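(* There is a Local Computation Algorithm (LCA) for the Maximal Independent Set problem that, on any $n$-node graph of maximum degree at most $\Delta$, with probability at least $1-1/n^{10}$ computes a Maximal Independent Set, and has query complexity $\Delta^{O(\sqrt{\log\Delta})}\cdot\log n$.
   Context: In the LCA model, the algorithm has query access to the input graph $G=(V,E)$: a query to a node $v$ returns the identifiers of all neighbors of $v$. The algorithm also has access to a shared string of random bits. When asked about a node $v\in V$, the LCA must answer whether $v$ is in the Maximal Independent Set, and the answers over all $v\in V$ must be consistent with one single Maximal Independent Set of $G$. The query complexity is the maximum number of queries to $G$ made to answer a single question about one node. *)

theory Defs
  imports
    "HOL-Probability.Probability"
    "HOL-Library.Landau_Symbols"
    "Graph_Theory.Pair_Digraph"
begin

text \<open>
  Input graphs are finite simple undirected graphs, i.e. \<open>pair_graph\<close> from \<open>Graph_Theory\<close>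
  (symmetric loop-free arc relation). Vertices are their own identifiers: the vertex set is an
  arbitrary finite set of natural numbers, not necessarily an initial segment.
\<close>

definition neighbors :: "'a pair_pre_digraph \<Rightarrow> 'a \<Rightarrow> 'a set" where
  "neighbors G v = {u. (v, u) \<in> parcs G}"

definition max_degree_at_most :: "'a pair_pre_digraph \<Rightarrow> nat \<Rightarrow> bool" where
  "max_degree_at_most G \<Delta> \<longleftrightarrow> (\<forall>v\<in>pverts G. card (neighbors G v) \<le> \<Delta>)"

definition independent_set :: "'a pair_pre_digraph \<Rightarrow> 'a set \<Rightarrow> bool" where
  "independent_set G I \<longleftrightarrow> I \<subseteq> pverts G \<and> (\<forall>u\<in>I. \<forall>v\<in>I. (u, v) \<notin> parcs G)"

definition maximal_independent_set :: "'a pair_pre_digraph \<Rightarrow> 'a set \<Rightarrow> bool" where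
  "maximal_independent_set G I \<longleftrightarrow>
     independent_set G I \<and> (\<forall>J. independent_set G J \<and> I \<subseteq> J \<longrightarrow> J = I)"

text \<open>
  The computation that answers one question is an adaptive decision tree. It has no access to the
  graph except through \<open>Query\<close>, whose continuation receives the set of identifiers of the neighbors
  of the queried node. It reads the bit of the shared random string at a given position through
  \<open>ReadBit\<close>. As the datatype is inductive, every run terminates after finitely many steps. Local
  computation between these steps is unrestricted and free, since only graph queries are counted.
\<close>

datatype local_computation =
    Answer bool
  | Query nat "nat set \<Rightarrow> local_computation"
  | ReadBit nat "bool \<Rightarrow> local_computation"

primrec answer :: "nat pair_pre_digraph \<Rightarrow> (nat \<Rightarrow> bool) \<Rightarrow> local_computation \<Rightarrow> bool" where
  "answer G r (Answer b) = b"
| "answer G r (Query v k) = answer G r (k (neighbors G v))"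
| "answer G r (ReadBit i k) = answer G r (k (r i))"

primrec num_queries :: "nat pair_pre_digraph \<Rightarrow> (nat \<Rightarrow> bool) \<Rightarrow> local_computation \<Rightarrow> nat" where
  "num_queries G r (Answer b) = 0"
| "num_queries G r (Query v k) = Suc (num_queries G r (k (neighbors G v)))"
| "num_queries G r (ReadBit i k) = num_queries G r (k (r i))"

text \<open>
  An LCA maps the node it is asked about to a computation. It keeps no state between questions;
  different questions share only the random string.
\<close>

type_synonym lca = "nat \<Rightarrow> local_computation"

definition lca_output :: "lca \<Rightarrow> nat pair_pre_digraph \<Rightarrow> (nat \<Rightarrow> bool) \<Rightarrow> nat set" where
  "lca_output A G r = {v \<in> pverts G. answer G r (A v)}"

text \<open>The maximum is over all nodes asked about and all random strings, without exception.\<close>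

definition query_complexity :: "lca \<Rightarrow> nat pair_pre_digraph \<Rightarrow> enat" where
  "query_complexity A G = (SUP v\<in>pverts G. SUP r. enat (num_queries G r (A v)))"

text \<open>The shared random string: an infinite sequence of independent fair coin flips.\<close>

definition random_bits :: "(nat \<Rightarrow> bool) measure" where
  "random_bits = Pi\<^sub>M UNIV (\<lambda>_. measure_pmf (bernoulli_pmf (1/2)))"

end

theory Submission
  imports Defs
begin

text \<open>
  The algorithm simulates a variant of Ghaffari's process: every undecided node marks itself with its
  current probability, joins the independent set if it is marked and no neighbor is, and then halves
  its probability if it saw a marked neighbor and doubles it (up to \<open>1/2\<close>) otherwise. For each node
  \<open>v\<close> there is a potential, a product of small powers of the inverse marking probability of \<open>v\<close> and of the
  expected number of marked neighbors of \<open>v\<close>, whose expectation shrinks by a constant factor in every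
  round, where only coins within distance two of \<open>v\<close> matter. Hence after \<open>O(log \<Delta>)\<close> rounds nodes at
  pairwise distance at least five are all undecided with probability at most \<open>\<Delta>\<^sup>-\<^sup>c\<close> to the power of their
  number, and a union bound over walks shows that the components of undecided nodes have size
  \<open>\<Delta>\<^sup>O\<^sup>(\<^sup>1\<^sup>) log n\<close>. Such a component can be explored completely.

  To save queries, the rounds are grouped into \<open>O(sqrt (log \<Delta>))\<close> phases of \<open>R = \<Theta>(sqrt (log \<Delta>))\<close> rounds.
  A marking probability grows at most by \<open>2\<^sup>R\<close> in a phase, so that only the few neighbors whose coin
  succeeds with \<open>2\<^sup>R\<close> times their initial probability have to be followed. Nodes with a large expected
  number of marked neighbors at the beginning of a phase, or with too many such candidates in one
  round, merely halve their probability for the rest of the phase. A phase then multiplies the number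
  of queries by \<open>\<Delta>\<^sup>O\<^sup>(\<^sup>1\<^sup>) 2\<^sup>O\<^sup>(\<^sup>R\<^sup>*\<^sup>R\<^sup>) = \<Delta>\<^sup>O\<^sup>(\<^sup>1\<^sup>)\<close>.
\<close>

section \<open>Averages over finitely many fair bits\<close>

text \<open>The obstacle to a tail bound is correlation: the influence of a coin spreads by a
  constant distance per round, so after log \<Delta> rounds the fates of nodes at distance five are
  dependent. The potential avoids any claim about the whole history. Once the state before a round
  is fixed, separated nodes read disjoint coins of that round, so the expected product of their
  potentials contracts by a constant factor per node and round. Markov's inequality at the end turns
  this into a bound exponential in the number of nodes. Levels react to marks that are seen and not
  to the degree, because evaluating the degree in every round would need the states of all neighbors
  and cost a factor \<Delta> per round. The degree is computed only between phases. With K phases of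
  R rounds, K R has to be of order log \<Delta>, and the logarithm of the simulation cost is of
  order K (log \<Delta> + R^2). The two terms balance at R = sqrt (log \<Delta>).\<close>

text \<open>
  The subset of \<open>A\<close> consists of the positions at which the random string is true.
\<close>

definition avg :: "'b set \<Rightarrow> ('b set \<Rightarrow> real) \<Rightarrow> real" where
  "avg A f = (\<Sum>S\<in>Pow A. f S) / 2 ^ card A"

lemma avg_cong: "(\<And>S. S \<subseteq> A \<Longrightarrow> f S = g S) \<Longrightarrow> avg A f = avg A g"
  unfolding avg_def by (auto intro!: sum.cong)

lemma avg_mono: "(\<And>S. S \<subseteq> A \<Longrightarrow> f S \<le> g S) \<Longrightarrow> avg A f \<le> avg A g"
  unfolding avg_def by (auto intro!: divide_right_mono sum_mono)

lemma avg_add: "avg A (\<lambda>S. f S + g S) = avg A f + avg A g"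
  unfolding avg_def by (simp add: sum.distrib add_divide_distrib)

lemma avg_diff: "avg A (\<lambda>S. f S - g S) = avg A f - avg A g"
  unfolding avg_def by (simp add: sum_subtractf diff_divide_distrib)

lemma avg_cmult: "avg A (\<lambda>S. c * f S) = c * avg A f"
  unfolding avg_def by (simp add: sum_distrib_left)

lemma avg_cmult_right: "avg A (\<lambda>S. f S * c) = avg A f * c"
  unfolding avg_def by (simp add: sum_distrib_right)

lemma avg_divide: "avg A (\<lambda>S. f S / c) = avg A f / c"
  using avg_cmult_right[of A f "1/c"] by simp

lemma avg_const: "finite A \<Longrightarrow> avg A (\<lambda>S. c) = c"
  unfolding avg_def by (simp add: card_Pow)

lemma avg_sum: "avg A (\<lambda>S. \<Sum>i\<in>I. f i S) = (\<Sum>i\<in>I. avg A (f i))"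
  unfolding avg_def by (subst sum.swap) (simp add: sum_divide_distrib)

lemma avg_nonneg: "(\<And>S. S \<subseteq> A \<Longrightarrow> 0 \<le> f S) \<Longrightarrow> 0 \<le> avg A f"
  unfolding avg_def by (auto intro!: sum_nonneg divide_nonneg_nonneg)

lemma avg_union:
  assumes "finite A" "finite B" "A \<inter> B = {}"
  shows "avg (A \<union> B) f = avg A (\<lambda>S. avg B (\<lambda>T. f (S \<union> T)))"
proof -
  have bij: "bij_betw (\<lambda>(S, T). S \<union> T) (Pow A \<times> Pow B) (Pow (A \<union> B))"
    by (rule bij_betw_byWitness[where f' = "\<lambda>U. (U \<inter> A, U \<inter> B)"]) (use assms in auto)
  have "(\<Sum>U\<in>Pow (A \<union> B). f U) = (\<Sum>S\<in>Pow A. \<Sum>T\<in>Pow B. f (S \<union> T))"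
    using sum.reindex_bij_betw[OF bij, of f]
    by (simp add: sum.cartesian_product case_prod_unfold)
  then show ?thesis
    using assms by (simp add: avg_def card_Un_disjoint power_add sum_divide_distrib field_simps)
qed

lemma avg_depends:
  assumes "finite M" "A \<subseteq> M" "\<And>S. S \<subseteq> M \<Longrightarrow> f S = f (S \<inter> A)"
  shows "avg M f = avg A f"
proof -
  have M: "M = A \<union> (M - A)" using assms by auto
  have "avg M f = avg A (\<lambda>S. avg (M - A) (\<lambda>T. f (S \<union> T)))"
    by (subst M, subst avg_union) (use assms in \<open>auto intro: finite_subset\<close>)
  also have "\<dots> = avg A (\<lambda>S. avg (M - A) (\<lambda>T. f S))"
  proof (intro avg_cong)
    fix S T assume "S \<subseteq> A" "T \<subseteq> M - A"
    then have "(S \<union> T) \<inter> A = S" "S \<union> T \<subseteq> M" using assms by auto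
    then show "f (S \<union> T) = f S" using assms(3)[of "S \<union> T"] by simp
  qed
  finally show ?thesis using assms by (simp add: avg_const)
qed

text \<open>Splitting \<open>M\<close> into \<open>A\<close> and its complement turns the average
  into an iterated one in which each factor reads its own argument. Independent coins enter the
  estimates of a round through this rule and its product form.\<close>

lemma avg_mult:
  assumes "finite M" "A \<subseteq> M" "B \<subseteq> M" "A \<inter> B = {}"
    "\<And>S. S \<subseteq> M \<Longrightarrow> f S = f (S \<inter> A)" "\<And>S. S \<subseteq> M \<Longrightarrow> g S = g (S \<inter> B)"
  shows "avg M (\<lambda>S. f S * g S) = avg M f * avg M g"
proof -
  have M: "M = A \<union> (M - A)" using assms by auto
  have fin: "finite A" "finite (M - A)" using assms by (auto intro: finite_subset)
  have "avg M (\<lambda>S. f S * g S) = avg A (\<lambda>S. avg (M - A) (\<lambda>T. f (S \<union> T) * g (S \<union> T)))"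
    by (subst M, subst avg_union) (use fin in auto)
  also have "\<dots> = avg A (\<lambda>S. avg (M - A) (\<lambda>T. f S * g T))"
  proof (intro avg_cong)
    fix S T assume ST: "S \<subseteq> A" "T \<subseteq> M - A"
    then have "(S \<union> T) \<inter> A = S" "(S \<union> T) \<inter> B = T \<inter> B" "S \<union> T \<subseteq> M" "T \<subseteq> M" using assms by auto
    then show "f (S \<union> T) * g (S \<union> T) = f S * g T"
      using assms(5)[of "S \<union> T"] assms(6)[of "S \<union> T"] assms(6)[of T] by simp
  qed
  also have "\<dots> = avg A f * avg (M - A) g"
    by (simp add: avg_cmult avg_cmult_right)
  also have "avg A f = avg M f" using avg_depends[of M A f] assms by simp
  also have "avg (M - A) g = avg M g"
  proof (rule avg_depends[symmetric])
    fix S assume "S \<subseteq> M"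
    have eq: "S \<inter> (M - A) \<inter> B = S \<inter> B" using assms by auto
    have "S \<inter> (M - A) \<subseteq> M" by auto
    then show "g S = g (S \<inter> (M - A))"
      using assms(6)[of S] assms(6)[of "S \<inter> (M - A)"] \<open>S \<subseteq> M\<close> eq by simp
  qed (use assms in auto)
  finally show ?thesis .
qed

lemma avg_prod:
  assumes "finite M" "finite I" "\<And>i. i \<in> I \<Longrightarrow> A i \<subseteq> M" "disjoint_family_on A I"
    "\<And>i S. i \<in> I \<Longrightarrow> S \<subseteq> M \<Longrightarrow> f i S = f i (S \<inter> A i)"
  shows "avg M (\<lambda>S. \<Prod>i\<in>I. f i S) = (\<Prod>i\<in>I. avg M (f i))"
  using assms(2-)
proof (induction I rule: finite_induct)
  case empty
  then show ?case using \<open>finite M\<close> by (simp add: avg_const)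
next
  case (insert i I)
  have "avg M (\<lambda>S. f i S * (\<Prod>i\<in>I. f i S)) = avg M (f i) * avg M (\<lambda>S. \<Prod>i\<in>I. f i S)"
  proof (rule avg_mult[where A = "A i" and B = "\<Union>i\<in>I. A i"])
    show "A i \<inter> (\<Union>i\<in>I. A i) = {}"
      using insert.prems(2) insert.hyps by (auto simp: disjoint_family_on_def)
    fix S assume S: "S \<subseteq> M"
    show "f i S = f i (S \<inter> A i)" using insert.prems S by auto
    show "(\<Prod>i\<in>I. f i S) = (\<Prod>j\<in>I. f j (S \<inter> (\<Union>i\<in>I. A i)))"
    proof (rule prod.cong)
      fix j assume j: "j \<in> I"
      have "S \<inter> (\<Union>i\<in>I. A i) \<inter> A j = S \<inter> A j" "S \<inter> (\<Union>i\<in>I. A i) \<subseteq> M" using j S by auto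
      then show "f j S = f j (S \<inter> (\<Union>i\<in>I. A i))"
        using insert.prems(3)[of j S] insert.prems(3)[of j "S \<inter> (\<Union>i\<in>I. A i)"] j S by auto
    qed simp
  qed (use insert.prems assms(1) in auto)
  moreover have "avg M (\<lambda>S. \<Prod>i\<in>I. f i S) = (\<Prod>i\<in>I. avg M (f i))"
    using insert.prems by (intro insert.IH) (auto simp: disjoint_family_on_def)
  ultimately show ?case using insert.hyps by simp
qed

lemma avg_all_heads:
  assumes "finite M" "A \<subseteq> M"
  shows "avg M (\<lambda>S. of_bool (A \<subseteq> S)) = (1/2) ^ card A"
proof -
  have "avg M (\<lambda>S. of_bool (A \<subseteq> S)) = avg A (\<lambda>S. of_bool (A \<subseteq> S))"
    by (rule avg_depends) (use assms in auto)
  also have "\<dots> = (\<Sum>S\<in>Pow A. of_bool (S = A)) / 2 ^ card A"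
    unfolding avg_def by (intro arg_cong2[where f = "(/)"] sum.cong) auto
  also have "(\<Sum>S\<in>Pow A. of_bool (S = A) :: real) = 1"
    using assms by (simp add: of_bool_def if_distrib sum.delta finite_subset)
  finally show ?thesis by (simp add: power_divide)
qed

section \<open>Events that depend on finitely many random bits\<close>

lemma prob_space_random_bits: "prob_space random_bits"
  unfolding random_bits_def
  by (intro prob_space_PiM measure_pmf.prob_space_axioms)

lemma space_random_bits: "space random_bits = UNIV"
  unfolding random_bits_def by (auto simp: space_PiM)

lemma measurable_bit: "{r. r i} \<in> sets random_bits"
proof -
  have "(\<lambda>r. r i) \<in> measurable random_bits (measure_pmf (bernoulli_pmf (1/2)))"
    unfolding random_bits_def by (rule measurable_component_singleton) simp
  then have "(\<lambda>r. r i) -` {True} \<inter> space random_bits \<in> sets random_bits"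
    by (rule measurable_sets) simp
  moreover have "(\<lambda>r. r i) -` {True} \<inter> space random_bits = {r. r i}"
    by (auto simp: space_random_bits)
  ultimately show ?thesis by simp
qed

lemma random_bits_cylinder:
  assumes "finite J" "S \<subseteq> J"
  shows "{r. {i\<in>J. r i} = S} \<in> sets random_bits"
    "measure random_bits {r. {i\<in>J. r i} = S} = (1/2) ^ card J"
proof -
  interpret P: product_prob_space "\<lambda>_::nat. measure_pmf (bernoulli_pmf (1/2))" UNIV
    by unfold_locales
  have eq: "{r. {i\<in>J. r i} = S} =
     prod_emb UNIV (\<lambda>_. measure_pmf (bernoulli_pmf (1/2))) J (Pi\<^sub>E J (\<lambda>i. {i \<in> S}))"
    using assms by (auto simp: prod_emb_def PiE_iff space_PiM extensional_def restrict_def)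
  show "{r. {i\<in>J. r i} = S} \<in> sets random_bits"
    unfolding eq random_bits_def using assms by (intro sets_PiM_I) auto
  have "measure random_bits {r. {i\<in>J. r i} = S} =
     (\<Prod>i\<in>J. measure (measure_pmf (bernoulli_pmf (1/2))) {i \<in> S})"
    unfolding eq random_bits_def using assms by (intro P.measure_PiM_emb) auto
  also have "\<dots> = (\<Prod>i\<in>J. 1/2)"
  proof (rule prod.cong)
    fix i assume "i \<in> J"
    show "measure (measure_pmf (bernoulli_pmf (1/2))) {i \<in> S} = 1/2"
      by (cases "i \<in> S") (simp_all add: measure_pmf_single)
  qed simp
  finally show "measure random_bits {r. {i\<in>J. r i} = S} = (1/2) ^ card J" by simp
qed

text \<open>The event is a finite disjoint union of cylinders, one per pattern on \<open>J\<close>,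
  all of equal measure. Probability estimates thereby become finite sums without measurability
  conditions.\<close>

lemma measure_random_bits:
  assumes J: "finite J" and dep: "\<And>r. Q r \<longleftrightarrow> Q (\<lambda>i. i \<in> J \<and> r i)"
  shows "{r. Q r} \<in> sets random_bits"
    "measure random_bits {r. Q r} = avg J (\<lambda>S. of_bool (Q (\<lambda>i. i \<in> S)))"
proof -
  interpret prob_space random_bits by (rule prob_space_random_bits)
  let ?G = "{S \<in> Pow J. Q (\<lambda>i. i \<in> S)}"
  let ?C = "\<lambda>S. {r. {i\<in>J. r i} = S}"
  have fin: "finite ?G" using J by simp
  have eq: "{r. Q r} = (\<Union>S\<in>?G. ?C S)"
  proof -
    have "Q r \<longleftrightarrow> Q (\<lambda>i. i \<in> {i\<in>J. r i})" for r using dep[of r] by simp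
    then show ?thesis by auto
  qed
  have meas: "?C S \<in> sets random_bits" if "S \<in> ?G" for S
    using random_bits_cylinder(1)[OF J] that by auto
  show "{r. Q r} \<in> sets random_bits"
    unfolding eq by (intro sets.finite_UN fin meas)
  have "measure random_bits {r. Q r} = (\<Sum>S\<in>?G. measure random_bits (?C S))"
    unfolding eq by (intro finite_measure_finite_Union fin) (use meas in \<open>auto simp: disjoint_family_on_def\<close>)
  also have "\<dots> = (\<Sum>S\<in>?G. (1/2) ^ card J)"
    by (intro sum.cong) (use random_bits_cylinder(2)[OF J] in auto)
  also have "\<dots> = (\<Sum>S\<in>Pow J. of_bool (Q (\<lambda>i. i \<in> S)) * (1/2) ^ card J)"
    using J by (intro sum.mono_neutral_cong_left) auto
  finally show "measure random_bits {r. Q r} = avg J (\<lambda>S. of_bool (Q (\<lambda>i. i \<in> S)))"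
    by (simp add: avg_def sum_divide_distrib power_divide sum_distrib_right)
qed

section \<open>One round of the process\<close>

datatype status = Und | In | Out

text \<open>
  A node of level \<open>l\<close> marks itself with probability \<open>2\<^sup>-\<^sup>l\<close>. A dormant node (\<open>dor\<close>) does not take part in the rest of
  the phase. In a round, \<open>h u l\<close> is a coin of \<open>u\<close> that succeeds with probability \<open>2\<^sup>-\<^sup>l\<close>; it is antitone in
  \<open>l\<close>. Throughout, \<open>\<sigma>0\<close> is the state at the beginning of the current phase of \<open>R\<close> rounds.
\<close>

datatype node = Node (lev: nat) (dor: bool) (stat: status)

text \<open>
  Levels drop by at most \<open>R\<close> during a phase, so only candidates can be marked; they can be found
  without knowing the current state of the neighbors.
\<close>

definition cand :: "nat \<Rightarrow> (nat \<Rightarrow> nat \<Rightarrow> bool) \<Rightarrow> (nat \<Rightarrow> node) \<Rightarrow> nat \<Rightarrow> bool" where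
  "cand R h \<sigma>0 u \<longleftrightarrow> stat (\<sigma>0 u) = Und \<and> h u (lev (\<sigma>0 u) - R)"

text \<open>A node that starts the phase with degree at most 4^R expects at most 2^R 4^R = 2^(3R)
  candidates in a round. The threshold exceeds this by a factor 2^(3R), which outweighs the cost 4^R
  of falling dormant.\<close>

definition over :: "(nat \<Rightarrow> nat set) \<Rightarrow> nat \<Rightarrow> (nat \<Rightarrow> nat \<Rightarrow> bool) \<Rightarrow> (nat \<Rightarrow> node) \<Rightarrow> nat \<Rightarrow> bool" where
  "over N R h \<sigma>0 v \<longleftrightarrow> 2 ^ (6 * R) < card {u \<in> N v. cand R h \<sigma>0 u}"

definition mark :: "nat \<Rightarrow> (nat \<Rightarrow> nat \<Rightarrow> bool) \<Rightarrow> (nat \<Rightarrow> node) \<Rightarrow> (nat \<Rightarrow> node) \<Rightarrow> nat \<Rightarrow> bool" where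
  "mark R h \<sigma>0 \<sigma> u \<longleftrightarrow> cand R h \<sigma>0 u \<and> stat (\<sigma> u) = Und \<and> \<not> dor (\<sigma> u) \<and> h u (lev (\<sigma> u))"

definition seen ::
  "(nat \<Rightarrow> nat set) \<Rightarrow> nat \<Rightarrow> (nat \<Rightarrow> nat \<Rightarrow> bool) \<Rightarrow> (nat \<Rightarrow> node) \<Rightarrow> (nat \<Rightarrow> node) \<Rightarrow> nat \<Rightarrow> bool" where
  "seen N R h \<sigma>0 \<sigma> v \<longleftrightarrow> (\<exists>u\<in>N v. mark R h \<sigma>0 \<sigma> u)"

definition join ::
  "(nat \<Rightarrow> nat set) \<Rightarrow> nat \<Rightarrow> (nat \<Rightarrow> nat \<Rightarrow> bool) \<Rightarrow> (nat \<Rightarrow> node) \<Rightarrow> (nat \<Rightarrow> node) \<Rightarrow> nat \<Rightarrow> bool" where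
  "join N R h \<sigma>0 \<sigma> v \<longleftrightarrow> mark R h \<sigma>0 \<sigma> v \<and> \<not> seen N R h \<sigma>0 \<sigma> v \<and> \<not> over N R h \<sigma>0 v"

definition nlev ::
  "(nat \<Rightarrow> nat set) \<Rightarrow> nat \<Rightarrow> (nat \<Rightarrow> nat \<Rightarrow> bool) \<Rightarrow> (nat \<Rightarrow> node) \<Rightarrow> (nat \<Rightarrow> node) \<Rightarrow> nat \<Rightarrow> nat" where
  "nlev N R h \<sigma>0 \<sigma> v =
     (if dor (\<sigma> v) \<or> over N R h \<sigma>0 v \<or> seen N R h \<sigma>0 \<sigma> v then lev (\<sigma> v) + 1 else max 1 (lev (\<sigma> v) - 1))"

text \<open>A dormant node does not learn that a neighbor has joined, as this would require
  following its marked neighbors. Its status stays \<open>Und\<close> until \<open>sync\<close>,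
  while \<open>removed\<close> already counts it as gone.\<close>

definition mis_round ::
  "(nat \<Rightarrow> nat set) \<Rightarrow> nat \<Rightarrow> (nat \<Rightarrow> nat \<Rightarrow> bool) \<Rightarrow> (nat \<Rightarrow> node) \<Rightarrow> (nat \<Rightarrow> node) \<Rightarrow> nat \<Rightarrow> node" where
  "mis_round N R h \<sigma>0 \<sigma> v =
     (if stat (\<sigma> v) \<noteq> Und then \<sigma> v
      else if dor (\<sigma> v) \<or> over N R h \<sigma>0 v then Node (lev (\<sigma> v) + 1) True Und
      else Node (nlev N R h \<sigma>0 \<sigma> v) False
        (if join N R h \<sigma>0 \<sigma> v then In else if \<exists>u\<in>N v. join N R h \<sigma>0 \<sigma> u then Out else Und))"

definition deg :: "(nat \<Rightarrow> nat set) \<Rightarrow> (nat \<Rightarrow> node) \<Rightarrow> nat \<Rightarrow> real" where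
  "deg N \<sigma> v = (\<Sum>u\<in>{u \<in> N v. stat (\<sigma> u) = Und}. (1/2) ^ lev (\<sigma> u))"

definition sync :: "(nat \<Rightarrow> nat set) \<Rightarrow> nat \<Rightarrow> (nat \<Rightarrow> node) \<Rightarrow> nat \<Rightarrow> node" where
  "sync N R \<sigma> v = Node (lev (\<sigma> v)) (4 ^ R < deg N \<sigma> v)
     (if stat (\<sigma> v) = Und \<and> (\<exists>u\<in>N v. stat (\<sigma> u) = In) then Out else stat (\<sigma> v))"

definition removed :: "(nat \<Rightarrow> nat set) \<Rightarrow> (nat \<Rightarrow> node) \<Rightarrow> nat \<Rightarrow> bool" where
  "removed N \<sigma> v \<longleftrightarrow> stat (\<sigma> v) \<noteq> Und \<or> (\<exists>u\<in>N v. stat (\<sigma> u) = In)"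

text \<open>
  A dormant node has to raise its level in every remaining round even if its degree has become
  small. The floor \<open>4\<^sup>R (3/4)\<^sup>j\<close> pays for this: it shrinks by a constant factor in each round \<open>j\<close> of
  the phase and is still at least \<open>3\<^sup>R\<close> at the end.
\<close>

definition psi :: "nat \<Rightarrow> nat \<Rightarrow> bool \<Rightarrow> real \<Rightarrow> real" where
  "psi R j dm x = max x (if dm then 4 ^ R * (3/4) ^ j else 1/16)"

text \<open>The exponent balances the factors. A rising level costs a factor 1 + \<alpha>; when
  \<open>psi\<close> falls to 3/4 of its value, its power falls to at most 1 - 8 \<alpha> / 4 = 1 -
  2 \<alpha>, which pays for that with \<alpha> to spare.\<close>

definition pot :: "(nat \<Rightarrow> nat set) \<Rightarrow> nat \<Rightarrow> real \<Rightarrow> nat \<Rightarrow> (nat \<Rightarrow> node) \<Rightarrow> nat \<Rightarrow> real" where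
  "pot N R \<alpha> j \<sigma> v =
     (if removed N \<sigma> v then 0
      else (1 + \<alpha>) ^ lev (\<sigma> v) * psi R j (dor (\<sigma> v)) (deg N \<sigma> v) powr (8 * \<alpha>))"

lemma floor_ge_1: "(1::real) \<le> 4 ^ R * (3/4) ^ j" if "j \<le> R"
proof -
  have "(1::real) \<le> 3 ^ R" by simp
  also have "(3::real) ^ R = 4 ^ R * (3/4) ^ R" by (simp flip: power_mult_distrib)
  also have "\<dots> \<le> 4 ^ R * (3/4) ^ j" using that by (intro mult_left_mono power_decreasing) auto
  finally show ?thesis .
qed

lemma psi_pos: "1/16 \<le> psi R j dm x" "x \<le> psi R j dm x" if "j \<le> R"
  using floor_ge_1[OF that] unfolding psi_def by auto

locale nbr_graph =
  fixes V :: "nat set" and N :: "nat \<Rightarrow> nat set"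
  assumes finite_V: "finite V"
    and N_subset: "N v \<subseteq> V"
    and N_sym: "u \<in> N v \<Longrightarrow> v \<in> N u"
    and N_irrefl: "v \<notin> N v"
begin

lemma finite_N: "finite (N v)"
  using finite_V N_subset finite_subset by blast

end

text \<open>Weighted AM-GM for \<open>y\<close> and 1. It linearizes the power in the potential, so
  that only the average of a ratio has to be bounded.\<close>

lemma powr_le_linear:
  fixes y b :: real
  assumes "0 \<le> y" "0 < b" "b \<le> 1"
  shows "y powr b \<le> 1 + b * (y - 1)"
proof (cases "y = 0")
  case False
  have "y powr b * 1 powr (1 - b) \<le> b * y + (1 - b) * 1"
    by (rule Youngs_inequality_0) (use assms False in auto)
  then show ?thesis by (simp add: algebra_simps)
qed (use assms in auto)

text \<open>Discarding elements one by one lowers the sum by at most \<open>e\<close> at a time, so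
  it cannot leap over a window of width \<open>e\<close>.\<close>

lemma subset_sum_between:
  fixes q :: "'a \<Rightarrow> real"
  assumes "finite L" "\<And>u. u \<in> L \<Longrightarrow> 0 \<le> q u \<and> q u \<le> e" "m \<le> sum q L" "0 \<le> m" "0 \<le> e"
  shows "\<exists>L'\<subseteq>L. m \<le> sum q L' \<and> sum q L' \<le> m + e"
  using assms
proof (induction L rule: finite_induct)
  case (insert x L)
  show ?case
  proof (cases "m \<le> sum q L")
    case True
    then show ?thesis using insert by (meson insertCI subset_insertI2)
  next
    case False
    then have "sum q (insert x L) \<le> m + e" using insert by force
    then show ?thesis using insert by blast
  qed
qed auto

text \<open>The history is frozen: \<sigma>0 and \<sigma> are any states with the invariants of the
  process, and only the coins of the current round are averaged over. The bound \<open>L\<close> on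
  the levels keeps these coins finite in number.\<close>

locale one_round = nbr_graph +
  fixes R L :: nat and pos :: "nat \<Rightarrow> nat \<Rightarrow> nat" and \<sigma>0 \<sigma> :: "nat \<Rightarrow> node"
  assumes inj_pos: "pos u i = pos w k \<Longrightarrow> u = w \<and> i = k"
    and lev_ge_1: "u \<in> V \<Longrightarrow> 1 \<le> lev (\<sigma> u)"
    and lev_le: "u \<in> V \<Longrightarrow> lev (\<sigma> u) \<le> L"
    and lev0_le: "u \<in> V \<Longrightarrow> lev (\<sigma>0 u) \<le> L"
    and lev_ge: "u \<in> V \<Longrightarrow> lev (\<sigma>0 u) - R \<le> lev (\<sigma> u)"
    and Und0: "u \<in> V \<Longrightarrow> stat (\<sigma> u) = Und \<Longrightarrow> stat (\<sigma>0 u) = Und"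
    and deg0_le: "u \<in> V \<Longrightarrow> stat (\<sigma> u) = Und \<Longrightarrow> \<not> dor (\<sigma> u) \<Longrightarrow> deg N \<sigma>0 u \<le> 4 ^ R"
begin

definition "atoms u = pos u ` {..<L}"
definition "At = (\<Union>u\<in>V. atoms u)"
definition h :: "nat set \<Rightarrow> nat \<Rightarrow> nat \<Rightarrow> bool" where "h c u l = (\<forall>i<l. pos u i \<in> c)"
definition "act u \<longleftrightarrow> stat (\<sigma> u) = Und \<and> \<not> dor (\<sigma> u)"
definition q :: "nat \<Rightarrow> real" where "q u = (if act u then (1/2) ^ lev (\<sigma> u) else 0)"

abbreviation "ovr c \<equiv> over N R (h c) \<sigma>0"
abbreviation "mrk c \<equiv> mark R (h c) \<sigma>0 \<sigma>"
abbreviation "sen c \<equiv> seen N R (h c) \<sigma>0 \<sigma>"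
abbreviation "jn c \<equiv> join N R (h c) \<sigma>0 \<sigma>"
abbreviation "nlv c \<equiv> nlev N R (h c) \<sigma>0 \<sigma>"

lemma N_V: "u \<in> N v \<Longrightarrow> u \<in> V" using N_subset by auto

lemma finite_At: "finite At" unfolding At_def atoms_def using finite_V by auto

lemma atoms_subset: "u \<in> V \<Longrightarrow> atoms u \<subseteq> At" unfolding At_def by auto

lemma atoms_disjoint: "u \<noteq> w \<Longrightarrow> atoms u \<inter> atoms w = {}"
  unfolding atoms_def using inj_pos by blast

lemma h_prob:
  assumes "u \<in> V" "l \<le> L"
  shows "avg At (\<lambda>c. of_bool (h c u l)) = (1/2) ^ l"
proof -
  have "avg At (\<lambda>c. of_bool (pos u ` {..<l} \<subseteq> c)) = (1/2) ^ card (pos u ` {..<l})"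
  proof (rule avg_all_heads[OF finite_At])
    have "pos u ` {..<l} \<subseteq> atoms u" unfolding atoms_def using assms(2) by (intro image_mono) auto
    then show "pos u ` {..<l} \<subseteq> At" using atoms_subset[OF assms(1)] by blast
  qed
  moreover have "card (pos u ` {..<l}) = l"
    by (subst card_image) (auto intro!: inj_onI dest: inj_pos)
  moreover have "h c u l \<longleftrightarrow> pos u ` {..<l} \<subseteq> c" for c unfolding h_def by auto
  ultimately show ?thesis by simp
qed

lemma h_restrict: "l \<le> L \<Longrightarrow> atoms u \<subseteq> A \<Longrightarrow> h (c \<inter> A) u l = h c u l"
  unfolding h_def atoms_def by (auto simp: image_subset_iff)

lemma h_antimono: "l \<le> l' \<Longrightarrow> h c u l' \<Longrightarrow> h c u l"
  unfolding h_def by auto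

text \<open>The same bits serve all levels, so success at the current level implies success at the
  lower level \<open>lev (\<sigma>0 u) - R\<close>, which makes \<open>u\<close> a candidate. Hence
  restricting marks to candidates does not change the marking probability.\<close>

lemma mrk_eq: "u \<in> V \<Longrightarrow> mrk c u \<longleftrightarrow> act u \<and> h c u (lev (\<sigma> u))"
  unfolding mark_def cand_def act_def using Und0 lev_ge h_antimono by blast

lemma cand_restrict: "u \<in> V \<Longrightarrow> atoms u \<subseteq> A \<Longrightarrow> cand R (h (c \<inter> A)) \<sigma>0 u = cand R (h c) \<sigma>0 u"
  unfolding cand_def using lev0_le[of u] by (subst h_restrict) auto

lemma mrk_restrict: "u \<in> V \<Longrightarrow> atoms u \<subseteq> A \<Longrightarrow> mrk (c \<inter> A) u = mrk c u"
  using lev_le by (simp add: mrk_eq h_restrict)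

lemma ovr_restrict: "(\<And>u. u \<in> N v \<Longrightarrow> atoms u \<subseteq> A) \<Longrightarrow> ovr (c \<inter> A) v = ovr c v"
  unfolding over_def using cand_restrict N_V by (metis (mono_tags, lifting) Collect_cong)

lemma sen_restrict: "(\<And>u. u \<in> N v \<Longrightarrow> atoms u \<subseteq> A) \<Longrightarrow> sen (c \<inter> A) v = sen c v"
  unfolding seen_def using mrk_restrict N_V by (metis (no_types, lifting))

lemma jn_restrict:
  "v \<in> V \<Longrightarrow> (\<And>u. u \<in> insert v (N v) \<Longrightarrow> atoms u \<subseteq> A) \<Longrightarrow> jn (c \<inter> A) v = jn c v"
  unfolding join_def using mrk_restrict[of v A c] sen_restrict[of v A c] ovr_restrict[of v A c] by auto

lemma nlv_restrict: "(\<And>u. u \<in> N v \<Longrightarrow> atoms u \<subseteq> A) \<Longrightarrow> nlv (c \<inter> A) v = nlv c v"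
  unfolding nlev_def using sen_restrict[of v A c] ovr_restrict[of v A c] by auto

section \<open>Probabilities of marks, of unmarked sets and of too many candidates\<close>

lemma mrk_prob: "u \<in> V \<Longrightarrow> avg At (\<lambda>c. of_bool (mrk c u)) = q u"
  using h_prob[OF _ lev_le] lev_le unfolding q_def by (auto simp: mrk_eq avg_const finite_At)

lemma q_bounds: "u \<in> V \<Longrightarrow> 0 \<le> q u \<and> q u \<le> 1/2"
  using lev_ge_1[of u] power_decreasing[of 1 "lev (\<sigma> u)" "1/2::real"] unfolding q_def by auto

lemma no_mrk_prod:
  assumes "W \<subseteq> V"
  shows "of_bool (\<forall>w\<in>W. \<not> mrk c w) = (\<Prod>w\<in>W. 1 - of_bool (mrk c w) :: real)"
proof -
  have "finite W" using assms finite_V finite_subset by blast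
  then show ?thesis by (induction W) auto
qed

lemma no_mrk_prob:
  assumes "W \<subseteq> V"
  shows "avg At (\<lambda>c. of_bool (\<forall>w\<in>W. \<not> mrk c w)) = (\<Prod>w\<in>W. 1 - q w)"
proof -
  have "finite W" using assms finite_V finite_subset by blast
  have "avg At (\<lambda>c. \<Prod>w\<in>W. 1 - of_bool (mrk c w) :: real) = (\<Prod>w\<in>W. avg At (\<lambda>c. 1 - of_bool (mrk c w)))"
    by (rule avg_prod[where A = atoms])
      (use assms \<open>finite W\<close> finite_At atoms_subset atoms_disjoint mrk_restrict in
        \<open>auto simp: disjoint_family_on_def subset_iff\<close>)
  also have "\<dots> = (\<Prod>w\<in>W. 1 - q w)"
    by (intro prod.cong) (use assms in \<open>auto simp: avg_diff mrk_prob avg_const finite_At\<close>)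
  finally show ?thesis by (simp add: no_mrk_prod[OF assms])
qed

lemma no_mrk_le:
  assumes "W \<subseteq> V"
  shows "avg At (\<lambda>c. of_bool (\<forall>w\<in>W. \<not> mrk c w)) \<le> exp (- sum q W)"
proof -
  have fin: "finite W" using assms finite_V finite_subset by blast
  have "(\<Prod>w\<in>W. 1 - q w) \<le> (\<Prod>w\<in>W. exp (- q w))"
  proof (intro prod_mono conjI)
    fix w assume "w \<in> W"
    then show "0 \<le> 1 - q w" using q_bounds[of w] assms by auto
    show "1 - q w \<le> exp (- q w)" using exp_ge_add_one_self[of "- q w"] by simp
  qed
  then show ?thesis using fin by (simp add: no_mrk_prob[OF assms] exp_sum flip: sum_negf)
qed

text \<open>Levels are at least 1, so \<open>q\<close> is at most 1/2, and there 1 - x is at least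
  exp (- x - 2 x^2), hence at least exp (- 2 x).\<close>

lemma no_mrk_ge:
  assumes "W \<subseteq> V"
  shows "exp (- 2 * sum q W) \<le> (\<Prod>w\<in>W. 1 - q w)"
proof -
  have fin: "finite W" using assms finite_V finite_subset by blast
  have "(\<Prod>w\<in>W. exp (- 2 * q w)) \<le> (\<Prod>w\<in>W. 1 - q w)"
  proof (intro prod_mono conjI)
    fix w assume "w \<in> W"
    then have b: "0 \<le> q w" "q w \<le> 1/2" using q_bounds[of w] assms by auto
    have "2 * (q w)\<^sup>2 \<le> q w" using b mult_left_mono[of "q w" "1/2" "q w"] by (simp add: power2_eq_square)
    then have "- 2 * q w \<le> ln (1 - q w)"
      using ln_one_minus_pos_lower_bound[OF b] by simp
    then show "exp (- 2 * q w) \<le> 1 - q w"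
      using b by (simp add: ln_ge_iff)
  qed simp
  then show ?thesis using fin by (simp add: exp_sum sum_distrib_left flip: sum_negf)
qed

lemma cand_prob:
  assumes "u \<in> V"
  shows "avg At (\<lambda>c. of_bool (cand R (h c) \<sigma>0 u)) \<le> (if stat (\<sigma>0 u) = Und then 2 ^ R * (1/2) ^ lev (\<sigma>0 u) else 0)"
proof (cases "stat (\<sigma>0 u) = Und")
  case True
  let ?l = "lev (\<sigma>0 u)"
  have "(1/2::real) ^ (?l - R) \<le> 2 ^ R * (1/2) ^ ?l"
  proof (cases "R \<le> ?l")
    case True
    then show ?thesis by (simp add: power_diff power_divide)
  next
    \<comment> \<open>The truncated difference is 0 here: the coin always succeeds and the bound is
      at least 1.\<close>
    case False
    then have "2 ^ ?l \<le> (2::real) ^ R" by (intro power_increasing) auto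
    then show ?thesis using False by (simp add: power_divide field_simps)
  qed
  then show ?thesis using True h_prob[OF assms, of "?l - R"] lev0_le[OF assms] by (auto simp: cand_def)
qed (simp add: cand_def avg_const finite_At)

text \<open>Markov's inequality for the number of candidates, whose expectation is at most 2^R times
  the degree at the start of the phase.\<close>

lemma ovr_prob:
  assumes "u \<in> V" "stat (\<sigma> u) = Und" "\<not> dor (\<sigma> u)"
  shows "avg At (\<lambda>c. of_bool (ovr c u)) \<le> (1/2) ^ (3 * R)"
proof -
  let ?I = "\<lambda>c w. of_bool (cand R (h c) \<sigma>0 w) :: real"
  have "avg At (\<lambda>c. of_bool (ovr c u)) \<le> avg At (\<lambda>c. (\<Sum>w\<in>N u. ?I c w) / 2 ^ (6 * R))"
  proof (rule avg_mono)
    fix c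
    have eq: "(\<Sum>w\<in>N u. ?I c w) = real (card {w \<in> N u. cand R (h c) \<sigma>0 w})"
      using finite_N by (simp add: of_bool_def sum.If_cases Int_def)
    show "of_bool (ovr c u) \<le> (\<Sum>w\<in>N u. ?I c w) / 2 ^ (6 * R)"
    proof (cases "ovr c u")
      case True
      then have "2 ^ (6 * R) < real (card {w \<in> N u. cand R (h c) \<sigma>0 w})"
        unfolding over_def using of_nat_less_iff[where ?'a = real] by fastforce
      then show ?thesis using True by (simp add: eq)
    qed (simp add: sum_nonneg)
  qed
  also have "\<dots> = (\<Sum>w\<in>N u. avg At (\<lambda>c. ?I c w)) / 2 ^ (6 * R)"
    by (simp add: avg_divide avg_sum)
  also have "\<dots> \<le> (\<Sum>w\<in>N u. if stat (\<sigma>0 w) = Und then 2 ^ R * (1/2) ^ lev (\<sigma>0 w) else 0) / 2 ^ (6 * R)"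
    by (intro divide_right_mono sum_mono cand_prob N_V) auto
  also have "\<dots> = 2 ^ R * deg N \<sigma>0 u / 2 ^ (6 * R)"
    using finite_N by (simp add: deg_def sum.inter_filter sum_distrib_left if_distrib cong: if_cong)
  also have "\<dots> \<le> 2 ^ R * 4 ^ R / 2 ^ (6 * R)"
    using deg0_le[OF assms] by (intro divide_right_mono mult_left_mono) auto
  also have "\<dots> = (1/2) ^ (3 * R)"
  proof -
    have "(2::real) ^ R * 4 ^ R = 2 ^ (3 * R)"
      by (simp add: power_mult flip: power_mult_distrib)
    moreover have "(2::real) ^ (6 * R) = 2 ^ (3 * R) * 2 ^ (3 * R)"
      unfolding power_add[symmetric] by (rule arg_cong[where f = "power 2"]) simp
    ultimately show ?thesis unfolding power_one_over by (metis nonzero_divide_mult_cancel_left power_not_zero zero_neq_numeral)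
  qed
  finally show ?thesis .
qed

text \<open>\<open>ovr\<close> may read the same coins as the marks in \<open>W\<close>, so it is
  subtracted by a union bound. Each of the two terms factors by itself, because \<open>u\<close>
  lies neither in \<open>W\<close> nor in \<open>N u\<close>.\<close>

lemma isolated_prob:
  assumes u: "u \<in> V" and W: "W \<subseteq> V" "u \<notin> W"
  shows "q u * (exp (- 2 * sum q W) - (1/2) ^ (3 * R))
    \<le> avg At (\<lambda>c. of_bool (mrk c u \<and> \<not> ovr c u \<and> (\<forall>w\<in>W. \<not> mrk c w)))"
proof (cases "act u")
  case False
  then show ?thesis by (simp add: q_def avg_nonneg)
next
  case True
  have WA: "(\<Union>w\<in>W. atoms w) \<subseteq> At" using W unfolding At_def by auto
  have NA: "(\<Union>w\<in>N u. atoms w) \<subseteq> At" using N_V unfolding At_def by auto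
  have "avg At (\<lambda>c. of_bool (mrk c u) * of_bool (\<forall>w\<in>W. \<not> mrk c w))
      = q u * (\<Prod>w\<in>W. 1 - q w)"
  proof (subst avg_mult[where A = "atoms u" and B = "\<Union>w\<in>W. atoms w"])
    have "atoms u \<inter> atoms w = {}" if "w \<in> W" for w using W that by (intro atoms_disjoint) auto
    then show "atoms u \<inter> (\<Union>w\<in>W. atoms w) = {}" by blast
    fix c
    have "mrk (c \<inter> (\<Union>w\<in>W. atoms w)) w = mrk c w" if "w \<in> W" for w
      using W that by (intro mrk_restrict) auto
    then show "of_bool (\<forall>w\<in>W. \<not> mrk c w) = (of_bool (\<forall>w\<in>W. \<not> mrk (c \<inter> (\<Union>w\<in>W. atoms w)) w) :: real)"
      by simp
    show "of_bool (mrk c u) = (of_bool (mrk (c \<inter> atoms u) u) :: real)"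
      using mrk_restrict[OF u, of "atoms u" c] by simp
  next
    show "avg At (\<lambda>c. of_bool (mrk c u)) * avg At (\<lambda>c. of_bool (\<forall>w\<in>W. \<not> mrk c w)) = q u * (\<Prod>w\<in>W. 1 - q w)"
      using mrk_prob[OF u] no_mrk_prob[OF W(1)] by simp
  qed (rule finite_At atoms_subset[OF u] WA)+
  moreover have "avg At (\<lambda>c. of_bool (mrk c u) * of_bool (ovr c u)) = q u * avg At (\<lambda>c. of_bool (ovr c u))"
  proof (subst avg_mult[where A = "atoms u" and B = "\<Union>w\<in>N u. atoms w"])
    have "atoms u \<inter> atoms w = {}" if "w \<in> N u" for w using N_irrefl that by (intro atoms_disjoint) auto
    then show "atoms u \<inter> (\<Union>w\<in>N u. atoms w) = {}" by blast
    fix c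
    have "ovr (c \<inter> (\<Union>w\<in>N u. atoms w)) u = ovr c u" by (intro ovr_restrict) auto
    then show "of_bool (ovr c u) = (of_bool (ovr (c \<inter> (\<Union>w\<in>N u. atoms w)) u) :: real)" by simp
    show "of_bool (mrk c u) = (of_bool (mrk (c \<inter> atoms u) u) :: real)"
      using mrk_restrict[OF u, of "atoms u" c] by simp
  next
    show "avg At (\<lambda>c. of_bool (mrk c u)) * avg At (\<lambda>c. of_bool (ovr c u)) = q u * avg At (\<lambda>c. of_bool (ovr c u))"
      using mrk_prob[OF u] by simp
  qed (rule finite_At atoms_subset[OF u] NA)+
  ultimately have eq: "avg At (\<lambda>c. of_bool (mrk c u) * of_bool (\<forall>w\<in>W. \<not> mrk c w) - of_bool (mrk c u) * of_bool (ovr c u))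
    = q u * ((\<Prod>w\<in>W. 1 - q w) - avg At (\<lambda>c. of_bool (ovr c u)))"
    by (simp only: avg_diff right_diff_distrib)
  have "q u * (exp (- 2 * sum q W) - (1/2) ^ (3 * R)) \<le> q u * ((\<Prod>w\<in>W. 1 - q w) - avg At (\<lambda>c. of_bool (ovr c u)))"
  proof (rule mult_left_mono)
    have "avg At (\<lambda>c. of_bool (ovr c u)) \<le> (1/2) ^ (3 * R)"
      using ovr_prob[OF u] True by (simp add: act_def)
    then show "exp (- 2 * sum q W) - (1/2) ^ (3 * R) \<le> (\<Prod>w\<in>W. 1 - q w) - avg At (\<lambda>c. of_bool (ovr c u))"
      using no_mrk_ge[OF W(1)] by linarith
  qed (use q_bounds[OF u] in simp)
  also have "\<dots> \<le> avg At (\<lambda>c. of_bool (mrk c u \<and> \<not> ovr c u \<and> (\<forall>w\<in>W. \<not> mrk c w)))"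
    unfolding eq[symmetric]
  proof (rule avg_mono)
    fix c
    show "of_bool (mrk c u) * of_bool (\<forall>w\<in>W. \<not> mrk c w) - of_bool (mrk c u) * of_bool (ovr c u)
        \<le> (of_bool (mrk c u \<and> \<not> ovr c u \<and> (\<forall>w\<in>W. \<not> mrk c w)) :: real)"
      by (cases "mrk c u"; cases "ovr c u"; cases "\<forall>w\<in>W. \<not> mrk c w") (simp_all only: of_bool_def if_True if_False simp_thms, simp_all)
  qed
  finally show ?thesis .
qed

text \<open>The threshold 8 serves both sides: a light node finds its neighborhood unmarked with at
  least constant probability, while an active node that is not light sees no mark with probability
  at most exp (-8), below 1/256, and otherwise halves.\<close>

definition light :: "nat \<Rightarrow> bool" where "light u \<longleftrightarrow> act u \<and> sum q (N u) < 8"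

definition gone :: "nat set \<Rightarrow> nat \<Rightarrow> bool" where "gone c v \<longleftrightarrow> jn c v \<or> (\<exists>u\<in>N v. jn c u)"

definition ndeg :: "nat set \<Rightarrow> nat \<Rightarrow> real" where
  "ndeg c v = (\<Sum>u\<in>{u \<in> N v. stat (\<sigma> u) = Und}. (1/2) ^ nlv c u)"

text \<open>The true potential after the round depends on the new statuses of the neighbors, hence
  on joins at distance two and coins at distance three. Keeping in \<open>ndeg\<close> all neighbors
  that were undecided before the round removes this dependence and can only increase the
  value.\<close>

definition next_pot :: "real \<Rightarrow> nat \<Rightarrow> nat \<Rightarrow> nat set \<Rightarrow> real" where
  "next_pot \<alpha> j v c = (if removed N \<sigma> v \<or> gone c v then 0
     else (1 + \<alpha>) ^ nlv c v * psi R (j + 1) (dor (\<sigma> v) \<or> ovr c v) (ndeg c v) powr (8 * \<alpha>))"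

section \<open>Golden rounds: removal with constant probability\<close>

lemma exp_18_le: "exp (-18) \<le> (1/4::real)"
proof -
  have "exp (-18) \<le> exp (-2::real)" by simp
  also have "exp (-2::real) = (exp (-1))\<^sup>2" by (simp add: power2_eq_square flip: exp_add)
  also have "\<dots> \<le> (1/2)\<^sup>2"
    using exp_ge_add_one_self[of 1] by (intro power_mono) (auto simp: exp_minus field_simps)
  finally show ?thesis by (simp add: power2_eq_square)
qed

text \<open>
  Light neighbors are marked in isolation with probability proportional to their marking
  probability; these events are disjoint when marks inside the chosen set \<open>L'\<close> are excluded too.
\<close>

lemma golden_neighbours:
  assumes v: "v \<in> V" and R: "(1/2) ^ (3 * R) \<le> exp (-18) / (2::real)"
    and mass: "1/192 \<le> sum q {u \<in> N v. light u}"
  shows "exp (-18) / 384 \<le> avg At (\<lambda>c. of_bool (gone c v))"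
proof -
  obtain L' where L': "L' \<subseteq> {u \<in> N v. light u}" "1/192 \<le> sum q L'" "sum q L' \<le> 1/192 + 1/2"
    using subset_sum_between[of "{u \<in> N v. light u}" q "1/2" "1/192"] mass q_bounds N_V finite_N
    by auto
  have L'V: "L' \<subseteq> V" and fL: "finite L'" using L' N_V finite_N[of v] finite_subset by fastforce+
  define W where "W u = N u \<union> (L' - {u})" for u
  define E where "E u c \<longleftrightarrow> mrk c u \<and> \<not> ovr c u \<and> (\<forall>w\<in>W u. \<not> mrk c w)" for u c
  have "q u * (exp (-18) / 2) \<le> avg At (\<lambda>c. of_bool (E u c))" if u: "u \<in> L'" for u
  proof -
    have uV: "u \<in> V" and WV: "W u \<subseteq> V" "u \<notin> W u"
      using u L'V N_V N_irrefl unfolding W_def by auto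
    have "sum q (W u) \<le> sum q (N u) + sum q L'"
    proof -
      have "sum q (W u) \<le> sum q (N u) + sum q (L' - {u})"
        unfolding W_def using finite_N fL L'V q_bounds
        by (subst sum_Un) (auto intro!: sum_nonneg)
      also have "sum q (L' - {u}) \<le> sum q L'"
        using fL L'V q_bounds by (intro sum_mono2) auto
      finally show ?thesis by simp
    qed
    \<comment> \<open>Below 8 from lightness of \<open>u\<close>, and at most 1/192 + 1/2 from
      \<open>L'\<close>. Doubled in the exponent, 9 gives exp (-18).\<close>
    also have "\<dots> \<le> 9" using u L' by (auto simp: light_def)
    finally have "exp (-18) \<le> exp (- 2 * sum q (W u))" by simp
    then have "exp (-18) / 2 \<le> exp (- 2 * sum q (W u)) - (1/2) ^ (3 * R)" using R by linarith
    then have "q u * (exp (-18) / 2) \<le> q u * (exp (- 2 * sum q (W u)) - (1/2) ^ (3 * R))"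
      using q_bounds[OF uV] by (intro mult_left_mono) auto
    also have "\<dots> \<le> avg At (\<lambda>c. of_bool (E u c))"
      unfolding E_def using isolated_prob[OF uV WV] by simp
    finally show ?thesis .
  qed
  then have "(\<Sum>u\<in>L'. q u * (exp (-18) / 2)) \<le> (\<Sum>u\<in>L'. avg At (\<lambda>c. of_bool (E u c)))"
    by (rule sum_mono)
  also have "\<dots> = avg At (\<lambda>c. \<Sum>u\<in>L'. of_bool (E u c))" by (simp add: avg_sum)
  also have "\<dots> \<le> avg At (\<lambda>c. of_bool (gone c v))"
  proof (rule avg_mono)
    fix c
    show "(\<Sum>u\<in>L'. of_bool (E u c)) \<le> (of_bool (gone c v) :: real)"
    proof (cases "\<exists>u\<in>L'. E u c")
      case True
      then obtain u where u: "u \<in> L'" "E u c" by auto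
      have "\<not> E w c" if "w \<in> L'" "w \<noteq> u" for w
        using u that unfolding E_def W_def by auto
      then have "(\<Sum>w\<in>L'. of_bool (E w c)) = (\<Sum>w\<in>L'. if w = u then 1 else 0 :: real)"
        using u by (intro sum.cong) auto
      also have "\<dots> = 1" using u fL by simp
      finally have eq1: "(\<Sum>w\<in>L'. of_bool (E w c)) = (1::real)" .
      have "jn c u" using u unfolding E_def W_def join_def seen_def by auto
      then have "gone c v" using u L' unfolding gone_def by auto
      then show ?thesis using eq1 by simp
    next
      case False
      then have "(\<Sum>w\<in>L'. of_bool (E w c)) = (0::real)" by (intro sum.neutral) auto
      then show ?thesis by simp
    qed
  qed
  finally have "sum q L' * (exp (-18) / 2) \<le> avg At (\<lambda>c. of_bool (gone c v))"
    by (simp only: sum_distrib_right)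
  moreover have "1/192 * (exp (-18) / 2) \<le> sum q L' * (exp (-18) / (2::real))"
    using L' by (intro mult_right_mono) auto
  ultimately show ?thesis by linarith
qed

lemma sum_q_le_deg: "sum q (N v) \<le> deg N \<sigma> v"
proof -
  have "sum q (N v) \<le> (\<Sum>u\<in>N v. if stat (\<sigma> u) = Und then (1/2) ^ lev (\<sigma> u) else 0)"
    by (intro sum_mono) (auto simp: q_def act_def)
  then show ?thesis unfolding deg_def using finite_N by (simp add: sum.inter_filter)
qed

text \<open>Such a node marks itself with probability 1/2 and is then isolated with probability at
  least 1/2. The result is weakened to the bound of the other golden case.\<close>

lemma golden_self:
  assumes v: "v \<in> V" and R: "(1/2) ^ (3 * R) \<le> exp (-18) / (2::real)"
    and low: "act v" "lev (\<sigma> v) = 1" "deg N \<sigma> v < 1/8"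
  shows "exp (-18) / 384 \<le> avg At (\<lambda>c. of_bool (gone c v))"
proof -
  have qv: "q v = 1/2" using low by (simp add: q_def)
  have "1 - 2 * sum q (N v) \<le> exp (- 2 * sum q (N v))"
    using exp_ge_add_one_self[of "- 2 * sum q (N v)"] by simp
  then have "3/4 \<le> exp (- 2 * sum q (N v))" using sum_q_le_deg[of v] low by linarith
  moreover have "(1/2) ^ (3 * R) \<le> (1/8 :: real)" using R exp_18_le by linarith
  ultimately have "1/2 \<le> exp (- 2 * sum q (N v)) - (1/2) ^ (3 * R)" by linarith
  then have "1/4 \<le> q v * (exp (- 2 * sum q (N v)) - (1/2) ^ (3 * R))" by (simp add: qv)
  also have "\<dots> \<le> avg At (\<lambda>c. of_bool (mrk c v \<and> \<not> ovr c v \<and> (\<forall>w\<in>N v. \<not> mrk c w)))"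
    using isolated_prob[OF v, of "N v"] N_subset N_irrefl by simp
  also have "\<dots> \<le> avg At (\<lambda>c. of_bool (gone c v))"
    by (rule avg_mono) (auto simp: gone_def join_def seen_def)
  finally show ?thesis using exp_18_le by linarith
qed

text \<open>An active neighbor that is not light is expected to see a mark and to halve. If it sees
  none, it may double, and 3/2 of its probability is the difference between doubling and
  halving.\<close>

definition excess :: "nat \<Rightarrow> nat set \<Rightarrow> real" where
  "excess v c = (\<Sum>u\<in>{u \<in> N v. act u \<and> \<not> light u}. 3/2 * (1/2) ^ lev (\<sigma> u) * of_bool (\<not> sen c u))"

lemma excess_nonneg: "0 \<le> excess v c"
  unfolding excess_def by (intro sum_nonneg) auto

lemma exp_8_le: "exp (-8) \<le> (1/256::real)"
proof -
  have "exp (-8::real) = exp (-1) ^ 8" by (simp flip: exp_of_nat_mult)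
  also have "\<dots> \<le> (1/2) ^ 8"
    using exp_ge_add_one_self[of 1] by (intro power_mono) (auto simp: exp_minus field_simps)
  finally show ?thesis by (simp add: power_divide)
qed

lemma avg_excess: "avg At (excess v) \<le> deg N \<sigma> v / 128"
proof -
  let ?H = "{u \<in> N v. act u \<and> \<not> light u}"
  have "avg At (excess v) = (\<Sum>u\<in>?H. 3/2 * (1/2) ^ lev (\<sigma> u) * avg At (\<lambda>c. of_bool (\<not> sen c u)))"
    unfolding excess_def by (simp only: avg_sum avg_cmult)
  also have "\<dots> \<le> (\<Sum>u\<in>?H. (1/2) ^ lev (\<sigma> u) * (1/128))"
  proof (rule sum_mono)
    fix u assume u: "u \<in> ?H"
    have "avg At (\<lambda>c. of_bool (\<not> sen c u)) \<le> exp (- sum q (N u))"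
      using no_mrk_le[OF N_subset[of u]] by (simp add: seen_def)
    also have "\<dots> \<le> exp (-8)" using u by (auto simp: light_def)
    finally have "avg At (\<lambda>c. of_bool (\<not> sen c u)) \<le> 1/256" using exp_8_le by linarith
    then have "(3/2 * (1/2) ^ lev (\<sigma> u)) * avg At (\<lambda>c. of_bool (\<not> sen c u)) \<le> (3/2 * (1/2) ^ lev (\<sigma> u)) * (1/256)"
      by (intro mult_left_mono) auto
    also have "\<dots> \<le> (1/2) ^ lev (\<sigma> u) * (1/128)" by simp
    finally show "3/2 * (1/2) ^ lev (\<sigma> u) * avg At (\<lambda>c. of_bool (\<not> sen c u)) \<le> (1/2) ^ lev (\<sigma> u) * (1/128)" .
  qed
  also have "\<dots> \<le> (\<Sum>u\<in>{u \<in> N v. stat (\<sigma> u) = Und}. (1/2) ^ lev (\<sigma> u) * (1/128))"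
    using finite_N by (intro sum_mono2) (auto simp: act_def)
  finally show ?thesis by (simp add: deg_def sum_divide_distrib)
qed

section \<open>Change of levels, degree and potential in one round\<close>

lemma nlv_cases: "u \<in> V \<Longrightarrow> (1/2::real) ^ nlv c u \<le> 2 * (1/2) ^ lev (\<sigma> u)"
  using lev_ge_1[of u] by (cases "lev (\<sigma> u)") (auto simp: nlev_def max_def)

lemma nlv_half: "dor (\<sigma> u) \<or> ovr c u \<or> sen c u \<Longrightarrow> (1/2::real) ^ nlv c u = 1/2 * (1/2) ^ lev (\<sigma> u)"
  by (simp add: nlev_def)

lemma ndeg_le_double: "ndeg c v \<le> 2 * deg N \<sigma> v"
  unfolding ndeg_def deg_def sum_distrib_left by (intro sum_mono nlv_cases) (use N_V in auto)

text \<open>Let every neighbor halve and correct by 3/2 of its probability where it may double.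
  Light neighbors contribute at most 3/2 of a sixth of the degree, so 1/2 + 1/4 = 3/4; the others
  that see no mark form \<open>excess\<close>.\<close>

lemma ndeg_le:
  assumes "sum q {u \<in> N v. light u} \<le> deg N \<sigma> v / 6"
  shows "ndeg c v \<le> 3/4 * deg N \<sigma> v + excess v c"
proof -
  let ?U = "{u \<in> N v. stat (\<sigma> u) = Und}"
  let ?p = "\<lambda>u. (1/2::real) ^ lev (\<sigma> u)"
  have "ndeg c v \<le> (\<Sum>u\<in>?U. 1/2 * ?p u + (if light u then 3/2 * ?p u else 0)
      + (if act u \<and> \<not> light u then 3/2 * ?p u * of_bool (\<not> sen c u) else 0))"
    unfolding ndeg_def
  proof (rule sum_mono)
    fix u assume u: "u \<in> ?U"
    show "(1/2) ^ nlv c u \<le> 1/2 * ?p u + (if light u then 3/2 * ?p u else 0)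
      + (if act u \<and> \<not> light u then 3/2 * ?p u * of_bool (\<not> sen c u) else 0)"
    proof (cases "dor (\<sigma> u) \<or> sen c u")
      case True
      then have "(1/2) ^ nlv c u = 1/2 * ?p u" by (intro nlv_half) auto
      moreover have "0 \<le> (if light u then 3/2 * ?p u else 0)"
        "0 \<le> (if act u \<and> \<not> light u then 3/2 * ?p u * of_bool (\<not> sen c u) else 0)"
        by simp_all
      ultimately show ?thesis by linarith
    next
      case False
      then show ?thesis using nlv_cases[of u c] u N_V by (auto simp: act_def)
    qed
  qed
  also have "\<dots> = 1/2 * deg N \<sigma> v + (\<Sum>u\<in>?U. if light u then 3/2 * ?p u else 0)
      + (\<Sum>u\<in>?U. if act u \<and> \<not> light u then 3/2 * ?p u * of_bool (\<not> sen c u) else 0)"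
    by (simp only: sum.distrib deg_def sum_distrib_left)
  also have "(\<Sum>u\<in>?U. if light u then 3/2 * ?p u else 0) = (\<Sum>u\<in>{u \<in> N v. light u}. 3/2 * q u)"
    using finite_N by (intro sum.mono_neutral_cong) (auto simp: light_def act_def q_def)
  also have "\<dots> = 3/2 * sum q {u \<in> N v. light u}" by (simp only: sum_distrib_left)
  also have "(\<Sum>u\<in>?U. if act u \<and> \<not> light u then 3/2 * ?p u * of_bool (\<not> sen c u) else 0) = excess v c"
    unfolding excess_def using finite_N by (intro sum.mono_neutral_cong) (auto simp: act_def)
  finally show ?thesis using assms by linarith
qed

text \<open>Allowance for \<open>v\<close> falling dormant in this round, which lifts its floor from
  1/16 to at most 4^R. As the probability is at most 8^(-R), the expected cost is only
  2^(-R).\<close>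

definition jump :: "nat \<Rightarrow> nat set \<Rightarrow> real" where
  "jump v c = of_bool (\<not> dor (\<sigma> v) \<and> ovr c v) * 4 ^ R"

lemma avg_jump:
  assumes "v \<in> V" "stat (\<sigma> v) = Und"
  shows "avg At (jump v) \<le> (1/2) ^ R"
proof (cases "dor (\<sigma> v)")
  case True
  then show ?thesis by (simp add: jump_def[abs_def] avg_const finite_At)
next
  case False
  then have "avg At (jump v) = avg At (\<lambda>c. of_bool (ovr c v)) * 4 ^ R"
    unfolding jump_def[abs_def] by (simp add: avg_cmult_right)
  also have "\<dots> \<le> (1/2) ^ (3 * R) * 4 ^ R"
    using ovr_prob[OF assms False] by (intro mult_right_mono) auto
  also have "\<dots> = (1/2) ^ R"
    by (simp add: power_mult power3_eq_cube flip: power_mult_distrib)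
  finally show ?thesis .
qed

lemma psi_new_le:
  assumes "j < R"
  shows "psi R (j + 1) (dor (\<sigma> v) \<or> ovr c v) x
    \<le> max x (if dor (\<sigma> v) then 3/4 * (4 ^ R * (3/4) ^ j) else 1/16) + jump v c"
proof (cases "dor (\<sigma> v)")
  case True
  then show ?thesis by (simp add: psi_def jump_def)
next
  case False
  define t where "t = (4::real) ^ R * (3/4) ^ (j + 1)"
  have "t \<le> 4 ^ R"
    unfolding t_def using power_le_one[of "3/4::real" "j + 1"] by (intro mult_left_le) auto
  moreover have "0 \<le> (4::real) ^ R" by simp
  moreover have "psi R (j + 1) dm x = max x (if dm then t else 1/16)" for dm
    unfolding psi_def t_def ..
  ultimately show ?thesis using False by (auto simp: jump_def max_def intro: add_increasing2)
qed

text \<open>Reduces every case of the contraction to a factor \<open>f\<close> for the level part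
  and a ratio \<open>y\<close> for \<open>psi\<close>. The power of \<open>y\<close> enters
  linearly, so a random \<open>y\<close> may be averaged afterwards.\<close>

lemma potential_ratio:
  assumes v: "v \<in> V" and j: "j < R" and a: "0 < \<alpha>" "\<alpha> \<le> 1/8" and nr: "\<not> removed N \<sigma> v"
    and g: "\<not> gone c v \<Longrightarrow> (1 + \<alpha>) ^ nlv c v \<le> f * (1 + \<alpha>) ^ lev (\<sigma> v)"
    and y: "\<not> gone c v \<Longrightarrow> psi R (j + 1) (dor (\<sigma> v) \<or> ovr c v) (ndeg c v) \<le> y * psi R j (dor (\<sigma> v)) (deg N \<sigma> v)"
    and f: "0 \<le> f"
  shows "next_pot \<alpha> j v c \<le> of_bool (\<not> gone c v) * f * (1 + 8 * \<alpha> * (y - 1)) * pot N R \<alpha> j \<sigma> v"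
proof (cases "gone c v")
  case True
  then show ?thesis by (simp add: next_pot_def)
next
  case False
  let ?p = "psi R j (dor (\<sigma> v)) (deg N \<sigma> v)"
  let ?p' = "psi R (j + 1) (dor (\<sigma> v) \<or> ovr c v) (ndeg c v)"
  have "1/16 \<le> ?p" "1/16 \<le> ?p'" using j by (simp_all only: psi_pos Suc_leI Suc_eq_plus1[symmetric] less_imp_le)
  then have p: "0 < ?p" "0 < ?p'" by linarith+
  then have "0 < y * ?p" using y[OF False] by linarith
  then have y0: "0 \<le> y" using p by (simp add: zero_less_mult_iff)
  have "?p' powr (8 * \<alpha>) \<le> (y * ?p) powr (8 * \<alpha>)"
    using y[OF False] p a by (intro powr_mono2) auto
  also have "\<dots> = y powr (8 * \<alpha>) * ?p powr (8 * \<alpha>)"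
    using p y0 by (simp add: powr_mult)
  also have "\<dots> \<le> (1 + 8 * \<alpha> * (y - 1)) * ?p powr (8 * \<alpha>)"
    using powr_le_linear[OF y0, of "8 * \<alpha>"] a by (intro mult_right_mono) auto
  finally have P: "?p' powr (8 * \<alpha>) \<le> (1 + 8 * \<alpha> * (y - 1)) * ?p powr (8 * \<alpha>)" .
  have "next_pot \<alpha> j v c = (1 + \<alpha>) ^ nlv c v * ?p' powr (8 * \<alpha>)"
    using nr False by (simp add: next_pot_def)
  also have "\<dots> \<le> (f * (1 + \<alpha>) ^ lev (\<sigma> v)) * ((1 + 8 * \<alpha> * (y - 1)) * ?p powr (8 * \<alpha>))"
    using g[OF False] P a f by (intro mult_mono) auto
  also have "\<dots> = of_bool (\<not> gone c v) * f * (1 + 8 * \<alpha> * (y - 1)) * pot N R \<alpha> j \<sigma> v"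
    using nr False by (simp add: pot_def)
  finally show ?thesis .
qed

lemma nlv_pow_le:
  fixes \<alpha> :: real
  assumes "0 \<le> \<alpha>" "v \<in> V"
  shows "(1 + \<alpha>) ^ nlv c v \<le> (1 + \<alpha>) * (1 + \<alpha>) ^ lev (\<sigma> v)"
proof -
  have "nlv c v \<le> Suc (lev (\<sigma> v))" using lev_ge_1[OF assms(2)] by (auto simp: nlev_def)
  then have "(1 + \<alpha>) ^ nlv c v \<le> (1 + \<alpha>) ^ Suc (lev (\<sigma> v))"
    using assms by (intro power_increasing) auto
  then show ?thesis by simp
qed

text \<open>The factor 1 - \<alpha> + \<alpha>^2 dominates 1 / (1 + \<alpha>), since their quotient
  is 1 + \<alpha>^3. Adding 2 \<alpha> covers a rising level. Level 1 is excluded because it cannot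
  drop.\<close>

lemma nlv_pow_le':
  fixes \<alpha> :: real
  assumes "0 \<le> \<alpha>" "\<not> dor (\<sigma> v)" "2 \<le> lev (\<sigma> v)"
  shows "(1 + \<alpha>) ^ nlv c v \<le> (1 - \<alpha> + \<alpha>\<^sup>2 + 2 * \<alpha> * of_bool (sen c v \<or> ovr c v)) * (1 + \<alpha>) ^ lev (\<sigma> v)"
proof (cases "sen c v \<or> ovr c v")
  case True
  then have "nlv c v = Suc (lev (\<sigma> v))" by (auto simp: nlev_def)
  then have "(1 + \<alpha>) ^ nlv c v = (1 + \<alpha>) * (1 + \<alpha>) ^ lev (\<sigma> v)" by simp
  also have "\<dots> \<le> (1 - \<alpha> + \<alpha>\<^sup>2 + 2 * \<alpha> * of_bool (sen c v \<or> ovr c v)) * (1 + \<alpha>) ^ lev (\<sigma> v)"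
    using True assms by (intro mult_right_mono) auto
  finally show ?thesis .
next
  case False
  obtain k where k: "lev (\<sigma> v) = Suc k" "1 \<le> k" using assms by (cases "lev (\<sigma> v)") auto
  then have "nlv c v = k" using False assms by (auto simp: nlev_def)
  moreover have "1 * (1 + \<alpha>) ^ k \<le> ((1 - \<alpha> + \<alpha>\<^sup>2) * (1 + \<alpha>)) * (1 + \<alpha>) ^ k"
  proof (rule mult_right_mono)
    have "(1 - \<alpha> + \<alpha>\<^sup>2) * (1 + \<alpha>) = 1 + \<alpha> ^ 3" by (simp add: algebra_simps power2_eq_square power3_eq_cube)
    then show "1 \<le> (1 - \<alpha> + \<alpha>\<^sup>2) * (1 + \<alpha>)" using assms by simp
  qed (use assms in simp)
  ultimately show ?thesis using False k by (simp add: mult.assoc)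
qed

lemma sen_prob: "avg At (\<lambda>c. of_bool (sen c v)) \<le> deg N \<sigma> v"
proof -
  have "avg At (\<lambda>c. of_bool (sen c v)) \<le> avg At (\<lambda>c. \<Sum>u\<in>N v. of_bool (mrk c u))"
  proof (rule avg_mono)
    fix c
    show "of_bool (sen c v) \<le> (\<Sum>u\<in>N v. of_bool (mrk c u) :: real)"
    proof (cases "sen c v")
      case True
      then obtain u where u: "u \<in> N v" "mrk c u" by (auto simp: seen_def)
      then have "of_bool (mrk c u) \<le> (\<Sum>u\<in>N v. of_bool (mrk c u) :: real)"
        using finite_N by (intro member_le_sum) auto
      then show ?thesis using u True by simp
    qed (simp add: sum_nonneg)
  qed
  also have "\<dots> = sum q (N v)" unfolding avg_sum using N_V by (intro sum.cong mrk_prob) auto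
  finally show ?thesis using sum_q_le_deg[of v] by linarith
qed

text \<open>
  In the golden case \<open>v\<close> is removed with constant probability. Otherwise the potential shrinks
  because \<open>psi\<close> does (heavy case) or because the level drops (low case).
\<close>

theorem potential_contracts:
  assumes v: "v \<in> V" and j: "j < R"
    and \<alpha>: "\<alpha> = exp (-18) / 12288"
    and R: "16 * (1/2) ^ R \<le> \<alpha>"
  shows "avg At (next_pot \<alpha> j v) \<le> (1 - \<alpha> / 4) * pot N R \<alpha> j \<sigma> v"
proof (cases "removed N \<sigma> v")
  case True
  then show ?thesis by (simp add: next_pot_def[abs_def] pot_def avg_const finite_At)
next
  case nr: False
  let ?p = "psi R j (dor (\<sigma> v)) (deg N \<sigma> v)"
  let ?P = "pot N R \<alpha> j \<sigma> v"
  let ?d = "deg N \<sigma> v"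
  have a: "0 < \<alpha>" "\<alpha> \<le> 1/49152" using exp_18_le by (auto simp: \<alpha>)
  have und: "stat (\<sigma> v) = Und" using nr by (simp add: removed_def)
  have pd: "1/16 \<le> ?p" "?d \<le> ?p" using j by (auto simp only: psi_pos less_imp_le)
  have p0: "0 < ?p" using pd by linarith
  have d0: "0 \<le> ?d" unfolding deg_def by (intro sum_nonneg) auto
  have P0: "0 \<le> ?P" unfolding pot_def using a by auto
  have f1: "(1::real) \<le> 4 ^ R * (3/4) ^ j" using floor_ge_1 j by simp
  have jmp: "avg At (\<lambda>c. jump v c / ?p) \<le> \<alpha>"
  proof -
    have "avg At (\<lambda>c. jump v c / ?p) = avg At (jump v) / ?p" by (rule avg_divide)
    also have "\<dots> \<le> (1/2) ^ R / (1/16)"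
      using avg_jump[OF v und] pd by (intro frac_le) auto
    finally show ?thesis using R by simp
  qed
  have jump0: "0 \<le> jump v c" for c by (simp add: jump_def)
  have ovr3: "(1/2) ^ (3 * R) \<le> (1/2::real) ^ R" by (intro power_decreasing) auto
  have R3: "(1/2) ^ (3 * R) \<le> exp (-18) / (2::real)" using ovr3 R exp_ge_zero[of "-18::real"] unfolding \<alpha> by linarith
  have exc: "avg At (\<lambda>c. excess v c / ?p) \<le> 1/128"
  proof -
    have "avg At (\<lambda>c. excess v c / ?p) = avg At (excess v) / ?p" by (rule avg_divide)
    also have "\<dots> \<le> (?d / 128) / ?p" using avg_excess p0 by (intro divide_right_mono) auto
    also have "\<dots> \<le> 1/128" using pd p0 by (simp add: field_simps)
    finally show ?thesis .
  qed
  have psi_new: "psi R (j + 1) (dor (\<sigma> v) \<or> ovr c v) (ndeg c v)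
    \<le> max (ndeg c v) (if dor (\<sigma> v) then 3/4 * (4 ^ R * (3/4) ^ j) else 1/16) + jump v c" for c
    by (rule psi_new_le[OF j])
  have p_eq: "?p = max ?d (if dor (\<sigma> v) then 4 ^ R * (3/4) ^ j else 1/16)" by (simp add: psi_def)
  have finish: ?thesis if bd: "\<And>c. next_pot \<alpha> j v c \<le> g c * ?P" and "avg At g \<le> 1 - \<alpha>/4" for g
  proof -
    have "avg At (next_pot \<alpha> j v) \<le> avg At g * ?P"
      unfolding avg_cmult_right[symmetric] by (rule avg_mono) (rule bd)
    also have "\<dots> \<le> (1 - \<alpha>/4) * ?P" using that P0 by (intro mult_right_mono) auto
    finally show ?thesis .
  qed
  \<comment> \<open>Outside the golden case, either the degree is below 1/32 and even doubling
    leaves it below the clamp 1/16, or light neighbors carry at most a sixth of it and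
    \<open>ndeg_le\<close> applies; the product 1/32 * 1/6 is the mass 1/192. From degree 1/8 on,
    3/4 of it is still above 1/16, so \<open>psi\<close> really falls. Below 1/8, marks are seldom
    seen and the level tends to drop, unless it is 1 already, which is golden.\<close>
  consider (golden) "32 * \<alpha> \<le> avg At (\<lambda>c. of_bool (gone c v))"
    | (heavy) "?d < 1/32 \<or> sum q {u \<in> N v. light u} \<le> ?d / 6" "dor (\<sigma> v) \<or> 1/8 \<le> ?d"
    | (low) "?d < 1/32 \<or> sum q {u \<in> N v. light u} \<le> ?d / 6" "\<not> dor (\<sigma> v)" "?d < 1/8" "2 \<le> lev (\<sigma> v)"
  proof (cases "?d < 1/32 \<or> sum q {u \<in> N v. light u} \<le> ?d / 6")
    case False
    then have "1/192 \<le> sum q {u \<in> N v. light u}" by auto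
    then have "exp (-18) / 384 \<le> avg At (\<lambda>c. of_bool (gone c v))" by (rule golden_neighbours[OF v R3])
    then show ?thesis using golden by (simp add: \<alpha>)
  next
    case T: True
    show ?thesis
    proof (cases "dor (\<sigma> v) \<or> 1/8 \<le> ?d")
      case False
      show ?thesis
      proof (cases "lev (\<sigma> v) = 1")
        case True
        then have "exp (-18) / 384 \<le> avg At (\<lambda>c. of_bool (gone c v))"
          using False und by (intro golden_self[OF v R3]) (auto simp: act_def)
        then show ?thesis using golden by (simp add: \<alpha>)
      next
        case False
        then have "2 \<le> lev (\<sigma> v)" using lev_ge_1[OF v] by linarith
        then show ?thesis using low T \<open>\<not> (dor (\<sigma> v) \<or> 1/8 \<le> ?d)\<close> by auto
      qed
    qed (use T heavy in auto)
  qed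
  then show ?thesis
  proof cases
    case golden
    define z where "z c = jump v c / ?p" for c
    have z0: "0 \<le> z c" for c using jump0 p0 by (simp add: z_def)
    show ?thesis
    \<comment> \<open>At worst the level rises and \<open>psi\<close> doubles, which costs \<alpha>
      + 8 \<alpha> to first order. Removal with probability at least 32 \<alpha> outweighs this; the
      value of \<alpha> is chosen for exactly this bound.\<close>
    proof (rule finish[where g = "\<lambda>c. (1 + \<alpha>) * (1 + 8 * \<alpha>) * (1 - of_bool (gone c v)) + (1 + \<alpha>) * (8 * \<alpha>) * z c"])
      fix c
      have "next_pot \<alpha> j v c \<le> of_bool (\<not> gone c v) * (1 + \<alpha>) * (1 + 8 * \<alpha> * ((2 + z c) - 1)) * ?P"
      proof (rule potential_ratio[OF v j _ _ nr])
        have "max (ndeg c v) (if dor (\<sigma> v) then 3/4 * (4 ^ R * (3/4) ^ j) else 1/16) \<le> 2 * ?p"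
          using ndeg_le_double[of c v] f1 by (auto simp: p_eq)
        then have "psi R (j + 1) (dor (\<sigma> v) \<or> ovr c v) (ndeg c v) \<le> 2 * ?p + jump v c"
          using psi_new[of c] by linarith
        also have "\<dots> = (2 + z c) * ?p" using p0 by (simp add: z_def algebra_simps)
        finally show "psi R (j + 1) (dor (\<sigma> v) \<or> ovr c v) (ndeg c v) \<le> (2 + z c) * ?p" .
        show "(1 + \<alpha>) ^ nlv c v \<le> (1 + \<alpha>) * (1 + \<alpha>) ^ lev (\<sigma> v)"
          by (rule nlv_pow_le[OF _ v]) (use a in auto)
      qed (use a in auto)
      also have "\<dots> \<le> ((1 + \<alpha>) * (1 + 8 * \<alpha>) * (1 - of_bool (gone c v)) + (1 + \<alpha>) * (8 * \<alpha>) * z c) * ?P"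
      proof (rule mult_right_mono)
        show "of_bool (\<not> gone c v) * (1 + \<alpha>) * (1 + 8 * \<alpha> * ((2 + z c) - 1))
          \<le> (1 + \<alpha>) * (1 + 8 * \<alpha>) * (1 - of_bool (gone c v)) + (1 + \<alpha>) * (8 * \<alpha>) * z c"
          using z0[of c] a by (cases "gone c v") (auto simp: algebra_simps)
      qed (rule P0)
      finally show "next_pot \<alpha> j v c \<le> \<dots>" .
    next
      have "avg At (\<lambda>c. (1 + \<alpha>) * (1 + 8 * \<alpha>) * (1 - of_bool (gone c v)) + (1 + \<alpha>) * (8 * \<alpha>) * z c)
        = (1 + \<alpha>) * (1 + 8 * \<alpha>) * (1 - avg At (\<lambda>c. of_bool (gone c v))) + (1 + \<alpha>) * (8 * \<alpha>) * avg At z"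
        by (simp only: avg_add avg_cmult avg_diff avg_const[OF finite_At])
      also have "\<dots> \<le> (1 + \<alpha>) * (1 + 8 * \<alpha>) * (1 - 32 * \<alpha>) + (1 + \<alpha>) * (8 * \<alpha>) * \<alpha>"
        using golden jmp a unfolding z_def[abs_def] by (intro add_mono mult_left_mono) auto
      also have "\<dots> \<le> 1 - \<alpha>/4"
      proof -
        have "(1 + \<alpha>) * (1 + 8 * \<alpha>) * (1 - 32 * \<alpha>) + (1 + \<alpha>) * (8 * \<alpha>) * \<alpha>
          = 1 - 23 * \<alpha> - 272 * (\<alpha> * \<alpha>) - 248 * (\<alpha> * \<alpha> * \<alpha>)" by (simp add: algebra_simps)
        then show ?thesis using a mult_nonneg_nonneg[of \<alpha> \<alpha>] mult_nonneg_nonneg[of "\<alpha> * \<alpha>" \<alpha>] by linarith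
      qed
      finally show "avg At (\<lambda>c. (1 + \<alpha>) * (1 + 8 * \<alpha>) * (1 - of_bool (gone c v)) + (1 + \<alpha>) * (8 * \<alpha>) * z c) \<le> 1 - \<alpha>/4" .
    qed
  next
    case heavy
    define z where "z c = excess v c / ?p + jump v c / ?p" for c
    have z0: "0 \<le> z c" for c using jump0[of c] excess_nonneg[of v c] p0 by (simp add: z_def)
    show ?thesis
    \<comment> \<open>First-order balance: \<alpha> lost to the level, 2 \<alpha> gained from
      \<open>psi\<close>, and \<alpha>/8 lost to \<open>excess\<close> and
      \<open>jump\<close>.\<close>
    proof (rule finish[where g = "\<lambda>c. (1 + \<alpha>) * (1 - 2 * \<alpha> + 8 * \<alpha> * z c)"])
      fix c
      have "next_pot \<alpha> j v c \<le> of_bool (\<not> gone c v) * (1 + \<alpha>) * (1 + 8 * \<alpha> * ((3/4 + z c) - 1)) * ?P"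
      proof (rule potential_ratio[OF v j _ _ nr])
        have "max (ndeg c v) (if dor (\<sigma> v) then 3/4 * (4 ^ R * (3/4) ^ j) else 1/16) \<le> 3/4 * ?p + excess v c"
        proof (cases "?d < 1/32")
          case True
          then have "dor (\<sigma> v)" using heavy by auto
          moreover from this have "4 ^ R * (3/4) ^ j \<le> ?p" by (simp add: psi_def)
          ultimately show ?thesis using True ndeg_le_double[of c v] f1 excess_nonneg[of v c]
            by (simp add: max_def)
        next
          case False
          then have "ndeg c v \<le> 3/4 * ?d + excess v c" using heavy by (intro ndeg_le) auto
          then show ?thesis using excess_nonneg[of v c] pd heavy by (auto simp: p_eq max_def)
        qed
        then have "psi R (j + 1) (dor (\<sigma> v) \<or> ovr c v) (ndeg c v) \<le> 3/4 * ?p + excess v c + jump v c"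
          using psi_new[of c] by linarith
        also have "\<dots> = (3/4 + z c) * ?p" using p0 by (simp add: z_def algebra_simps)
        finally show "psi R (j + 1) (dor (\<sigma> v) \<or> ovr c v) (ndeg c v) \<le> (3/4 + z c) * ?p" .
        show "(1 + \<alpha>) ^ nlv c v \<le> (1 + \<alpha>) * (1 + \<alpha>) ^ lev (\<sigma> v)"
          by (rule nlv_pow_le[OF _ v]) (use a in auto)
      qed (use a in auto)
      also have "\<dots> \<le> ((1 + \<alpha>) * (1 - 2 * \<alpha> + 8 * \<alpha> * z c)) * ?P"
      proof (rule mult_right_mono)
        have "0 \<le> (1 + \<alpha>) * (1 - 2 * \<alpha> + 8 * \<alpha> * z c)"
          using z0[of c] a by (intro mult_nonneg_nonneg add_nonneg_nonneg) auto
        then show "of_bool (\<not> gone c v) * (1 + \<alpha>) * (1 + 8 * \<alpha> * ((3/4 + z c) - 1))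
          \<le> (1 + \<alpha>) * (1 - 2 * \<alpha> + 8 * \<alpha> * z c)"
          by (cases "gone c v") (auto simp: algebra_simps)
      qed (rule P0)
      finally show "next_pot \<alpha> j v c \<le> \<dots>" .
    next
      have "avg At (\<lambda>c. (1 + \<alpha>) * (1 - 2 * \<alpha> + 8 * \<alpha> * z c)) = (1 + \<alpha>) * (1 - 2 * \<alpha> + 8 * \<alpha> * avg At z)"
        by (simp only: avg_add avg_cmult avg_diff avg_const[OF finite_At])
      also have "\<dots> \<le> (1 + \<alpha>) * (1 - 2 * \<alpha> + 8 * \<alpha> * (1/64))"
      proof -
        have "avg At z \<le> 1/128 + \<alpha>" unfolding z_def[abs_def] avg_add using exc jmp by linarith
        then show ?thesis using a by (intro mult_left_mono add_left_mono) auto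
      qed
      also have "\<dots> \<le> 1 - \<alpha>/4"
      proof -
        have "(1 + \<alpha>) * (1 - 2 * \<alpha> + 8 * \<alpha> * (1/64)) = 1 - 7/8 * \<alpha> - 15/8 * (\<alpha> * \<alpha>)" by (simp add: algebra_simps)
        then show ?thesis using a mult_nonneg_nonneg[of \<alpha> \<alpha>] by linarith
      qed
      finally show "avg At (\<lambda>c. (1 + \<alpha>) * (1 - 2 * \<alpha> + 8 * \<alpha> * z c)) \<le> 1 - \<alpha>/4" .
    qed
  next
    case low
    define z where "z c = excess v c / ?p + jump v c / ?p" for c
    have z0: "0 \<le> z c" for c using jump0[of c] excess_nonneg[of v c] p0 by (simp add: z_def)
    define s where "s c = (of_bool (sen c v \<or> ovr c v) :: real)" for c
    define f where "f c = 1 - \<alpha> + \<alpha>\<^sup>2 + 2 * \<alpha> * s c" for c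
    have f0: "0 \<le> f c" "f c \<le> 2" for c
    proof -
      have "\<alpha>\<^sup>2 \<le> \<alpha>" using a by (simp add: power2_eq_square mult_left_le)
      moreover have "0 \<le> 2 * \<alpha> * s c" "2 * \<alpha> * s c \<le> 2 * \<alpha>" using a by (auto simp: s_def)
      moreover have "0 \<le> \<alpha>\<^sup>2" by simp
      ultimately show "0 \<le> f c" "f c \<le> 2" unfolding f_def using a by linarith+
    qed
    show ?thesis
    \<comment> \<open>First-order balance: \<alpha> gained from the dropping level, \<alpha>/2 lost
      because it rises with probability at most 1/4, \<alpha>/8 lost to \<open>excess\<close>. The
      remaining 3/8 \<alpha> is the smallest gain of the three cases.\<close>
    proof (rule finish[where g = "\<lambda>c. f c + 16 * \<alpha> * z c"])
      fix c
      have "next_pot \<alpha> j v c \<le> of_bool (\<not> gone c v) * f c * (1 + 8 * \<alpha> * ((1 + z c) - 1)) * ?P"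
      proof (rule potential_ratio[OF v j _ _ nr])
        have "max (ndeg c v) (1/16) \<le> ?p + excess v c"
        proof (cases "?d < 1/32")
          case True
          then show ?thesis using ndeg_le_double[of c v] excess_nonneg[of v c] pd by auto
        next
          case False
          then have "ndeg c v \<le> 3/4 * ?d + excess v c" using low by (intro ndeg_le) auto
          then show ?thesis using excess_nonneg[of v c] pd d0 by auto
        qed
        then have "psi R (j + 1) (dor (\<sigma> v) \<or> ovr c v) (ndeg c v) \<le> ?p + excess v c + jump v c"
          using psi_new[of c] unfolding if_not_P[OF low(2)] by linarith
        also have "\<dots> = (1 + z c) * ?p" using p0 by (simp add: z_def algebra_simps)
        finally show "psi R (j + 1) (dor (\<sigma> v) \<or> ovr c v) (ndeg c v) \<le> (1 + z c) * ?p" .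
        show "(1 + \<alpha>) ^ nlv c v \<le> f c * (1 + \<alpha>) ^ lev (\<sigma> v)"
          unfolding f_def s_def by (rule nlv_pow_le') (use a low in auto)
      qed (use a f0 in auto)
      also have "\<dots> \<le> (f c + 16 * \<alpha> * z c) * ?P"
      proof (rule mult_right_mono)
        have "f c * (8 * \<alpha> * z c) \<le> 2 * (8 * \<alpha> * z c)"
          using f0 z0 a by (intro mult_right_mono) auto
        moreover have "0 \<le> f c + 16 * \<alpha> * z c" using f0 z0 a by auto
        ultimately show "of_bool (\<not> gone c v) * f c * (1 + 8 * \<alpha> * ((1 + z c) - 1)) \<le> f c + 16 * \<alpha> * z c"
          by (cases "gone c v") (auto simp: algebra_simps)
      qed (rule P0)
      finally show "next_pot \<alpha> j v c \<le> \<dots>" .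
    next
      have "avg At s \<le> avg At (\<lambda>c. of_bool (sen c v) + of_bool (ovr c v))"
        by (rule avg_mono) (auto simp: s_def)
      also have "\<dots> \<le> 1/8 + (1/2) ^ (3 * R)"
        unfolding avg_add using sen_prob[of v] ovr_prob[OF v und] low by (intro add_mono) auto
      finally have s: "avg At s \<le> 1/4" using ovr3 R a by linarith
      have zb: "avg At z \<le> 1/128 + \<alpha>" unfolding z_def[abs_def] avg_add using exc jmp by linarith
      have "avg At (\<lambda>c. f c + 16 * \<alpha> * z c) = 1 - \<alpha> + \<alpha>\<^sup>2 + 2 * \<alpha> * avg At s + 16 * \<alpha> * avg At z"
        unfolding f_def by (simp only: avg_add avg_cmult avg_diff avg_const[OF finite_At])
      also have "\<dots> \<le> 1 - \<alpha> + \<alpha>\<^sup>2 + 2 * \<alpha> * (1/4) + 16 * \<alpha> * (1/128 + \<alpha>)"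
        using s zb a by (intro add_mono mult_left_mono) auto
      also have "\<dots> \<le> 1 - \<alpha>/4"
        using mult_left_mono[OF a(2), of \<alpha>] a by (simp add: power2_eq_square algebra_simps)
      finally show "avg At (\<lambda>c. f c + 16 * \<alpha> * z c) \<le> 1 - \<alpha>/4" .
    qed
  qed
qed

end

section \<open>Locality of a round and contraction of products\<close>

primrec nball :: "(nat \<Rightarrow> nat set) \<Rightarrow> nat \<Rightarrow> nat \<Rightarrow> nat set" where
  "nball N 0 v = {v}"
| "nball N (Suc i) v = (\<Union>u\<in>nball N i v. insert u (N u))"

lemma nball_2: "nball N 2 v = (\<Union>u\<in>insert v (N v). insert u (N u))"
  by (simp add: numeral_2_eq_2)

context one_round
begin

text \<open>A joining node gets status \<open>In\<close>, so \<open>gone\<close> implies removal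
  after the round. Neighbors decided in the round only lower the degree.\<close>

lemma pot_round_le_next_pot:
  assumes v: "v \<in> V" and \<alpha>: "0 \<le> \<alpha>"
  shows "pot N R \<alpha> (j + 1) (mis_round N R (h c) \<sigma>0 \<sigma>) v \<le> next_pot \<alpha> j v c"
proof (cases "removed N (mis_round N R (h c) \<sigma>0 \<sigma>) v")
  case True
  have "0 \<le> next_pot \<alpha> j v c" using \<alpha> by (auto simp: next_pot_def)
  then show ?thesis using True by (simp add: pot_def)
next
  case False
  let ?\<tau> = "mis_round N R (h c) \<sigma>0 \<sigma>"
  have und: "stat (\<sigma> v) = Und" using False by (auto simp: removed_def mis_round_def split: if_splits)
  have "stat (\<sigma> u) \<noteq> In" if "u \<in> N v" for u
    using False that by (auto simp: removed_def mis_round_def split: if_splits)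
  then have nr: "\<not> removed N \<sigma> v" using und by (simp add: removed_def)
  have joined: "stat (?\<tau> u) = In" if "jn c u" for u
    using that by (auto simp: join_def mark_def mis_round_def)
  have ng: "\<not> gone c v" using False joined by (auto simp: gone_def removed_def)
  have lev: "lev (?\<tau> u) = nlv c u" if "stat (\<sigma> u) = Und" for u
    using that by (simp add: mis_round_def nlev_def)
  have dor: "dor (?\<tau> v) = (dor (\<sigma> v) \<or> ovr c v)"
    using und by (simp add: mis_round_def)
  have still: "stat (\<sigma> u) = Und" if "stat (?\<tau> u) = Und" for u
    using that by (auto simp: mis_round_def split: if_splits)
  have "deg N ?\<tau> v \<le> ndeg c v"
  proof -
    have "deg N ?\<tau> v = (\<Sum>u\<in>{u \<in> N v. stat (?\<tau> u) = Und}. (1/2) ^ nlv c u)"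
      unfolding deg_def using lev still by (intro sum.cong) auto
    also have "\<dots> \<le> ndeg c v"
      unfolding ndeg_def using finite_N still by (intro sum_mono2) auto
    finally show ?thesis .
  qed
  then have "psi R (j + 1) (dor (?\<tau> v)) (deg N ?\<tau> v) \<le> psi R (j + 1) (dor (\<sigma> v) \<or> ovr c v) (ndeg c v)"
    unfolding dor by (auto simp: psi_def)
  moreover have "0 \<le> psi R (j + 1) (dor (?\<tau> v)) (deg N ?\<tau> v)"
    unfolding psi_def by (auto simp: le_max_iff_disj)
  ultimately show ?thesis
    using False nr ng \<alpha> lev[OF und] unfolding pot_def next_pot_def
    by (auto intro!: mult_left_mono powr_mono2)
qed

lemma next_pot_restrict:
  assumes v: "v \<in> V"
  shows "next_pot \<alpha> j v (c \<inter> (\<Union>u\<in>nball N 2 v. atoms u)) = next_pot \<alpha> j v c"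
proof -
  let ?A = "\<Union>u\<in>nball N 2 v. atoms u"
  have sub: "atoms w \<subseteq> ?A" if "u \<in> insert v (N v)" "w \<in> insert u (N u)" for u w
    using that unfolding nball_2 by blast
  have jn: "jn (c \<inter> ?A) u = jn c u" if "u \<in> insert v (N v)" for u
    using that v N_V by (intro jn_restrict sub[OF that]) auto
  have nl: "nlv (c \<inter> ?A) u = nlv c u" if "u \<in> insert v (N v)" for u
    by (intro nlv_restrict sub[OF that]) auto
  have "gone (c \<inter> ?A) v = gone c v" unfolding gone_def using jn by auto
  moreover have "ndeg (c \<inter> ?A) v = ndeg c v" unfolding ndeg_def using nl by (intro sum.cong) auto
  moreover have "nlv (c \<inter> ?A) v = nlv c v" using nl by simp
  moreover have "ovr (c \<inter> ?A) v = ovr c v" by (intro ovr_restrict sub[of v]) auto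
  ultimately show ?thesis unfolding next_pot_def by simp
qed

text \<open>
  The bound on the potential of \<open>v\<close> after the round only reads coins within distance two of \<open>v\<close>.
\<close>

lemma product_contracts:
  assumes S: "S \<subseteq> V" "disjoint_family_on (nball N 2) S" and j: "j < R"
    and \<alpha>: "\<alpha> = exp (-18) / 12288" and R: "16 * (1/2) ^ R \<le> \<alpha>"
  shows "avg At (\<lambda>c. \<Prod>v\<in>S. pot N R \<alpha> (j + 1) (mis_round N R (h c) \<sigma>0 \<sigma>) v)
    \<le> (1 - \<alpha>/4) ^ card S * (\<Prod>v\<in>S. pot N R \<alpha> j \<sigma> v)"
proof -
  have a: "0 < \<alpha>" "\<alpha> \<le> 1" using exp_18_le by (auto simp: \<alpha>)
  have pot0: "0 \<le> pot N R \<alpha> i \<tau> v" for i \<tau> v using a by (auto simp: pot_def)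
  have next_pot0: "0 \<le> next_pot \<alpha> j v c" for v c using a by (auto simp: next_pot_def)
  have ball_V: "nball N 2 v \<subseteq> V" if "v \<in> S" for v
    using that S N_subset unfolding nball_2 by auto
  have "avg At (\<lambda>c. \<Prod>v\<in>S. pot N R \<alpha> (j + 1) (mis_round N R (h c) \<sigma>0 \<sigma>) v)
    \<le> avg At (\<lambda>c. \<Prod>v\<in>S. next_pot \<alpha> j v c)"
    using S pot0 pot_round_le_next_pot a by (intro avg_mono prod_mono) auto
  also have "\<dots> = (\<Prod>v\<in>S. avg At (next_pot \<alpha> j v))"
  proof (rule avg_prod[OF finite_At, where A = "\<lambda>v. \<Union>u\<in>nball N 2 v. atoms u"])
    show "finite S" using S finite_V finite_subset by auto
    show "(\<Union>u\<in>nball N 2 v. atoms u) \<subseteq> At" if "v \<in> S" for v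
      using ball_V[OF that] unfolding At_def by auto
    show "disjoint_family_on (\<lambda>v. \<Union>u\<in>nball N 2 v. atoms u) S"
      unfolding disjoint_family_on_def
    proof (intro ballI impI)
      fix v w assume vw: "v \<in> S" "w \<in> S" "v \<noteq> w"
      then have "nball N 2 v \<inter> nball N 2 w = {}" using S(2) by (auto simp: disjoint_family_on_def)
      then have "atoms x \<inter> atoms y = {}" if "x \<in> nball N 2 v" "y \<in> nball N 2 w" for x y
        using that by (intro atoms_disjoint) auto
      then show "(\<Union>u\<in>nball N 2 v. atoms u) \<inter> (\<Union>u\<in>nball N 2 w. atoms u) = {}" by fastforce
    qed
    show "next_pot \<alpha> j v c = next_pot \<alpha> j v (c \<inter> (\<Union>u\<in>nball N 2 v. atoms u))" if "v \<in> S" for v c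
      using next_pot_restrict[of v \<alpha> j c] that S by auto
  qed
  also have "\<dots> \<le> (\<Prod>v\<in>S. (1 - \<alpha>/4) * pot N R \<alpha> j \<sigma> v)"
  proof (intro prod_mono conjI)
    fix v assume "v \<in> S"
    then show "avg At (next_pot \<alpha> j v) \<le> (1 - \<alpha>/4) * pot N R \<alpha> j \<sigma> v"
      using S by (intro potential_contracts[OF _ j \<alpha> R]) auto
  qed (intro avg_nonneg next_pot0)
  also have "\<dots> = (1 - \<alpha>/4) ^ card S * (\<Prod>v\<in>S. pot N R \<alpha> j \<sigma> v)" by (simp add: prod.distrib)
  finally show ?thesis .
qed

end

section \<open>Undecided nodes after all phases\<close>

definition pos :: "nat \<Rightarrow> nat \<Rightarrow> nat \<Rightarrow> nat" where
  "pos t u i = prod_encode (t, prod_encode (u, i))"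

definition coin :: "(nat \<Rightarrow> bool) \<Rightarrow> nat \<Rightarrow> nat \<Rightarrow> nat \<Rightarrow> bool" where
  "coin r t u l \<longleftrightarrow> (\<forall>i<l. r (pos t u i))"

primrec rounds ::
  "(nat \<Rightarrow> nat set) \<Rightarrow> nat \<Rightarrow> (nat \<Rightarrow> nat \<Rightarrow> nat \<Rightarrow> bool) \<Rightarrow> (nat \<Rightarrow> node) \<Rightarrow> nat \<Rightarrow> nat \<Rightarrow> node" where
  "rounds N R H \<sigma>0 0 = \<sigma>0"
| "rounds N R H \<sigma>0 (Suc j) = mis_round N R (H j) \<sigma>0 (rounds N R H \<sigma>0 j)"

text \<open>The initial state is synchronized too: all levels are 1 there, and nodes of large degree
  have to be dormant from the very start.\<close>

primrec base :: "(nat \<Rightarrow> nat set) \<Rightarrow> nat \<Rightarrow> (nat \<Rightarrow> bool) \<Rightarrow> nat \<Rightarrow> nat \<Rightarrow> node" where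
  "base N R r 0 = sync N R (\<lambda>_. Node 1 False Und)"
| "base N R r (Suc k) = sync N R (rounds N R (\<lambda>j. coin r (k * R + j)) (base N R r k) R)"

definition state :: "(nat \<Rightarrow> nat set) \<Rightarrow> nat \<Rightarrow> (nat \<Rightarrow> bool) \<Rightarrow> nat \<Rightarrow> nat \<Rightarrow> nat \<Rightarrow> node" where
  "state N R r k j = rounds N R (\<lambda>j. coin r (k * R + j)) (base N R r k) j"

lemma state_0: "state N R r k 0 = base N R r k"
  by (simp add: state_def)

lemma state_Suc:
  "state N R r k (Suc j) = mis_round N R (coin r (k * R + j)) (base N R r k) (state N R r k j)"
  by (simp add: state_def)

lemma base_Suc: "base N R r (Suc k) = sync N R (state N R r k R)"
  by (simp add: state_def)

lemma pos_inject: "pos t u i = pos t' u' i' \<longleftrightarrow> t = t' \<and> u = u' \<and> i = i'"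
  by (simp add: pos_def)

section \<open>Invariants of the process and the coins that a state reads\<close>

lemma lev_mis_round:
  "1 \<le> lev (\<sigma> u) \<Longrightarrow> 1 \<le> lev (mis_round N R h \<sigma>0 \<sigma> u)"
  "1 \<le> lev (\<sigma> u) \<Longrightarrow> lev (mis_round N R h \<sigma>0 \<sigma> u) \<le> Suc (lev (\<sigma> u))"
  "lev (\<sigma> u) \<le> Suc (lev (mis_round N R h \<sigma>0 \<sigma> u))"
  by (auto simp: mis_round_def nlev_def)

lemma lev_state_aux:
  assumes "1 \<le> lev (base N R r k u)" "lev (base N R r k u) \<le> m"
  shows "1 \<le> lev (state N R r k j u) \<and> lev (state N R r k j u) \<le> m + j
    \<and> lev (base N R r k u) \<le> lev (state N R r k j u) + j"
proof (induction j)
  case 0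
  then show ?case using assms by (simp add: state_0)
next
  case (Suc j)
  then show ?case
    using lev_mis_round[of "state N R r k j" u N R "coin r (k * R + j)" "base N R r k"]
    unfolding state_Suc by linarith
qed

lemma lev_base: "1 \<le> lev (base N R r k u) \<and> lev (base N R r k u) \<le> Suc (k * R)"
proof (induction k)
  case (Suc k)
  then show ?case using lev_state_aux[of N R r k u "Suc (k * R)" R] unfolding base_Suc
    by (simp add: sync_def add.commute)
qed (simp add: sync_def)

lemma lev_state:
  "1 \<le> lev (state N R r k j u)" "lev (state N R r k j u) \<le> Suc (k * R + j)"
  "lev (base N R r k u) - j \<le> lev (state N R r k j u)"
  using lev_state_aux[of N R r k u "Suc (k * R)" j] lev_base[of N R r k u] by auto

lemma Und_mis_round: "stat (mis_round N R h \<sigma>0 \<sigma> u) = Und \<Longrightarrow> stat (\<sigma> u) = Und"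
  by (auto simp: mis_round_def split: if_splits)

lemma not_dor_mis_round:
  "stat (mis_round N R h \<sigma>0 \<sigma> u) = Und \<Longrightarrow> \<not> dor (mis_round N R h \<sigma>0 \<sigma> u) \<Longrightarrow> \<not> dor (\<sigma> u)"
  by (auto simp: mis_round_def split: if_splits)

lemma Und_state: "stat (state N R r k j u) = Und \<Longrightarrow> stat (base N R r k u) = Und"
  by (induction j) (auto simp: state_0 state_Suc dest: Und_mis_round)

lemma not_dor_state:
  "stat (state N R r k j u) = Und \<Longrightarrow> \<not> dor (state N R r k j u) \<Longrightarrow> \<not> dor (base N R r k u)"
  by (induction j) (auto simp: state_0 state_Suc dest: Und_mis_round not_dor_mis_round)

context nbr_graph
begin

lemma deg_sync_le: "deg N (sync N R \<sigma>) u \<le> deg N \<sigma> u"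
proof -
  have "deg N (sync N R \<sigma>) u = (\<Sum>w\<in>{w \<in> N u. stat (sync N R \<sigma> w) = Und}. (1/2) ^ lev (\<sigma> w))"
    unfolding deg_def by (intro sum.cong) (auto simp: sync_def)
  also have "\<dots> \<le> deg N \<sigma> u"
    unfolding deg_def using finite_N by (intro sum_mono2) (auto simp: sync_def split: if_splits)
  finally show ?thesis .
qed

lemma deg_base_le: "\<not> dor (base N R r k u) \<Longrightarrow> deg N (base N R r k) u \<le> 4 ^ R"
proof (cases k)
  case 0
  then show "\<not> dor (base N R r k u) \<Longrightarrow> deg N (base N R r k) u \<le> 4 ^ R"
    using deg_sync_le[of R "\<lambda>_. Node 1 False Und" u] by (auto simp: sync_def)
next
  case (Suc k')
  then show "\<not> dor (base N R r k u) \<Longrightarrow> deg N (base N R r k) u \<le> 4 ^ R"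
    using deg_sync_le[of R "state N R r k' R" u] unfolding Suc base_Suc by (auto simp: sync_def)
qed

lemma mis_round_cong:
  assumes "\<And>u l. u \<in> V \<Longrightarrow> l \<le> L \<Longrightarrow> h u l = h' u l"
    and "\<And>u. u \<in> V \<Longrightarrow> \<sigma>0 u = \<sigma>0' u" "\<And>u. u \<in> V \<Longrightarrow> \<sigma> u = \<sigma>' u"
    and "\<And>u. u \<in> V \<Longrightarrow> lev (\<sigma>0 u) \<le> L" "\<And>u. u \<in> V \<Longrightarrow> lev (\<sigma> u) \<le> L"
    and v: "v \<in> V"
  shows "mis_round N R h \<sigma>0 \<sigma> v = mis_round N R h' \<sigma>0' \<sigma>' v"
proof -
  have N_V: "u \<in> V" if "u \<in> N w" for u w using that N_subset by auto
  have cand: "cand R h \<sigma>0 u = cand R h' \<sigma>0' u" if "u \<in> V" for u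
  proof -
    have "lev (\<sigma>0 u) - R \<le> L" using assms(4)[OF that] by simp
    then show ?thesis using assms(1,2) that by (simp add: cand_def)
  qed
  have over: "over N R h \<sigma>0 u = over N R h' \<sigma>0' u" for u
    unfolding over_def using cand N_V by (metis (mono_tags, lifting) Collect_cong)
  have mark: "mark R h \<sigma>0 \<sigma> u = mark R h' \<sigma>0' \<sigma>' u" if "u \<in> V" for u
    using assms cand that by (simp add: mark_def)
  have seen: "seen N R h \<sigma>0 \<sigma> u = seen N R h' \<sigma>0' \<sigma>' u" for u
    unfolding seen_def using mark N_V by (metis (no_types, lifting))
  have join: "join N R h \<sigma>0 \<sigma> u = join N R h' \<sigma>0' \<sigma>' u" if "u \<in> V" for u
    using mark[OF that] seen over by (simp add: join_def)
  have "(\<exists>u\<in>N v. join N R h \<sigma>0 \<sigma> u) = (\<exists>u\<in>N v. join N R h' \<sigma>0' \<sigma>' u)"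
    using join N_V by (metis (no_types, lifting))
  then show ?thesis
    using assms(3)[OF v] join[OF v] over[of v] seen[of v] by (simp add: mis_round_def nlev_def)
qed

lemma deg_cong:
  assumes "\<And>u. u \<in> V \<Longrightarrow> \<sigma> u = \<sigma>' u"
  shows "deg N \<sigma> v = deg N \<sigma>' v"
proof -
  have "\<sigma> u = \<sigma>' u" if "u \<in> N v" for u using that N_subset assms by auto
  then show ?thesis unfolding deg_def by (intro sum.cong) auto
qed

lemma sync_cong:
  assumes "\<And>u. u \<in> V \<Longrightarrow> \<sigma> u = \<sigma>' u" "v \<in> V"
  shows "sync N R \<sigma> v = sync N R \<sigma>' v"
proof -
  have "\<sigma> u = \<sigma>' u" if "u \<in> N v" for u using that N_subset assms(1) by auto
  then show ?thesis
    using assms(1)[OF assms(2)] deg_cong[OF assms(1)] by (simp add: sync_def)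
qed

lemma pot_cong:
  assumes "\<And>u. u \<in> V \<Longrightarrow> \<sigma> u = \<sigma>' u" "v \<in> V"
  shows "pot N R \<alpha> j \<sigma> v = pot N R \<alpha> j \<sigma>' v"
proof -
  have "\<sigma> u = \<sigma>' u" if "u \<in> N v" for u using that N_subset assms(1) by auto
  then show ?thesis
    using assms(1)[OF assms(2)] deg_cong[OF assms(1)] by (simp add: pot_def removed_def)
qed

text \<open>A level exceeds the number of elapsed rounds by at most 1, so a state reads only coins
  of earlier rounds, and only that many bits of each. The past is therefore a finite set of
  positions, disjoint from those of the coming round.\<close>

lemma state_cong_aux:
  assumes "\<And>u. u \<in> V \<Longrightarrow> base N R r k u = base N R r' k u"
    and "\<And>t u l. t < k * R + j \<Longrightarrow> u \<in> V \<Longrightarrow> l \<le> Suc (k * R + j) \<Longrightarrow> coin r t u l = coin r' t u l"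
    and "v \<in> V"
  shows "state N R r k j v = state N R r' k j v"
  using assms(2,3)
proof (induction j arbitrary: v)
  case (Suc j)
  show ?case unfolding state_Suc
  proof (rule mis_round_cong[where L = "Suc (k * R + j)"])
    show "coin r (k * R + j) u l = coin r' (k * R + j) u l" if "u \<in> V" "l \<le> Suc (k * R + j)" for u l
      using Suc.prems(1)[of "k * R + j" u l] that by auto
    show "state N R r k j u = state N R r' k j u" if "u \<in> V" for u
      using that Suc.prems(1) by (intro Suc.IH) auto
    show "lev (base N R r k u) \<le> Suc (k * R + j)" for u using lev_base[of N R r k u] by simp
    show "lev (state N R r k j u) \<le> Suc (k * R + j)" for u by (rule lev_state)
  qed (use assms Suc.prems in auto)
qed (use assms in \<open>simp add: state_0\<close>)

lemma base_cong:
  assumes "\<And>t u l. t < k * R \<Longrightarrow> u \<in> V \<Longrightarrow> l \<le> Suc (k * R) \<Longrightarrow> coin r t u l = coin r' t u l" "v \<in> V"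
  shows "base N R r k v = base N R r' k v"
  using assms
proof (induction k arbitrary: v)
  case (Suc k)
  have "state N R r k R u = state N R r' k R u" if "u \<in> V" for u
    using Suc.prems(1) that by (intro state_cong_aux Suc.IH) auto
  then show ?case unfolding base_Suc using Suc.prems by (intro sync_cong) auto
qed simp

lemma state_cong:
  assumes "\<And>t u l. t < k * R + j \<Longrightarrow> u \<in> V \<Longrightarrow> l \<le> Suc (k * R + j) \<Longrightarrow> coin r t u l = coin r' t u l" "v \<in> V"
  shows "state N R r k j v = state N R r' k j v"
  using assms by (intro state_cong_aux base_cong) auto

text \<open>A node is dormant after \<open>sync\<close> only if its old degree exceeds 4^R, so the
  restored floor lies below that degree. A node that wakes up exchanges its floor for 1/16. Hence
  the phase change costs nothing.\<close>

lemma pot_sync_le: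
  assumes "0 \<le> \<alpha>"
  shows "pot N R \<alpha> 0 (sync N R \<sigma>) v \<le> pot N R \<alpha> R \<sigma> v"
proof (cases "removed N (sync N R \<sigma>) v")
  case True
  then show ?thesis using assms by (auto simp: pot_def)
next
  case False
  then have nr: "\<not> removed N \<sigma> v" by (auto simp: removed_def sync_def split: if_splits)
  have "psi R 0 (dor (sync N R \<sigma> v)) (deg N (sync N R \<sigma>) v) \<le> psi R R (dor (\<sigma> v)) (deg N \<sigma> v)"
    using deg_sync_le[of R \<sigma> v] psi_pos(1)[of R R "dor (\<sigma> v)" "deg N \<sigma> v"]
      psi_pos(2)[of R R "deg N \<sigma> v" "dor (\<sigma> v)"]
    unfolding psi_def[of R 0] by (auto simp: sync_def)
  moreover have "0 \<le> psi R 0 (dor (sync N R \<sigma> v)) (deg N (sync N R \<sigma>) v)"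
    unfolding psi_def by (auto simp: le_max_iff_disj)
  ultimately show ?thesis
    using False nr assms by (auto simp: pot_def sync_def intro!: mult_left_mono powr_mono2)
qed

end

locale mis_process = nbr_graph +
  fixes R K \<Delta> :: nat and \<alpha> :: real
  assumes card_N: "card (N v) \<le> \<Delta>"
    and \<Delta>: "1 \<le> \<Delta>"
    and \<alpha>: "\<alpha> = exp (-18) / 12288"
    and R: "16 * (1/2) ^ R \<le> \<alpha>"
begin

section \<open>Expected product of the potentials of separated nodes\<close>

definition "L = Suc (K * R)"

definition atoms_at :: "nat \<Rightarrow> nat set" where
  "atoms_at t = (\<Union>u\<in>V. pos t u ` {..<L})"

definition atoms_before :: "nat \<Rightarrow> nat set" where
  "atoms_before T = (\<Union>t<T. atoms_at t)"

lemma finite_atoms: "finite (atoms_at t)" "finite (atoms_before T)"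
  using finite_V by (auto simp: atoms_at_def atoms_before_def)

lemma \<alpha>_bounds: "0 < \<alpha>" "8 * \<alpha> \<le> 1"
proof -
  have "exp (-18) \<le> (1::real)" by simp
  then show "0 < \<alpha>" "8 * \<alpha> \<le> 1" unfolding \<alpha> by (simp, linarith)
qed

lemma coin_union_before:
  assumes "t < T" "u \<in> V" "l \<le> L" "c' \<subseteq> atoms_at T"
  shows "coin (\<lambda>i. i \<in> c \<union> c') t u l = coin (\<lambda>i. i \<in> c) t u l"
  using assms unfolding coin_def atoms_at_def by (auto simp: pos_inject subset_iff)

lemma coin_union_now:
  assumes "c \<subseteq> atoms_before T"
  shows "coin (\<lambda>i. i \<in> c \<union> c') T u l = coin (\<lambda>i. i \<in> c') T u l"
  using assms unfolding coin_def atoms_before_def atoms_at_def by (auto simp: pos_inject subset_iff)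

lemma one_round_state:
  assumes "k * R + j < K * R" "j < R"
  shows "one_round V N R L (pos t) (base N R r k) (state N R r k j)"
proof
  show "1 \<le> lev (state N R r k j u)" for u by (rule lev_state)
  show "lev (state N R r k j u) \<le> L" for u
    using lev_state(2)[of N R r k j u] assms by (simp add: L_def)
  show "lev (base N R r k u) \<le> L" for u
    using lev_base[of N R r k u] assms by (simp add: L_def)
  show "lev (base N R r k u) - R \<le> lev (state N R r k j u)" for u
    using lev_state(3)[of N R r k u j] assms by linarith
  show "stat (state N R r k j u) = Und \<Longrightarrow> stat (base N R r k u) = Und" for u by (rule Und_state)
  show "stat (state N R r k j u) = Und \<Longrightarrow> \<not> dor (state N R r k j u) \<Longrightarrow> deg N (base N R r k) u \<le> 4 ^ R" for u
    by (intro deg_base_le not_dor_state)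
qed (auto simp: pos_inject)

definition Phi :: "nat set \<Rightarrow> nat \<Rightarrow> nat \<Rightarrow> real" where
  "Phi S k j = avg (atoms_before (k * R + j)) (\<lambda>c. \<Prod>v\<in>S. pot N R \<alpha> j (state N R (\<lambda>i. i \<in> c) k j) v)"

lemma Phi_step:
  assumes S: "S \<subseteq> V" "disjoint_family_on (nball N 2) S" and t: "k * R + j < K * R" "j < R"
  shows "Phi S k (Suc j) \<le> (1 - \<alpha>/4) ^ card S * Phi S k j"
proof -
  let ?T = "k * R + j"
  have un: "atoms_before (k * R + Suc j) = atoms_before ?T \<union> atoms_at ?T"
    by (auto simp: atoms_before_def less_Suc_eq)
  have disj: "atoms_before ?T \<inter> atoms_at ?T = {}"
    by (auto simp: atoms_before_def atoms_at_def pos_inject)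
  have "Phi S k (Suc j) = avg (atoms_before ?T) (\<lambda>c. avg (atoms_at ?T) (\<lambda>c'.
      \<Prod>v\<in>S. pot N R \<alpha> (Suc j) (state N R (\<lambda>i. i \<in> c \<union> c') k (Suc j)) v))"
    unfolding Phi_def un by (intro avg_union finite_atoms disj)
  also have "\<dots> \<le> avg (atoms_before ?T) (\<lambda>c. (1 - \<alpha>/4) ^ card S * (\<Prod>v\<in>S. pot N R \<alpha> j (state N R (\<lambda>i. i \<in> c) k j) v))"
  proof (rule avg_mono)
    fix c assume c: "c \<subseteq> atoms_before ?T"
    interpret O: one_round V N R L "pos ?T" "base N R (\<lambda>i. i \<in> c) k" "state N R (\<lambda>i. i \<in> c) k j"
      by (rule one_round_state[OF t])
    have At: "O.At = atoms_at ?T" by (simp add: O.At_def O.atoms_def atoms_at_def)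
    have h: "O.h c' = coin (\<lambda>i. i \<in> c') ?T" for c' by (intro ext) (simp add: O.h_def coin_def)
    have "avg (atoms_at ?T) (\<lambda>c'. \<Prod>v\<in>S. pot N R \<alpha> (Suc j) (state N R (\<lambda>i. i \<in> c \<union> c') k (Suc j)) v)
      = avg (atoms_at ?T) (\<lambda>c'. \<Prod>v\<in>S. pot N R \<alpha> (j + 1)
          (mis_round N R (O.h c') (base N R (\<lambda>i. i \<in> c) k) (state N R (\<lambda>i. i \<in> c) k j)) v)"
    proof (intro avg_cong prod.cong refl)
      fix c' v assume c': "c' \<subseteq> atoms_at ?T" and v: "v \<in> S"
      have eq: "coin (\<lambda>i. i \<in> c \<union> c') s u l = coin (\<lambda>i. i \<in> c) s u l"
        if "s < k * R + j" "u \<in> V" "l \<le> Suc (k * R + j)" for s u l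
        using that t c' by (intro coin_union_before) (auto simp: L_def)
      have "state N R (\<lambda>i. i \<in> c \<union> c') k (Suc j) u
        = mis_round N R (O.h c') (base N R (\<lambda>i. i \<in> c) k) (state N R (\<lambda>i. i \<in> c) k j) u" if "u \<in> V" for u
        unfolding state_Suc
      proof (rule mis_round_cong[where L = L])
        show "coin (\<lambda>i. i \<in> c \<union> c') ?T u l = O.h c' u l" for u l
          unfolding h by (rule coin_union_now[OF c])
        show "base N R (\<lambda>i. i \<in> c \<union> c') k u = base N R (\<lambda>i. i \<in> c) k u" if "u \<in> V" for u
          using eq that by (intro base_cong) auto
        show "state N R (\<lambda>i. i \<in> c \<union> c') k j u = state N R (\<lambda>i. i \<in> c) k j u" if "u \<in> V" for u
          using eq that by (intro state_cong) auto
        show "lev (base N R (\<lambda>i. i \<in> c \<union> c') k u) \<le> L" for u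
          using lev_base[of N R "\<lambda>i. i \<in> c \<union> c'" k u] t by (simp add: L_def)
        show "lev (state N R (\<lambda>i. i \<in> c \<union> c') k j u) \<le> L" for u
          using lev_state(2)[of N R "\<lambda>i. i \<in> c \<union> c'" k j u] t by (simp add: L_def)
      qed (rule that)
      then show "pot N R \<alpha> (Suc j) (state N R (\<lambda>i. i \<in> c \<union> c') k (Suc j)) v
        = pot N R \<alpha> (j + 1) (mis_round N R (O.h c') (base N R (\<lambda>i. i \<in> c) k) (state N R (\<lambda>i. i \<in> c) k j)) v"
        using S v by (auto intro: pot_cong)
    qed
    also have "\<dots> \<le> (1 - \<alpha>/4) ^ card S * (\<Prod>v\<in>S. pot N R \<alpha> j (state N R (\<lambda>i. i \<in> c) k j) v)"
      using O.product_contracts[OF S t(2) \<alpha> R] unfolding At .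
    finally show "avg (atoms_at ?T) (\<lambda>c'. \<Prod>v\<in>S. pot N R \<alpha> (Suc j) (state N R (\<lambda>i. i \<in> c \<union> c') k (Suc j)) v)
      \<le> (1 - \<alpha>/4) ^ card S * (\<Prod>v\<in>S. pot N R \<alpha> j (state N R (\<lambda>i. i \<in> c) k j) v)" .
  qed
  finally show ?thesis by (simp add: Phi_def avg_cmult)
qed

lemma Phi_sync: "Phi S (Suc k) 0 \<le> Phi S k R"
proof -
  have "Phi S (Suc k) 0 = avg (atoms_before (k * R + R)) (\<lambda>c. \<Prod>v\<in>S. pot N R \<alpha> 0 (sync N R (state N R (\<lambda>i. i \<in> c) k R)) v)"
    by (simp add: Phi_def state_0 base_Suc add.commute del: base.simps)
  also have "\<dots> \<le> Phi S k R"
    unfolding Phi_def using \<alpha>_bounds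
    by (intro avg_mono prod_mono conjI pot_sync_le) (auto simp: pot_def)
  finally show ?thesis .
qed

text \<open>At level 1 the level factor is at most 2. A dormant node has floor 4^R below its degree,
  so \<open>psi\<close> is at most \<Delta>, and so is its power because 8 \<alpha> is at most
  1.\<close>

lemma Phi_0:
  assumes "S \<subseteq> V"
  shows "Phi S 0 0 \<le> (2 * real \<Delta>) ^ card S"
proof -
  have "pot N R \<alpha> 0 (base N R r 0) v \<le> 2 * real \<Delta>" for r v
  proof -
    let ?\<sigma> = "\<lambda>_::nat. Node 1 False Und"
    have d: "deg N ?\<sigma> v \<le> real \<Delta>" using card_N[of v] by (simp add: deg_def)
    have p: "psi R 0 (dor (base N R r 0 v)) (deg N (base N R r 0) v) \<le> real \<Delta>"
      unfolding psi_def
    proof (rule max.boundedI)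
      show "deg N (base N R r 0) v \<le> real \<Delta>"
        using d deg_sync_le[of R ?\<sigma> v] by simp
      have "(4::real) ^ R \<le> real \<Delta>" if "dor (base N R r 0 v)"
      proof -
        have "(4::real) ^ R < deg N ?\<sigma> v" using that by (simp add: sync_def)
        then show ?thesis using d by linarith
      qed
      then show "(if dor (base N R r 0 v) then 4 ^ R * (3/4) ^ 0 else 1/16) \<le> real \<Delta>"
        using \<Delta> by (simp del: base.simps)
    qed
    have p1: "0 \<le> psi R 0 (dor (base N R r 0 v)) (deg N (base N R r 0) v)"
      unfolding psi_def by (auto simp: le_max_iff_disj)
    have "psi R 0 (dor (base N R r 0 v)) (deg N (base N R r 0) v) powr (8 * \<alpha>) \<le> real \<Delta> powr (8 * \<alpha>)"
      using p p1 \<alpha>_bounds by (intro powr_mono2) auto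
    also have "\<dots> \<le> real \<Delta> powr 1" using \<Delta> \<alpha>_bounds by (intro powr_mono) auto
    finally have "(1 + \<alpha>) * psi R 0 (dor (base N R r 0 v)) (deg N (base N R r 0) v) powr (8 * \<alpha>) \<le> 2 * real \<Delta>"
      using \<alpha>_bounds \<Delta> by (intro mult_mono) auto
    moreover have "lev (base N R r 0 v) = 1" by (simp add: sync_def)
    ultimately show ?thesis unfolding pot_def by simp
  qed
  then have "(\<Prod>v\<in>S. pot N R \<alpha> 0 (base N R r 0) v) \<le> (\<Prod>v\<in>S. 2 * real \<Delta>)" for r
    using \<alpha>_bounds by (intro prod_mono) (auto simp: pot_def)
  then show ?thesis by (simp add: Phi_def atoms_before_def state_0 avg_def del: base.simps)
qed

lemma Phi_le_aux:
  assumes S: "S \<subseteq> V" "disjoint_family_on (nball N 2) S"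
    and "k < K" "j \<le> R" "Phi S k 0 \<le> ((1 - \<alpha>/4) ^ (k * R) * (2 * real \<Delta>)) ^ card S"
  shows "Phi S k j \<le> ((1 - \<alpha>/4) ^ (k * R + j) * (2 * real \<Delta>)) ^ card S"
  using assms(4)
proof (induction j)
  case (Suc j)
  have "k * R + R \<le> K * R" using \<open>k < K\<close> mult_le_mono1[of "Suc k" K R] by simp
  then have "Phi S k (Suc j) \<le> (1 - \<alpha>/4) ^ card S * Phi S k j"
    using Suc.prems by (intro Phi_step S) auto
  also have "\<dots> \<le> (1 - \<alpha>/4) ^ card S * ((1 - \<alpha>/4) ^ (k * R + j) * (2 * real \<Delta>)) ^ card S"
    using Suc \<alpha>_bounds by (intro mult_left_mono) auto
  also have "\<dots> = ((1 - \<alpha>/4) ^ (k * R + Suc j) * (2 * real \<Delta>)) ^ card S"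
    by (simp add: power_mult_distrib flip: power_mult power_add)
  finally show ?case .
qed (use assms in simp)

lemma Phi_le:
  assumes S: "S \<subseteq> V" "disjoint_family_on (nball N 2) S" and "k \<le> K"
  shows "Phi S k 0 \<le> ((1 - \<alpha>/4) ^ (k * R) * (2 * real \<Delta>)) ^ card S"
  using assms(3)
proof (induction k)
  case (Suc k)
  then show ?case
    using Phi_sync[of S k] Phi_le_aux[OF S, of k R] by (simp add: add.commute)
qed (use Phi_0[OF S(1)] in simp)

text \<open>Markov's inequality. After \<open>sync\<close> an undecided node has no neighbor with
  status \<open>In\<close>, so it is not removed and its potential is at least 1/16; the factor 32
  is 16 times the initial 2.\<close>

theorem undecided_prob:
  assumes S: "S \<subseteq> V" "disjoint_family_on (nball N 2) S"
  shows "avg (atoms_before (K * R)) (\<lambda>c. of_bool (\<forall>v\<in>S. stat (base N R (\<lambda>i. i \<in> c) K v) = Und))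
    \<le> (32 * real \<Delta> * (1 - \<alpha>/4) ^ (K * R)) ^ card S"
proof -
  have fin: "finite S" using S finite_V finite_subset by auto
  have low: "1/16 \<le> pot N R \<alpha> 0 (base N R r K) v" if "stat (base N R r K v) = Und" for r v
  proof -
    have nr: "\<not> removed N (base N R r K) v"
      using that by (cases K) (auto simp: removed_def sync_def split: if_splits)
    have "(1/16) powr 1 \<le> (1/16::real) powr (8 * \<alpha>)" using \<alpha>_bounds by (intro powr_mono') auto
    also have "\<dots> \<le> psi R 0 (dor (base N R r K v)) (deg N (base N R r K) v) powr (8 * \<alpha>)"
      using \<alpha>_bounds psi_pos(1)[of 0 R] by (intro powr_mono2) auto
    finally have "1 * (1/16) \<le> (1 + \<alpha>) ^ lev (base N R r K v) * psi R 0 (dor (base N R r K v)) (deg N (base N R r K) v) powr (8 * \<alpha>)"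
      using \<alpha>_bounds by (intro mult_mono) (auto simp: one_le_power)
    then show ?thesis using nr by (simp add: pot_def)
  qed
  have "avg (atoms_before (K * R)) (\<lambda>c. of_bool (\<forall>v\<in>S. stat (base N R (\<lambda>i. i \<in> c) K v) = Und))
    \<le> avg (atoms_before (K * R)) (\<lambda>c. 16 ^ card S * (\<Prod>v\<in>S. pot N R \<alpha> 0 (base N R (\<lambda>i. i \<in> c) K) v))"
  proof (rule avg_mono)
    fix c
    let ?r = "\<lambda>i::nat. i \<in> c"
    show "of_bool (\<forall>v\<in>S. stat (base N R ?r K v) = Und) \<le> 16 ^ card S * (\<Prod>v\<in>S. pot N R \<alpha> 0 (base N R ?r K) v)"
    proof (cases "\<forall>v\<in>S. stat (base N R ?r K v) = Und")
      case True
      then have "(\<Prod>v\<in>S. 1) \<le> (\<Prod>v\<in>S. 16 * pot N R \<alpha> 0 (base N R ?r K) v)"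
        using low by (intro prod_mono) fastforce
      then show ?thesis using True by (simp add: prod.distrib)
    next
      case False
      have "0 \<le> (\<Prod>v\<in>S. pot N R \<alpha> 0 (base N R ?r K) v)"
        using \<alpha>_bounds by (intro prod_nonneg) (auto simp: pot_def)
      moreover have "of_bool (\<forall>v\<in>S. stat (base N R ?r K v) = Und) = (0::real)"
        using False by (simp only: of_bool_eq_0_iff not_False_eq_True)
      ultimately show ?thesis by (simp only: mult_nonneg_nonneg zero_le_power zero_le_numeral)
    qed
  qed
  also have "\<dots> = 16 ^ card S * Phi S K 0" by (simp add: avg_cmult Phi_def state_0)
  also have "\<dots> \<le> 16 ^ card S * ((1 - \<alpha>/4) ^ (K * R) * (2 * real \<Delta>)) ^ card S"
    by (intro mult_left_mono Phi_le S) auto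
  also have "\<dots> = (32 * real \<Delta> * (1 - \<alpha>/4) ^ (K * R)) ^ card S"
    by (simp add: mult_ac flip: power_mult_distrib)
  finally show ?thesis .
qed

end

section \<open>Shattering\<close>

definition conn :: "(nat \<Rightarrow> nat set) \<Rightarrow> nat set \<Rightarrow> bool" where
  "conn N C \<longleftrightarrow> (\<forall>x\<in>C. \<forall>y\<in>C. (x, y) \<in> {(a, b). a \<in> C \<and> b \<in> C \<and> b \<in> N a}\<^sup>*)"

lemma rtrancl_exit:
  assumes "(x, y) \<in> r\<^sup>*" "x \<in> U" "y \<notin> U"
  shows "\<exists>a b. (a, b) \<in> r \<and> a \<in> U \<and> b \<notin> U"
  using assms by (induction rule: rtrancl_induct) blast+

context nbr_graph
begin

section \<open>Balls, and walks with steps of length at most five\<close>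

lemma nball_self: "v \<in> nball N i v"
  by (induction i) auto

lemma nball_trans: "w \<in> nball N i v \<Longrightarrow> x \<in> nball N j w \<Longrightarrow> x \<in> nball N (i + j) v"
  by (induction j arbitrary: x) auto

lemma nball_1: "w \<in> nball N 1 v \<longleftrightarrow> w = v \<or> w \<in> N v"
  by auto

lemma nball_sym: "w \<in> nball N i v \<Longrightarrow> v \<in> nball N i w"
proof (induction i arbitrary: w)
  case (Suc i)
  then obtain u where u: "u \<in> nball N i v" "w = u \<or> w \<in> N u" by auto
  then have "u \<in> nball N 1 w" using N_sym nball_1 by auto
  then show ?case using nball_trans[of u 1 w v i] Suc.IH[OF u(1)] by simp
qed simp

lemma separated_disjoint:
  assumes "\<And>v w. v \<in> S \<Longrightarrow> w \<in> S \<Longrightarrow> v \<noteq> w \<Longrightarrow> w \<notin> nball N 4 v"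
  shows "disjoint_family_on (nball N 2) S"
  unfolding disjoint_family_on_def
proof (intro ballI impI)
  fix v w assume "v \<in> S" "w \<in> S" "v \<noteq> w"
  then have "w \<notin> nball N (2 + 2) v" using assms by simp
  then show "nball N 2 v \<inter> nball N 2 w = {}" using nball_trans nball_sym by blast
qed

text \<open>The current end of a walk is the head of the list, so that a further step is a cons with
  at most (D + 1)^5 choices.\<close>

primrec walks :: "nat \<Rightarrow> nat list set" where
  "walks 0 = (\<lambda>x. [x]) ` V"
| "walks (Suc m) = (\<Union>xs\<in>walks m. (\<lambda>x. x # xs) ` nball N 5 (hd xs))"

lemma in_walks:
  "length xs = Suc m \<Longrightarrow> successively (\<lambda>x y. x \<in> nball N 5 y) xs \<Longrightarrow> set xs \<subseteq> V \<Longrightarrow> xs \<in> walks m"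
proof (induction m arbitrary: xs)
  case 0
  then show ?case by (auto simp: length_Suc_conv)
next
  case (Suc m)
  then obtain x ys where xs: "xs = x # ys" "length ys = Suc m" by (auto simp: length_Suc_conv)
  then have "ys \<in> walks m" "x \<in> nball N 5 (hd ys)"
    using Suc by (auto simp: successively_Cons)
  then show ?case using xs by auto
qed

lemma finite_nball: "finite (nball N i v)"
  using finite_N by (induction i) auto

lemma finite_walks: "finite (walks m)"
  using finite_V finite_nball by (induction m) auto

lemma card_nball:
  assumes "\<And>v. card (N v) \<le> D"
  shows "card (nball N i v) \<le> (D + 1) ^ i"
proof (induction i)
  case (Suc i)
  have "card (nball N (Suc i) v) \<le> (\<Sum>u\<in>nball N i v. card (insert u (N u)))"
    using finite_nball by (simp add: card_UN_le)
  also have "\<dots> \<le> (\<Sum>u\<in>nball N i v. D + 1)"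
    using assms finite_N N_irrefl by (intro sum_mono) (simp add: card_insert_if)
  also have "\<dots> \<le> (D + 1) ^ i * (D + 1)" using Suc by (simp only: sum_constant of_nat_id mult_le_mono1)
  finally show ?case by (simp only: power_Suc2)
qed simp

lemma card_walks:
  assumes "\<And>v. card (N v) \<le> D"
  shows "card (walks m) \<le> card V * ((D + 1) ^ 5) ^ m"
proof (induction m)
  case 0
  then show ?case using finite_V by (simp add: card_image_le)
next
  case (Suc m)
  have "card (walks (Suc m)) \<le> (\<Sum>xs\<in>walks m. card ((\<lambda>x. x # xs) ` nball N 5 (hd xs)))"
    using finite_walks by (simp add: card_UN_le)
  also have "\<dots> \<le> (\<Sum>xs\<in>walks m. (D + 1) ^ 5)"
    using card_nball[OF assms] finite_nball by (intro sum_mono) (meson card_image_le le_trans)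
  also have "\<dots> \<le> card V * ((D + 1) ^ 5) ^ m * (D + 1) ^ 5"
    using Suc by (simp only: sum_constant of_nat_id mult_le_mono1)
  finally show ?case by (simp only: power_Suc2 mult.assoc)
qed

text \<open>
  A walk around a spanning tree visits the separated nodes. Counting walks instead of sequences of
  separated nodes avoids a factorial in the union bound.
\<close>

lemma separated_walk:
  assumes D: "\<And>v. card (N v) \<le> D" and C: "C \<subseteq> V" "conn N C" and card: "i * (D + 1) ^ 4 < card C"
  shows "\<exists>xs. length xs = Suc (2 * i) \<and> successively (\<lambda>x y. x \<in> nball N 5 y) xs \<and> set xs \<subseteq> C
    \<and> card (set xs) = Suc i \<and> (\<forall>v\<in>set xs. \<forall>w\<in>set xs. v \<noteq> w \<longrightarrow> w \<notin> nball N 4 v)"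
  using card
proof (induction i)
  case 0
  then obtain x where "x \<in> C" by fastforce
  then show ?case by (intro exI[of _ "[x]"]) auto
next
  case (Suc i)
  then have "i * (D + 1) ^ 4 < card C" by simp
  then obtain xs where xs: "length xs = Suc (2 * i)" "successively (\<lambda>x y. x \<in> nball N 5 y) xs"
    "set xs \<subseteq> C" "card (set xs) = Suc i"
    "\<And>v w. v \<in> set xs \<Longrightarrow> w \<in> set xs \<Longrightarrow> v \<noteq> w \<Longrightarrow> w \<notin> nball N 4 v"
    using Suc.IH by auto
  define U where "U = (\<Union>x\<in>set xs. nball N 4 x)"
  have "card U \<le> (\<Sum>x\<in>set xs. card (nball N 4 x))" unfolding U_def by (intro card_UN_le) simp
  also have "\<dots> \<le> (\<Sum>x\<in>set xs. (D + 1) ^ 4)" by (intro sum_mono card_nball D)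
  also have "\<dots> = Suc i * (D + 1) ^ 4" using xs by simp
  also have "\<dots> < card C" by (rule Suc.prems)
  finally have "\<not> C \<subseteq> U"
    using card_mono[of U C] finite_nball by (auto simp: U_def)
  then obtain y where y: "y \<in> C" "y \<notin> U" by auto
  obtain x0 where x0: "x0 \<in> set xs" using xs(1) by (cases xs) auto
  then have "x0 \<in> U" "x0 \<in> C" using nball_self xs by (auto simp: U_def)
  \<comment> \<open>The 4-balls around the nodes found so far do not cover \<open>C\<close>, so by
    connectedness some edge inside \<open>C\<close> leaves them. Its outer end \<open>b\<close> is
    far from all these nodes but within distance five of one of them.\<close>
  then obtain a b where ab: "a \<in> C" "b \<in> C" "b \<in> N a" "a \<in> U" "b \<notin> U"
    using rtrancl_exit[of x0 y "{(a, b). a \<in> C \<and> b \<in> C \<and> b \<in> N a}" U] y C(2)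
    unfolding conn_def by auto
  obtain x where x: "x \<in> set xs" "a \<in> nball N 4 x" using ab by (auto simp: U_def)
  have "b \<in> nball N (4 + 1) x" using x ab by (intro nball_trans[of a]) auto
  then have bx: "b \<in> nball N 5 x" "x \<in> nball N 5 b" using nball_sym by auto
  obtain as bs where split: "xs = as @ x # bs" using split_list[OF x(1)] by auto
  \<comment> \<open>A detour from \<open>x\<close> to \<open>b\<close> and back keeps the list a
    walk and adds two entries for one new node.\<close>
  define ys where "ys = as @ x # b # x # bs"
  have b_new: "b \<notin> nball N 4 v" if "v \<in> set xs" for v using ab that by (auto simp: U_def)
  then have b_xs: "b \<notin> set xs" using nball_self by blast
  have set: "set ys = insert b (set xs)" unfolding ys_def split by auto
  have "successively (\<lambda>x y. x \<in> nball N 5 y) ys"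
    using xs(2) bx unfolding ys_def split by (auto simp: successively_append_iff successively_Cons)
  moreover have "length ys = Suc (2 * Suc i)" using xs(1) unfolding ys_def split by simp
  moreover have "set ys \<subseteq> C" "card (set ys) = Suc (Suc i)" using set xs ab b_xs by auto
  moreover have "\<forall>v\<in>set ys. \<forall>w\<in>set ys. v \<noteq> w \<longrightarrow> w \<notin> nball N 4 v"
    unfolding set
  proof (intro ballI impI)
    fix v w assume "v \<in> insert b (set xs)" "w \<in> insert b (set xs)" "v \<noteq> w"
    then consider "v = b" "w \<in> set xs" | "w = b" "v \<in> set xs" | "v \<in> set xs" "w \<in> set xs" by auto
    then show "w \<notin> nball N 4 v"
    proof cases
      case 1
      then show ?thesis using b_new[of w] nball_sym[of w 4 b] by auto
    qed (use b_new xs(5) \<open>v \<noteq> w\<close> in auto)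
  qed
  ultimately show ?case by blast
qed

end

context mis_process
begin

definition large_cluster :: "nat \<Rightarrow> (nat \<Rightarrow> bool) \<Rightarrow> bool" where
  "large_cluster m r \<longleftrightarrow> (\<exists>C\<subseteq>V. conn N C \<and> (\<forall>v\<in>C. stat (base N R r K v) = Und) \<and> m < card C)"

text \<open>Union bound: there are at most \<open>card V\<close> times (\<Delta> + 1)^(10 i) walks
  with 2 i steps, and the i + 1 separated nodes on one are all undecided with probability at most
  (\<Delta> + 1)^(- 11 (i + 1)). What remains is at most 2^(- (i + 1)) per starting node.\<close>

theorem large_cluster_prob:
  assumes eps: "32 * real \<Delta> * (1 - \<alpha>/4) ^ (K * R) \<le> 1 / (real \<Delta> + 1) ^ 11"
  shows "avg (atoms_before (K * R)) (\<lambda>c. of_bool (large_cluster (i * (\<Delta> + 1) ^ 4) (\<lambda>i. i \<in> c)))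
    \<le> real (card V) / 2 ^ Suc i"
proof -
  let ?Und = "\<lambda>c xs. \<forall>v\<in>set xs. stat (base N R (\<lambda>i. i \<in> c) K v) = Und"
  let ?A = "atoms_before (K * R)"
  define W where "W = {xs \<in> walks (2 * i). set xs \<subseteq> V \<and> card (set xs) = Suc i
    \<and> (\<forall>v\<in>set xs. \<forall>w\<in>set xs. v \<noteq> w \<longrightarrow> w \<notin> nball N 4 v)}"
  have finW: "finite W" unfolding W_def using finite_walks by simp
  have "avg ?A (\<lambda>c. of_bool (large_cluster (i * (\<Delta> + 1) ^ 4) (\<lambda>i. i \<in> c)))
    \<le> avg ?A (\<lambda>c. \<Sum>xs\<in>W. of_bool (?Und c xs))"
  proof (rule avg_mono)
    fix c
    show "of_bool (large_cluster (i * (\<Delta> + 1) ^ 4) (\<lambda>i. i \<in> c)) \<le> (\<Sum>xs\<in>W. of_bool (?Und c xs) :: real)"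
    proof (cases "large_cluster (i * (\<Delta> + 1) ^ 4) (\<lambda>i. i \<in> c)")
      case True
      then obtain C where C: "C \<subseteq> V" "conn N C" "\<forall>v\<in>C. stat (base N R (\<lambda>i. i \<in> c) K v) = Und"
        "i * (\<Delta> + 1) ^ 4 < card C" by (auto simp: large_cluster_def)
      obtain xs where xs: "length xs = Suc (2 * i)" "successively (\<lambda>x y. x \<in> nball N 5 y) xs"
        "set xs \<subseteq> C" "card (set xs) = Suc i"
        "\<forall>v\<in>set xs. \<forall>w\<in>set xs. v \<noteq> w \<longrightarrow> w \<notin> nball N 4 v"
        using separated_walk[OF card_N C(1,2,4)] by auto
      have "xs \<in> W" using xs C(1) in_walks unfolding W_def by auto
      moreover have "?Und c xs" using xs C by auto
      ultimately have "1 \<le> (\<Sum>xs\<in>W. of_bool (?Und c xs) :: real)"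
        using finW member_le_sum[of xs W "\<lambda>xs. of_bool (?Und c xs) :: real"] by auto
      then show ?thesis using True by simp
    qed (simp add: sum_nonneg)
  qed
  also have "\<dots> = (\<Sum>xs\<in>W. avg ?A (\<lambda>c. of_bool (?Und c xs)))" by (rule avg_sum)
  also have "\<dots> \<le> (\<Sum>xs\<in>W. (1 / (real \<Delta> + 1) ^ 11) ^ Suc i)"
  proof (rule sum_mono)
    fix xs assume "xs \<in> W"
    then have "avg ?A (\<lambda>c. of_bool (?Und c xs)) \<le> (32 * real \<Delta> * (1 - \<alpha>/4) ^ (K * R)) ^ Suc i"
      using undecided_prob[of "set xs"] separated_disjoint[of "set xs"] by (auto simp: W_def)
    also have "\<dots> \<le> (1 / (real \<Delta> + 1) ^ 11) ^ Suc i"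
      using eps \<alpha>_bounds by (intro power_mono) auto
    finally show "avg ?A (\<lambda>c. of_bool (?Und c xs)) \<le> (1 / (real \<Delta> + 1) ^ 11) ^ Suc i" .
  qed
  also have "\<dots> = real (card W) * (1 / (real \<Delta> + 1) ^ 11) ^ Suc i" by simp
  also have "\<dots> \<le> (real (card V) * ((real \<Delta> + 1) ^ 5) ^ (2 * i)) * (1 / (real \<Delta> + 1) ^ 11) ^ Suc i"
  proof (rule mult_right_mono)
    have "card W \<le> card (walks (2 * i))" unfolding W_def using finite_walks by (intro card_mono) auto
    also have "\<dots> \<le> card V * ((\<Delta> + 1) ^ 5) ^ (2 * i)" by (intro card_walks card_N)
    finally have "real (card W) \<le> real (card V * ((\<Delta> + 1) ^ 5) ^ (2 * i))" by (rule of_nat_mono)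
    then show "real (card W) \<le> real (card V) * ((real \<Delta> + 1) ^ 5) ^ (2 * i)" by (simp add: add.commute)
  qed simp
  also have "\<dots> \<le> real (card V) * (1/2) ^ Suc i"
  proof -
    let ?D = "real \<Delta> + 1"
    have "(?D ^ 5) ^ (2 * i) \<le> ?D ^ (10 * Suc i)"
      unfolding power_mult[symmetric] using \<Delta> by (intro power_increasing) auto
    then have "(?D ^ 5) ^ (2 * i) * (1 / ?D ^ 11) ^ Suc i \<le> ?D ^ (10 * Suc i) * (1 / ?D ^ 11) ^ Suc i"
      by (intro mult_right_mono) auto
    also have "\<dots> = (?D ^ 10 * (1 / ?D ^ 11)) ^ Suc i" by (simp only: power_mult power_mult_distrib)
    also have "?D ^ 10 * (1 / ?D ^ 11) = 1 / ?D"
      using \<Delta> by (simp add: field_simps flip: power_Suc)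
    also have "(1 / ?D) ^ Suc i \<le> (1/2) ^ Suc i"
      using \<Delta> by (intro power_mono frac_le) auto
    finally show ?thesis by (simp only: mult.assoc mult_left_mono of_nat_0_le_iff)
  qed
  finally show ?thesis by (simp add: power_divide)
qed

end

section \<open>Completion to a maximal independent set\<close>

text \<open>
  The choice depends only on the component and its edges, so all nodes of a component agree on it.
\<close>

definition mis_of :: "nat set \<Rightarrow> (nat \<times> nat) set \<Rightarrow> nat set" where
  "mis_of C A = (SOME M. M \<subseteq> C \<and> (\<forall>x\<in>M. \<forall>y\<in>M. (x, y) \<notin> A) \<and> (\<forall>x\<in>C - M. \<exists>y\<in>M. (x, y) \<in> A))"

lemma mis_of:
  assumes "finite C" "sym A" "irrefl A"
  shows "mis_of C A \<subseteq> C" "\<And>x y. x \<in> mis_of C A \<Longrightarrow> y \<in> mis_of C A \<Longrightarrow> (x, y) \<notin> A"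
    "\<And>x. x \<in> C \<Longrightarrow> x \<notin> mis_of C A \<Longrightarrow> \<exists>y\<in>mis_of C A. (x, y) \<in> A"
proof -
  have "\<exists>M. M \<subseteq> C \<and> (\<forall>x\<in>M. \<forall>y\<in>M. (x, y) \<notin> A) \<and> (\<forall>x\<in>C - M. \<exists>y\<in>M. (x, y) \<in> A)"
    using assms(1)
  proof (induction C rule: finite_induct)
    case (insert x C)
    then obtain M where M: "M \<subseteq> C" "\<forall>x\<in>M. \<forall>y\<in>M. (x, y) \<notin> A" "\<forall>x\<in>C - M. \<exists>y\<in>M. (x, y) \<in> A"
      by auto
    show ?case
    proof (cases "\<exists>y\<in>M. (x, y) \<in> A")
      case True
      then show ?thesis using M by (intro exI[of _ M]) auto
    next
      case False
      have "(x, x) \<notin> A" using assms(3) by (simp add: irrefl_def)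
      moreover have "(y, x) \<notin> A" if "y \<in> M" for y using False that symD[OF assms(2), of y x] by auto
      ultimately have "\<forall>a\<in>insert x M. \<forall>b\<in>insert x M. (a, b) \<notin> A" using M(2) False by simp
      moreover have "\<forall>a\<in>insert x C - insert x M. \<exists>y\<in>insert x M. (a, y) \<in> A" using M(3) by simp
      moreover have "insert x M \<subseteq> insert x C" using M(1) by auto
      ultimately show ?thesis by blast
    qed
  qed simp
  then have "mis_of C A \<subseteq> C \<and> (\<forall>x\<in>mis_of C A. \<forall>y\<in>mis_of C A. (x, y) \<notin> A)
    \<and> (\<forall>x\<in>C - mis_of C A. \<exists>y\<in>mis_of C A. (x, y) \<in> A)"
    unfolding mis_of_def by (rule someI_ex)
  then show "mis_of C A \<subseteq> C" "\<And>x y. x \<in> mis_of C A \<Longrightarrow> y \<in> mis_of C A \<Longrightarrow> (x, y) \<notin> A"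
    "\<And>x. x \<in> C \<Longrightarrow> x \<notin> mis_of C A \<Longrightarrow> \<exists>y\<in>mis_of C A. (x, y) \<in> A"
    by simp_all
qed

text \<open>Dormant nodes are exempt from the last condition, since they may miss a neighbor that
  joins until the next \<open>sync\<close>.\<close>

definition consistent :: "(nat \<Rightarrow> nat set) \<Rightarrow> (nat \<Rightarrow> node) \<Rightarrow> bool" where
  "consistent N \<sigma> \<longleftrightarrow>
     (\<forall>u v. stat (\<sigma> u) = In \<longrightarrow> v \<in> N u \<longrightarrow> stat (\<sigma> v) \<noteq> In) \<and>
     (\<forall>v. stat (\<sigma> v) = Out \<longrightarrow> (\<exists>u\<in>N v. stat (\<sigma> u) = In)) \<and>
     (\<forall>v. stat (\<sigma> v) = Und \<longrightarrow> \<not> dor (\<sigma> v) \<longrightarrow> (\<forall>u\<in>N v. stat (\<sigma> u) \<noteq> In))"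

definition und_edges :: "(nat \<Rightarrow> nat set) \<Rightarrow> (nat \<Rightarrow> node) \<Rightarrow> (nat \<times> nat) set" where
  "und_edges N \<sigma> = {(a, b). stat (\<sigma> a) = Und \<and> stat (\<sigma> b) = Und \<and> b \<in> N a}"

definition component :: "(nat \<Rightarrow> nat set) \<Rightarrow> (nat \<Rightarrow> node) \<Rightarrow> nat \<Rightarrow> nat set" where
  "component N \<sigma> v = {u. (v, u) \<in> (und_edges N \<sigma>)\<^sup>*}"

definition component_edges :: "(nat \<Rightarrow> nat set) \<Rightarrow> (nat \<Rightarrow> node) \<Rightarrow> nat \<Rightarrow> (nat \<times> nat) set" where
  "component_edges N \<sigma> v = und_edges N \<sigma> \<inter> component N \<sigma> v \<times> UNIV"

definition final_mis :: "(nat \<Rightarrow> nat set) \<Rightarrow> nat set \<Rightarrow> (nat \<Rightarrow> node) \<Rightarrow> nat set" where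
  "final_mis N V \<sigma> = {v \<in> V. stat (\<sigma> v) = In \<or>
     stat (\<sigma> v) = Und \<and> v \<in> mis_of (component N \<sigma> v) (component_edges N \<sigma> v)}"

context nbr_graph
begin

text \<open>A joining node is awake and so has no neighbor with status \<open>In\<close> before the
  round; two neighbors cannot join together, as each sees the mark of the other.\<close>

lemma consistent_mis_round:
  assumes "consistent N \<sigma>"
  shows "consistent N (mis_round N R h \<sigma>0 \<sigma>)"
proof -
  let ?\<tau> = "mis_round N R h \<sigma>0 \<sigma>"
  let ?join = "join N R h \<sigma>0 \<sigma>"
  have c1: "stat (\<sigma> v) \<noteq> In" if "stat (\<sigma> u) = In" "v \<in> N u" for u v
    using assms that unfolding consistent_def by blast
  have c2: "\<exists>u\<in>N v. stat (\<sigma> u) = In" if "stat (\<sigma> v) = Out" for v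
    using assms that unfolding consistent_def by blast
  have c3: "stat (\<sigma> u) \<noteq> In" if "stat (\<sigma> v) = Und" "\<not> dor (\<sigma> v)" "u \<in> N v" for u v
    using assms that unfolding consistent_def by blast
  have In: "stat (?\<tau> v) = In \<longleftrightarrow> stat (\<sigma> v) = In \<or> ?join v" for v
    by (auto simp: mis_round_def join_def mark_def)
  have joinD: "stat (\<sigma> v) = Und" "\<not> dor (\<sigma> v)" if "?join v" for v
    using that by (auto simp: join_def mark_def)
  have join2: "\<not> ?join u" if "?join v" "u \<in> N v" for u v
    using that by (auto simp: join_def seen_def)
  show ?thesis unfolding consistent_def
  proof (intro conjI allI impI ballI)
    fix u v assume u: "stat (?\<tau> u) = In" and v: "v \<in> N u"
    show "stat (?\<tau> v) \<noteq> In"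
      using u v c1[of u v] c3[of u v] c3[of v u] join2[of u v] joinD[of u] joinD[of v] N_sym[OF v]
      unfolding In by auto
  next
    fix v assume "stat (?\<tau> v) = Out"
    then have "stat (\<sigma> v) = Out \<or> (\<exists>u\<in>N v. ?join u)"
      by (auto simp: mis_round_def split: if_splits)
    then show "\<exists>u\<in>N v. stat (?\<tau> u) = In" unfolding In using c2 by auto
  next
    fix v u assume v: "stat (?\<tau> v) = Und" "\<not> dor (?\<tau> v)" and u: "u \<in> N v"
    then have "stat (\<sigma> v) = Und" "\<not> dor (\<sigma> v)" "\<not> ?join u"
      by (auto simp: mis_round_def split: if_splits)
    then show "stat (?\<tau> u) \<noteq> In" unfolding In using c3 u by auto
  qed
qed

lemma stat_sync_In: "stat (sync N R \<sigma> u) = In \<longleftrightarrow> stat (\<sigma> u) = In"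
  by (simp add: sync_def)

lemma sync_Und: "stat (sync N R \<sigma> v) = Und \<Longrightarrow> u \<in> N v \<Longrightarrow> stat (sync N R \<sigma> u) \<noteq> In"
  unfolding stat_sync_In by (auto simp: sync_def split: if_splits)

lemma consistent_sync:
  assumes "consistent N \<sigma>"
  shows "consistent N (sync N R \<sigma>)"
proof -
  have "\<exists>u\<in>N v. stat (\<sigma> u) = In" if "stat (sync N R \<sigma> v) = Out" for v
    using that assms by (auto simp: sync_def consistent_def split: if_splits)
  moreover have "stat (\<sigma> v) \<noteq> In" if "stat (\<sigma> u) = In" "v \<in> N u" for u v
    using assms that unfolding consistent_def by blast
  ultimately show ?thesis
    using sync_Und unfolding consistent_def stat_sync_In by blast
qed

lemma consistent_base:
  "consistent N (base N R r k)"
  "stat (base N R r k v) = Und \<Longrightarrow> u \<in> N v \<Longrightarrow> stat (base N R r k u) \<noteq> In"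
proof -
  have st: "consistent N (state N R r k j)" if "consistent N (base N R r k)" for k j
    using that by (induction j) (auto simp: state_0 state_Suc intro: consistent_mis_round)
  have init: "consistent N (\<lambda>_. Node 1 False Und)" by (simp add: consistent_def)
  show C: "consistent N (base N R r k)" for k
    by (induction k) (simp_all only: base_Suc base.simps(1) consistent_sync init st)
  show "stat (base N R r k v) = Und \<Longrightarrow> u \<in> N v \<Longrightarrow> stat (base N R r k u) \<noteq> In"
    by (cases k) (simp_all only: base_Suc base.simps(1) sync_Und not_False_eq_True)
qed

lemma und_edges_sym: "sym (und_edges N \<sigma>)"
  using N_sym by (auto simp: sym_def und_edges_def)

lemma component_self: "v \<in> component N \<sigma> v"
  by (simp add: component_def)

lemma component_eq: "u \<in> component N \<sigma> v \<Longrightarrow> component N \<sigma> u = component N \<sigma> v"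
  using symD[OF sym_rtrancl[OF und_edges_sym], of v u \<sigma>] unfolding component_def
  by (auto intro: rtrancl_trans)

lemma component_edges_eq: "u \<in> component N \<sigma> v \<Longrightarrow> component_edges N \<sigma> u = component_edges N \<sigma> v"
  by (simp add: component_edges_def component_eq)

lemma component_subset: "v \<in> V \<Longrightarrow> component N \<sigma> v \<subseteq> V"
proof
  fix u assume v: "v \<in> V" and "u \<in> component N \<sigma> v"
  then have "(v, u) \<in> (und_edges N \<sigma>)\<^sup>*" by (simp add: component_def)
  then show "u \<in> V" by (induction rule: rtrancl_induct) (use v N_subset in \<open>auto simp: und_edges_def\<close>)
qed

lemma component_Und: "stat (\<sigma> v) = Und \<Longrightarrow> u \<in> component N \<sigma> v \<Longrightarrow> stat (\<sigma> u) = Und"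
  unfolding component_def by (auto elim: rtranclE simp: und_edges_def)

lemma component_edges_sym: "sym (component_edges N \<sigma> v)"
proof (rule symI)
  fix a b assume ab: "(a, b) \<in> component_edges N \<sigma> v"
  then have e: "(a, b) \<in> und_edges N \<sigma>" and "a \<in> component N \<sigma> v" by (auto simp: component_edges_def)
  then have "b \<in> component N \<sigma> v" by (auto simp: component_def)
  then show "(b, a) \<in> component_edges N \<sigma> v" using symD[OF und_edges_sym e] by (auto simp: component_edges_def)
qed

lemma conn_comp: "conn N (component N \<sigma> v)"
  unfolding conn_def
proof (intro ballI)
  fix x y assume x: "x \<in> component N \<sigma> v" and "y \<in> component N \<sigma> v"
  then have "(x, y) \<in> (und_edges N \<sigma>)\<^sup>*" using component_eq[OF x] by (auto simp: component_def)
  then show "(x, y) \<in> {(a, b). a \<in> component N \<sigma> v \<and> b \<in> component N \<sigma> v \<and> b \<in> N a}\<^sup>*"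
  proof (induction rule: rtrancl_induct)
    case (step y z)
    have "y \<in> component N \<sigma> v" using step(1) component_eq[OF x] by (auto simp: component_def)
    moreover from this have "z \<in> component N \<sigma> v" using step(2) by (auto simp: component_def)
    ultimately show ?case using step by (intro rtrancl_into_rtrancl[OF step.IH]) (auto simp: und_edges_def)
  qed simp
qed

text \<open>By \<open>und\<close> no edge joins an undecided node to one with status
  \<open>In\<close>, so the completion cannot clash with nodes already chosen. Adjacent undecided
  nodes consult the same \<open>mis_of\<close>.\<close>

lemma final_mis:
  assumes c: "consistent N \<sigma>" and und: "\<And>u v. stat (\<sigma> v) = Und \<Longrightarrow> u \<in> N v \<Longrightarrow> stat (\<sigma> u) \<noteq> In"
  shows "\<And>u v. u \<in> final_mis N V \<sigma> \<Longrightarrow> v \<in> final_mis N V \<sigma> \<Longrightarrow> v \<notin> N u"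
    "\<And>v. v \<in> V \<Longrightarrow> v \<notin> final_mis N V \<sigma> \<Longrightarrow> \<exists>u\<in>final_mis N V \<sigma>. u \<in> N v"
proof -
  have irr: "irrefl (component_edges N \<sigma> v)" for v
    using N_irrefl by (auto simp: irrefl_def component_edges_def und_edges_def)
  have fin: "finite (component N \<sigma> v)" if "v \<in> V" for v
    using finite_subset[OF component_subset[OF that] finite_V] .
  note M = mis_of[OF fin component_edges_sym irr]
  have In_In: "stat (\<sigma> v) \<noteq> In" if "stat (\<sigma> u) = In" "v \<in> N u" for u v
    using c that unfolding consistent_def by blast
  have Out: "\<exists>u\<in>N v. stat (\<sigma> u) = In" if "stat (\<sigma> v) = Out" for v
    using c that unfolding consistent_def by blast
  show "v \<notin> N u" if u: "u \<in> final_mis N V \<sigma>" and v: "v \<in> final_mis N V \<sigma>" for u v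
  proof
    assume uv: "v \<in> N u"
    have "stat (\<sigma> u) \<noteq> In"
    proof
      assume "stat (\<sigma> u) = In"
      then show False using v In_In[OF _ uv] und[of v u] N_sym[OF uv] by (auto simp: final_mis_def)
    qed
    moreover have "stat (\<sigma> v) \<noteq> In"
    proof
      assume "stat (\<sigma> v) = In"
      then show False using u In_In[OF _ N_sym[OF uv]] und[of u v] uv by (auto simp: final_mis_def)
    qed
    ultimately have U: "stat (\<sigma> u) = Und" "stat (\<sigma> v) = Und"
      and Mu: "u \<in> mis_of (component N \<sigma> u) (component_edges N \<sigma> u)"
      and Mv: "v \<in> mis_of (component N \<sigma> v) (component_edges N \<sigma> v)" and uV: "u \<in> V"
      using u v by (auto simp: final_mis_def)
    have e: "(u, v) \<in> und_edges N \<sigma>" using U uv by (simp add: und_edges_def)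
    then have vu: "v \<in> component N \<sigma> u" by (auto simp: component_def)
    have "(u, v) \<in> component_edges N \<sigma> u" using e component_self by (simp add: component_edges_def)
    then show False using M(2)[OF uV Mu] Mv unfolding component_eq[OF vu] component_edges_eq[OF vu] by auto
  qed
  show "\<exists>u\<in>final_mis N V \<sigma>. u \<in> N v" if v: "v \<in> V" "v \<notin> final_mis N V \<sigma>" for v
  proof (cases "stat (\<sigma> v)")
    case Out': Out
    then obtain u where "u \<in> N v" "stat (\<sigma> u) = In" using Out by auto
    then show ?thesis using N_subset by (auto simp: final_mis_def)
  next
    case Und
    then have "v \<notin> mis_of (component N \<sigma> v) (component_edges N \<sigma> v)" using v by (simp add: final_mis_def)
    then obtain y where y: "y \<in> mis_of (component N \<sigma> v) (component_edges N \<sigma> v)" "(v, y) \<in> component_edges N \<sigma> v"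
      using M(3)[OF v(1) component_self] by auto
    then have e: "y \<in> N v" "stat (\<sigma> y) = Und" "y \<in> component N \<sigma> v"
      by (auto simp: component_edges_def und_edges_def component_def)
    then have "y \<in> final_mis N V \<sigma>"
      using y N_subset component_eq[OF e(3)] component_edges_eq[OF e(3)] by (auto simp: final_mis_def)
    then show ?thesis using e by auto
  qed (use v in \<open>simp add: final_mis_def\<close>)
qed

end

section \<open>Local simulation\<close>

text \<open>
  As \<open>local_computation\<close> only returns truth values, a computation with another type of result is a
  function of its continuation.
\<close>

type_synonym 'a cps = "('a \<Rightarrow> local_computation) \<Rightarrow> local_computation"

definition ret :: "'a \<Rightarrow> 'a cps" where
  "ret x = (\<lambda>k. k x)"

definition bnd :: "'a cps \<Rightarrow> ('a \<Rightarrow> 'b cps) \<Rightarrow> 'b cps" where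
  "bnd m f = (\<lambda>k. m (\<lambda>x. f x k))"

primrec tab :: "('a \<Rightarrow> 'b cps) \<Rightarrow> 'a list \<Rightarrow> ('a \<Rightarrow> 'b) cps" where
  "tab f [] = ret (\<lambda>_. undefined)"
| "tab f (x # xs) = bnd (f x) (\<lambda>y. bnd (tab f xs) (\<lambda>g. ret (g(x := y))))"

primrec flips :: "nat \<Rightarrow> nat \<Rightarrow> nat \<Rightarrow> bool cps" where
  "flips t u 0 = ret True"
| "flips t u (Suc l) = bnd (ReadBit (pos t u l)) (\<lambda>b. bnd (flips t u l) (\<lambda>c. ret (b \<and> c)))"

definition cand_of :: "nat \<Rightarrow> nat \<Rightarrow> (nat \<Rightarrow> node cps) \<Rightarrow> nat \<Rightarrow> bool cps" where
  "cand_of R t bs u = bnd (bs u) (\<lambda>s. bnd (flips t u (lev s - R)) (\<lambda>c. ret (stat s = Und \<and> c)))"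

definition mark_of :: "nat \<Rightarrow> (nat \<Rightarrow> node cps) \<Rightarrow> nat \<Rightarrow> bool cps" where
  "mark_of t cur u = bnd (cur u) (\<lambda>s. bnd (flips t u (lev s)) (\<lambda>c. ret (stat s = Und \<and> \<not> dor s \<and> c)))"

text \<open>The saving happens here: candidates are recognized from states at the start of the
  phase, and at most 2^(6R) of them are simulated up to the current round. \<open>None\<close>
  reports that there are too many.\<close>

definition marked_nbrs ::
  "nat \<Rightarrow> nat \<Rightarrow> (nat \<Rightarrow> node cps) \<Rightarrow> (nat \<Rightarrow> node cps) \<Rightarrow> nat \<Rightarrow> nat set option cps" where
  "marked_nbrs R t bs cur v =
     bnd (Query v) (\<lambda>S.
     bnd (tab (cand_of R t bs) (sorted_list_of_set S)) (\<lambda>cd.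
     let C = {u \<in> S. cd u} in
     if 2 ^ (6 * R) < card C then ret None
     else bnd (tab (mark_of t cur) (sorted_list_of_set C)) (\<lambda>mk. ret (Some {u \<in> C. mk u}))))"

text \<open>Only a marked neighbor can have joined, so it suffices to inspect \<open>M\<close>. The
  result \<open>Some {}\<close> for such a neighbor says that it is not \<open>over\<close> and sees
  no mark, i.e. that it joins.\<close>

definition decide_of ::
  "nat \<Rightarrow> nat \<Rightarrow> (nat \<Rightarrow> node cps) \<Rightarrow> (nat \<Rightarrow> node cps) \<Rightarrow> nat \<Rightarrow> node \<Rightarrow> nat set \<Rightarrow> node cps" where
  "decide_of R t bs cur v s M =
     bnd (cand_of R t bs v) (\<lambda>cv.
     bnd (flips t v (lev s)) (\<lambda>hv.
     bnd (tab (marked_nbrs R t bs cur) (sorted_list_of_set M)) (\<lambda>nb.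
     ret (Node (if M \<noteq> {} then lev s + 1 else max 1 (lev s - 1)) False
       (if cv \<and> hv \<and> M = {} then In else if \<exists>u\<in>M. nb u = Some {} then Out else Und)))))"

definition awake_of ::
  "nat \<Rightarrow> nat \<Rightarrow> (nat \<Rightarrow> node cps) \<Rightarrow> (nat \<Rightarrow> node cps) \<Rightarrow> nat \<Rightarrow> node \<Rightarrow> node cps" where
  "awake_of R t bs cur v s = bnd (marked_nbrs R t bs cur v)
     (case_option (ret (Node (lev s + 1) True Und)) (decide_of R t bs cur v s))"

definition round_of ::
  "nat \<Rightarrow> nat \<Rightarrow> (nat \<Rightarrow> node cps) \<Rightarrow> (nat \<Rightarrow> node cps) \<Rightarrow> nat \<Rightarrow> node cps" where
  "round_of R t bs cur v = bnd (cur v) (\<lambda>s.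
     if stat s \<noteq> Und then ret s
     else if dor s then ret (Node (lev s + 1) True Und)
     else awake_of R t bs cur v s)"

text \<open>\<open>sync\<close> is run on the local view itself: at \<open>v\<close> it inspects
  only \<open>v\<close> and its neighbors, so a constant neighborhood function and arbitrary values
  elsewhere suffice.\<close>

definition sync_of :: "nat \<Rightarrow> (nat \<Rightarrow> node cps) \<Rightarrow> nat \<Rightarrow> node cps" where
  "sync_of R cur v =
     bnd (Query v) (\<lambda>S.
     bnd (tab cur (sorted_list_of_set S)) (\<lambda>f.
     bnd (cur v) (\<lambda>s. ret (sync (\<lambda>_. S) R (f(v := s)) v))))"

primrec rounds_of :: "nat \<Rightarrow> nat \<Rightarrow> (nat \<Rightarrow> node cps) \<Rightarrow> nat \<Rightarrow> nat \<Rightarrow> node cps" where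
  "rounds_of R t bs 0 = bs"
| "rounds_of R t bs (Suc j) = round_of R (t + j) bs (rounds_of R t bs j)"

primrec base_of :: "nat \<Rightarrow> nat \<Rightarrow> nat \<Rightarrow> node cps" where
  "base_of R 0 = sync_of R (\<lambda>_. ret (Node 1 False Und))"
| "base_of R (Suc k) = sync_of R (rounds_of R (k * R) (base_of R k) R)"

text \<open>Breadth-first search in which \<open>X\<close> holds the discovered nodes,
  \<open>F\<close> the queue of unexpanded ones and \<open>A\<close> the edges out of expanded ones.
  The fuel enforces the query bound for every random string, including those where shattering
  fails.\<close>

primrec explore ::
  "(nat \<Rightarrow> node cps) \<Rightarrow> nat \<Rightarrow> nat set \<Rightarrow> nat list \<Rightarrow> (nat \<times> nat) set \<Rightarrow> (nat set \<times> (nat \<times> nat) set) option cps" where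
  "explore bs 0 X F A = ret (if F = [] then Some (X, A) else None)"
| "explore bs (Suc m) X F A =
     (case F of [] \<Rightarrow> ret (Some (X, A))
      | x # F' \<Rightarrow>
        bnd (Query x) (\<lambda>S.
        bnd (tab bs (sorted_list_of_set S)) (\<lambda>f.
        let Y = {u \<in> S. stat (f u) = Und}
        in explore bs m (X \<union> Y) (F' @ sorted_list_of_set (Y - X)) (A \<union> {x} \<times> Y))))"

text \<open>The answer after \<open>None\<close> is arbitrary, because the fuel runs out only in
  components with more than \<open>fuel\<close> nodes, which belong to the failure event.\<close>

definition mis_lca :: "nat \<Rightarrow> nat \<Rightarrow> nat \<Rightarrow> lca" where
  "mis_lca R K fuel v = base_of R K v (\<lambda>s.
     case stat s of In \<Rightarrow> Answer True | Out \<Rightarrow> Answer False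
     | Und \<Rightarrow> explore (base_of R K) fuel {v} [v] {} (\<lambda>o'.
         case o' of None \<Rightarrow> Answer False | Some (C, A) \<Rightarrow> Answer (v \<in> mis_of C A)))"

text \<open>Quantifying over the continuation \<open>k\<close> makes the statement compositional:
  results are substituted and query counts add up along \<open>bnd\<close>.\<close>

definition computes ::
  "nat pair_pre_digraph \<Rightarrow> (nat \<Rightarrow> bool) \<Rightarrow> 'a cps \<Rightarrow> 'a \<Rightarrow> nat \<Rightarrow> bool" where
  "computes G r m x q \<longleftrightarrow> (\<forall>k. answer G r (m k) = answer G r (k x)
     \<and> num_queries G r (m k) \<le> q + num_queries G r (k x))"

lemma computes_ret: "computes G r (ret x) x q"
  by (simp add: computes_def ret_def)

lemma computes_bnd:
  "computes G r m x q \<Longrightarrow> computes G r (f x) y q' \<Longrightarrow> q + q' \<le> p \<Longrightarrow> computes G r (bnd m f) y p"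
  unfolding computes_def bnd_def by (smt (verit) add.assoc add_le_mono le_trans order_refl add.commute add_le_cancel_left)

lemma computes_mono: "computes G r m x q \<Longrightarrow> q \<le> p \<Longrightarrow> computes G r m x p"
  unfolding computes_def by (meson add_le_mono1 le_trans)

lemma computes_Query: "computes G r (Query v) (neighbors G v) 1"
  by (simp add: computes_def)

lemma computes_ReadBit: "computes G r (ReadBit i) (r i) 0"
  by (simp add: computes_def)

lemma computes_tab:
  assumes "\<And>u. u \<in> set xs \<Longrightarrow> computes G r (f u) (g u) q"
  shows "computes G r (tab f xs) (restrict g (set xs)) (length xs * q)"
  using assms
proof (induction xs)
  case Nil
  then show ?case by (simp add: computes_ret restrict_def)
next
  case (Cons x xs)
  have eq: "restrict g (set (x # xs)) = (restrict g (set xs))(x := g x)" by (auto simp: restrict_def)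
  have xs: "computes G r (tab f xs) (restrict g (set xs)) (length xs * q)"
    using Cons.prems by (intro Cons.IH) auto
  have x: "computes G r (f x) (g x) q" using Cons.prems by auto
  show ?case unfolding tab.simps eq
    by (rule computes_bnd[OF x, where q' = "length xs * q"], rule computes_bnd[OF xs, where q' = 0],
        rule computes_ret, simp_all)
qed

lemma computes_tab_set:
  assumes "finite S" "\<And>u. u \<in> S \<Longrightarrow> computes G r (f u) (g u) q" "card S * q \<le> p"
  shows "computes G r (tab f (sorted_list_of_set S)) (restrict g S) p"
  using computes_mono[OF computes_tab[of "sorted_list_of_set S" G r f g q]] assms by simp

lemma computes_flips: "computes G r (flips t u l) (coin r t u l) 0"
proof (induction l)
  case 0
  then show ?case by (simp add: coin_def computes_ret)
next
  case (Suc l)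
  have eq: "coin r t u (Suc l) = (r (pos t u l) \<and> coin r t u l)"
    by (auto simp: coin_def less_Suc_eq)
  show ?case unfolding flips.simps eq
    by (rule computes_bnd[OF computes_ReadBit computes_bnd[OF Suc computes_ret]]) simp_all
qed

locale lca_process = mis_process +
  fixes G :: "nat pair_pre_digraph" and r :: "nat \<Rightarrow> bool"
  assumes N_eq: "N = neighbors G"
begin

abbreviation "B \<equiv> (2::nat) ^ (6 * R)"

lemma computes_nbrs: "computes G r (Query v) (N v) 1"
  unfolding N_eq by (rule computes_Query)

end

locale round_simulation = lca_process +
  fixes t :: nat and bs cur :: "nat \<Rightarrow> node cps" and \<sigma>0 \<sigma> :: "nat \<Rightarrow> node" and b w :: nat
  assumes bs: "\<And>u. computes G r (bs u) (\<sigma>0 u) b"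
    and cur: "\<And>u. computes G r (cur u) (\<sigma> u) w"
begin

lemma computes_cand: "computes G r (cand_of R t bs u) (cand R (coin r t) \<sigma>0 u) b"
  unfolding cand_of_def cand_def
  by (rule computes_bnd[OF bs computes_bnd[OF computes_flips computes_ret]]) simp_all

lemma computes_mark:
  "computes G r (mark_of t cur u) (stat (\<sigma> u) = Und \<and> \<not> dor (\<sigma> u) \<and> coin r t u (lev (\<sigma> u))) w"
  unfolding mark_of_def
  by (rule computes_bnd[OF cur computes_bnd[OF computes_flips computes_ret]]) simp_all

lemma computes_marked_nbrs:
  "computes G r (marked_nbrs R t bs cur v)
     (if over N R (coin r t) \<sigma>0 v then None else Some {u \<in> N v. mark R (coin r t) \<sigma>0 \<sigma> u})
     (1 + \<Delta> * b + B * w)"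
proof -
  let ?C = "{u \<in> N v. cand R (coin r t) \<sigma>0 u}"
  let ?cd = "restrict (cand R (coin r t) \<sigma>0) (N v)"
  have C: "{u \<in> N v. ?cd u} = ?C" by auto
  have tab1: "computes G r (tab (cand_of R t bs) (sorted_list_of_set (N v))) ?cd (\<Delta> * b)"
    by (intro computes_tab_set[where q = b] finite_N computes_cand mult_le_mono1 card_N)
  have rest: "computes G r (if B < card ?C then ret None
       else bnd (tab (mark_of t cur) (sorted_list_of_set ?C)) (\<lambda>mk. ret (Some {u \<in> ?C. mk u})))
     (if over N R (coin r t) \<sigma>0 v then None else Some {u \<in> N v. mark R (coin r t) \<sigma>0 \<sigma> u}) (B * w)"
  proof (cases "B < card ?C")
    case True
    then show ?thesis by (simp add: over_def computes_ret)
  next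
    case False
    let ?mk = "restrict (\<lambda>u. stat (\<sigma> u) = Und \<and> \<not> dor (\<sigma> u) \<and> coin r t u (lev (\<sigma> u))) ?C"
    have "computes G r (tab (mark_of t cur) (sorted_list_of_set ?C)) ?mk (B * w)"
      using finite_N False by (intro computes_tab_set[where q = w] computes_mark mult_le_mono1) auto
    moreover have "{u \<in> ?C. ?mk u} = {u \<in> N v. mark R (coin r t) \<sigma>0 \<sigma> u}"
      by (auto simp: mark_def)
    ultimately have "computes G r (bnd (tab (mark_of t cur) (sorted_list_of_set ?C)) (\<lambda>mk. ret (Some {u \<in> ?C. mk u})))
      (Some {u \<in> N v. mark R (coin r t) \<sigma>0 \<sigma> u}) (B * w)"
      by (intro computes_bnd[where q' = 0 and q = "B * w" and x = ?mk]) (simp_all only: computes_ret add_0_right order_refl)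
    then show ?thesis using False by (simp only: over_def if_False)
  qed
  show ?thesis unfolding marked_nbrs_def Let_def
    by (rule computes_bnd[OF computes_nbrs, where q' = "\<Delta> * b + B * w"],
        rule computes_bnd[OF tab1, where q' = "B * w"], unfold C, rule rest, simp_all)
qed

lemma computes_decide:
  assumes "stat (\<sigma> v) = Und" "\<not> dor (\<sigma> v)" "\<not> over N R (coin r t) \<sigma>0 v"
  shows "computes G r (decide_of R t bs cur v (\<sigma> v) {u \<in> N v. mark R (coin r t) \<sigma>0 \<sigma> u})
    (mis_round N R (coin r t) \<sigma>0 \<sigma> v) (b + B * (1 + \<Delta> * b + B * w))"
proof -
  let ?h = "coin r t"
  let ?M = "{u \<in> N v. mark R ?h \<sigma>0 \<sigma> u}"
  let ?nb = "\<lambda>u. if over N R ?h \<sigma>0 u then None else Some {w \<in> N u. mark R ?h \<sigma>0 \<sigma> w}"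
  define Q where "Q = 1 + \<Delta> * b + B * w"
  have M_cand: "card ?M \<le> B"
  proof -
    have "card ?M \<le> card {u \<in> N v. cand R ?h \<sigma>0 u}"
      using finite_N by (intro card_mono) (auto simp: mark_def)
    then show ?thesis using assms by (simp add: over_def)
  qed
  have fin: "finite ?M" using finite_N by simp
  have tab: "computes G r (tab (marked_nbrs R t bs cur) (sorted_list_of_set ?M)) (restrict ?nb ?M) (B * Q)"
    by (rule computes_tab_set[OF fin _ mult_le_mono1[OF M_cand]]) (unfold Q_def, rule computes_marked_nbrs)
  have seen_iff: "seen N R ?h \<sigma>0 \<sigma> u \<longleftrightarrow> {w \<in> N u. mark R ?h \<sigma>0 \<sigma> w} \<noteq> {}" for u
    by (simp add: seen_def Bex_def)
  have nb: "restrict ?nb ?M u = Some {} \<longleftrightarrow> join N R ?h \<sigma>0 \<sigma> u" if "u \<in> ?M" for u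
    using that unfolding join_def seen_iff by simp
  have ex: "(\<exists>u\<in>?M. restrict ?nb ?M u = Some {}) \<longleftrightarrow> (\<exists>u\<in>N v. join N R ?h \<sigma>0 \<sigma> u)"
  proof
    assume "\<exists>u\<in>?M. restrict ?nb ?M u = Some {}"
    then obtain u where u: "u \<in> ?M" "restrict ?nb ?M u = Some {}" by (elim bexE)
    then have "u \<in> N v" "join N R ?h \<sigma>0 \<sigma> u" using nb[OF u(1)] by simp_all
    then show "\<exists>u\<in>N v. join N R ?h \<sigma>0 \<sigma> u" by (rule bexI[rotated])
  next
    assume "\<exists>u\<in>N v. join N R ?h \<sigma>0 \<sigma> u"
    then obtain u where u: "u \<in> N v" "join N R ?h \<sigma>0 \<sigma> u" by (elim bexE)
    then have M: "u \<in> ?M" by (simp add: join_def)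
    then have "restrict ?nb ?M u = Some {}" using nb[OF M] u by simp
    then show "\<exists>u\<in>?M. restrict ?nb ?M u = Some {}" using M by (rule bexI)
  qed
  have join_iff: "join N R ?h \<sigma>0 \<sigma> v \<longleftrightarrow> cand R ?h \<sigma>0 v \<and> coin r t v (lev (\<sigma> v)) \<and> ?M = {}"
    unfolding join_def seen_iff mark_def[of R ?h \<sigma>0 \<sigma> v] using assms by simp
  have res: "mis_round N R ?h \<sigma>0 \<sigma> v =
    Node (if ?M \<noteq> {} then lev (\<sigma> v) + 1 else max 1 (lev (\<sigma> v) - 1)) False
      (if cand R ?h \<sigma>0 v \<and> coin r t v (lev (\<sigma> v)) \<and> ?M = {} then In
       else if \<exists>u\<in>?M. restrict ?nb ?M u = Some {} then Out else Und)"
    unfolding ex mis_round_def nlev_def join_iff seen_iff by (simp only: assms simp_thms if_False if_True)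
  show ?thesis unfolding decide_of_def res Q_def[symmetric]
    by (rule computes_bnd[OF computes_cand, where q' = "B * Q"],
        rule computes_bnd[OF computes_flips, where q' = "B * Q"],
        rule computes_bnd[OF tab, where q' = 0], rule computes_ret, simp_all)
qed

lemma computes_awake:
  assumes "stat (\<sigma> v) = Und" "\<not> dor (\<sigma> v)"
  shows "computes G r (awake_of R t bs cur v (\<sigma> v)) (mis_round N R (coin r t) \<sigma>0 \<sigma> v)
    (1 + \<Delta> * b + B * w + (b + B * (1 + \<Delta> * b + B * w)))"
proof -
  have "computes G r (case_option (ret (Node (lev (\<sigma> v) + 1) True Und)) (decide_of R t bs cur v (\<sigma> v))
      (if over N R (coin r t) \<sigma>0 v then None else Some {u \<in> N v. mark R (coin r t) \<sigma>0 \<sigma> u}))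
    (mis_round N R (coin r t) \<sigma>0 \<sigma> v) (b + B * (1 + \<Delta> * b + B * w))"
  proof (cases "over N R (coin r t) \<sigma>0 v")
    case True
    then have "mis_round N R (coin r t) \<sigma>0 \<sigma> v = Node (lev (\<sigma> v) + 1) True Und"
      using assms by (simp add: mis_round_def)
    then show ?thesis using True computes_ret by simp
  next
    case False
    then show ?thesis using computes_decide[OF assms False] by (simp only: if_False option.case)
  qed
  then show ?thesis unfolding awake_of_def
    by (rule computes_bnd[OF computes_marked_nbrs]) (rule order_refl)
qed

lemma computes_round:
  "computes G r (round_of R t bs cur v) (mis_round N R (coin r t) \<sigma>0 \<sigma> v)
     (w + (1 + \<Delta> * b + B * w + (b + B * (1 + \<Delta> * b + B * w))))"
proof -
  define Q where "Q = 1 + \<Delta> * b + B * w + (b + B * (1 + \<Delta> * b + B * w))"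
  have "computes G r (if stat (\<sigma> v) \<noteq> Und then ret (\<sigma> v)
     else if dor (\<sigma> v) then ret (Node (lev (\<sigma> v) + 1) True Und)
     else awake_of R t bs cur v (\<sigma> v)) (mis_round N R (coin r t) \<sigma>0 \<sigma> v) Q"
  proof -
    consider "stat (\<sigma> v) \<noteq> Und" | "stat (\<sigma> v) = Und" "dor (\<sigma> v)" | "stat (\<sigma> v) = Und" "\<not> dor (\<sigma> v)"
      by auto
    then show ?thesis
    proof cases
      case 3
      then show ?thesis using computes_awake[of v] unfolding Q_def[symmetric] by simp
    qed (simp_all add: mis_round_def computes_ret)
  qed
  then show ?thesis unfolding round_of_def Q_def[symmetric]
    by (rule computes_bnd[OF cur]) (rule order_refl)
qed

end

context lca_process
begin

lemma computes_sync:
  assumes cur: "\<And>u. computes G r (cur u) (\<sigma> u) w"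
  shows "computes G r (sync_of R cur v) (sync N R \<sigma> v) (1 + (\<Delta> * w + w))"
proof -
  let ?f = "(restrict \<sigma> (N v))(v := \<sigma> v)"
  have tab: "computes G r (tab cur (sorted_list_of_set (N v))) (restrict \<sigma> (N v)) (\<Delta> * w)"
    by (intro computes_tab_set[where q = w] finite_N cur mult_le_mono1 card_N)
  have f: "?f u = \<sigma> u" if "u \<in> insert v (N v)" for u using that by auto
  have "{u \<in> N v. stat (?f u) = Und} = {u \<in> N v. stat (\<sigma> u) = Und}" using f by auto
  then have "deg (\<lambda>_. N v) ?f v = deg N \<sigma> v"
    unfolding deg_def using f by (intro sum.cong) auto
  moreover have "(\<exists>u\<in>N v. stat (?f u) = In) = (\<exists>u\<in>N v. stat (\<sigma> u) = In)" using f by auto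
  ultimately have eq: "sync N R \<sigma> v = sync (\<lambda>_. N v) R ?f v"
    unfolding sync_def by (simp only: f insertI1)
  show ?thesis unfolding sync_of_def eq
    by (rule computes_bnd[OF computes_nbrs, where q' = "\<Delta> * w + w"], rule computes_bnd[OF tab, where q' = w],
        rule computes_bnd[OF cur, where q' = 0], rule computes_ret, simp_all)
qed

text \<open>Cost factor of one phase: (B + 2)^2 for each of the \<open>R\<close> rounds, (B + 1)
  (\<Delta> + 2) for the lookups of states at the start of the phase, and \<Delta> + 2 for the final
  \<open>sync\<close>.\<close>

definition "M = (\<Delta> + 2)\<^sup>2 * (B + 2) ^ (2 * R + 1)"

text \<open>A round costs 1 + B + B^2 simulations of the previous round plus lookups at the start of
  the phase. Their cost is at most \<open>c\<close> and is absorbed by one further copy of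
  \<open>w\<close>, so \<Delta> enters once per phase and not once per round.\<close>

lemma computes_rounds:
  assumes bs: "\<And>u. computes G r (bs u) (base N R r k u) b" and b: "1 \<le> b"
  shows "computes G r (rounds_of R (k * R) bs j v) (state N R r k j v)
    ((B + 2) ^ (2 * j) * ((B + 1) * (\<Delta> + 2) * b))"
proof (induction j arbitrary: v)
  case 0
  have "1 * b \<le> ((B + 1) * (\<Delta> + 2)) * b" by (intro mult_le_mono1) simp
  then show ?case unfolding state_0 rounds_of.simps
    by (intro computes_mono[OF bs]) (simp only: mult_0_right power_0 mult_1)
next
  case (Suc j)
  define c where "c = (B + 1) * (\<Delta> + 2) * b"
  define w where "w = (B + 2) ^ (2 * j) * c"
  interpret S: round_simulation V N R K \<Delta> \<alpha> G r "k * R + j" bs "rounds_of R (k * R) bs j"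
      "base N R r k" "state N R r k j" b w
    by unfold_locales (use bs Suc.IH in \<open>auto simp: w_def c_def\<close>)
  have "1 * c \<le> w" unfolding w_def by (intro mult_le_mono1) simp
  moreover have "(1 + \<Delta> * b) * (1 + B) + b \<le> c"
  proof -
    have "(1 + \<Delta> * b) * (1 + B) + b \<le> (b + \<Delta> * b) * (1 + B) + b * (1 + B)"
      using b by (intro add_mono mult_le_mono1) simp_all
    also have "\<dots> = c" by (simp add: c_def algebra_simps)
    finally show ?thesis .
  qed
  moreover have "w + (1 + \<Delta> * b + B * w + (b + B * (1 + \<Delta> * b + B * w)))
    = (1 + B + B * B) * w + ((1 + \<Delta> * b) * (1 + B) + b)"
    by (simp only: algebra_simps)
  moreover have "(1 + B + B * B) * w + w \<le> (B + 2)\<^sup>2 * w"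
    by (simp only: power2_eq_square algebra_simps)
  ultimately have "w + (1 + \<Delta> * b + B * w + (b + B * (1 + \<Delta> * b + B * w))) \<le> (B + 2)\<^sup>2 * w"
    by linarith
  moreover have "(B + 2) ^ (2 * Suc j) * c = (B + 2)\<^sup>2 * w"
    by (simp only: w_def mult_Suc_right power_add mult.assoc)
  ultimately show ?case
    using computes_mono[OF S.computes_round[of v]] unfolding state_Suc c_def[symmetric] rounds_of.simps by simp
qed

lemma M_pos: "1 \<le> M"
proof -
  have "0 < M" unfolding M_def by (intro mult_pos_pos zero_less_power) simp_all
  then show ?thesis by (simp only: Suc_leI One_nat_def)
qed

lemma computes_base: "computes G r (base_of R k v) (base N R r k v) (M ^ k)"
proof (induction k arbitrary: v)
  case 0
  show ?case unfolding base_of.simps base.simps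
    by (rule computes_mono[OF computes_sync[where w = 0]]) (simp_all add: computes_ret)
next
  case (Suc k)
  define b where "b = M ^ k"
  define w where "w = (B + 2) ^ (2 * R) * ((B + 1) * (\<Delta> + 2) * b)"
  have b: "1 \<le> b" unfolding b_def using M_pos by simp
  then have "0 < w" unfolding w_def by (intro mult_pos_pos zero_less_power) simp_all
  then have w1: "1 \<le> w" by (simp only: Suc_leI One_nat_def)
  have "computes G r (rounds_of R (k * R) (base_of R k) R u) (state N R r k R u) w" for u
    unfolding w_def by (intro computes_rounds b) (simp add: b_def Suc)
  then have "computes G r (base_of R (Suc k) v) (base N R r (Suc k) v) (1 + (\<Delta> * w + w))"
    unfolding base_of.simps base_Suc by (rule computes_sync)
  moreover have "1 + (\<Delta> * w + w) \<le> M ^ Suc k"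
  proof -
    have "1 + (\<Delta> * w + w) \<le> (\<Delta> + 2) * w" using w1 by simp
    also have "\<dots> \<le> (\<Delta> + 2) * ((B + 2) ^ (2 * R) * ((B + 2) * (\<Delta> + 2) * b))"
      unfolding w_def by (intro mult_le_mono) simp_all
    also have "\<dots> = M ^ Suc k"
      by (simp only: M_def b_def power_Suc power2_eq_square power_add power_one_right mult_ac)
    finally show ?thesis .
  qed
  ultimately show ?case by (rule computes_mono)
qed

text \<open>Invariant: the nodes outside the queue are expanded, with all their edges recorded. An
  empty queue means that \<open>X\<close> is closed, hence the whole component. Every step expands
  one new node, so fuel and expanded nodes together decide success.\<close>

lemma explore_spec:
  assumes bs: "\<And>u. computes G r (bs u) (\<sigma> u) b" and v: "v \<in> V" "stat (\<sigma> v) = Und"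
    and X: "X \<subseteq> component N \<sigma> v" "v \<in> X" "set F \<subseteq> X" "distinct F"
    and A: "A = und_edges N \<sigma> \<inter> (X - set F) \<times> UNIV"
    and closed: "\<And>x y. x \<in> X - set F \<Longrightarrow> (x, y) \<in> und_edges N \<sigma> \<Longrightarrow> y \<in> X"
  shows "\<exists>res. computes G r (explore bs m X F A) res (m * (1 + \<Delta> * b))
    \<and> (res = None \<or> res = Some (component N \<sigma> v, component_edges N \<sigma> v))
    \<and> (card (component N \<sigma> v) \<le> m + card (X - set F) \<longrightarrow> res \<noteq> None)"
  using X A closed
proof (induction m arbitrary: X F A)
  have fin: "finite (component N \<sigma> v)" using finite_subset[OF component_subset[OF v(1)] finite_V] .
  have saturated: "X = component N \<sigma> v"
    if "X \<subseteq> component N \<sigma> v" "v \<in> X" and cl: "\<And>x y. x \<in> X \<Longrightarrow> (x, y) \<in> und_edges N \<sigma> \<Longrightarrow> y \<in> X" for X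
  proof
    show "component N \<sigma> v \<subseteq> X"
    proof
      fix u assume "u \<in> component N \<sigma> v"
      then have "(v, u) \<in> (und_edges N \<sigma>)\<^sup>*" by (simp add: component_def)
      then show "u \<in> X" by (induction rule: rtrancl_induct) (rule that(2), rule cl)
    qed
  qed (rule that)
  {
    case 0
    show ?case
    proof (cases "F = []")
      case True
      have "X = component N \<sigma> v"
      proof (rule saturated[OF 0(1,2)])
        show "y \<in> X" if "x \<in> X" "(x, y) \<in> und_edges N \<sigma>" for x y
          using 0(6)[of x y] that True by simp
      qed
      then have "Some (X, A) = Some (component N \<sigma> v, component_edges N \<sigma> v)"
        using True 0(5) by (simp add: component_edges_def)
      then show ?thesis using True
        by (intro exI[of _ "Some (X, A)"]) (simp add: computes_ret)
    next
      case False
      then obtain x where "x \<in> set F" by (cases F) auto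
      then have "X - set F \<subset> component N \<sigma> v" using 0(1,3) by auto
      then have "card (X - set F) < card (component N \<sigma> v)" using fin by (rule psubset_card_mono[rotated])
      then show ?thesis using False by (intro exI[of _ None]) (simp add: computes_ret)
    qed
  next
    case (Suc m)
    show ?case
    proof (cases F)
      case Nil
      have "X = component N \<sigma> v"
      proof (rule saturated[OF Suc.prems(1,2)])
        show "y \<in> X" if "x \<in> X" "(x, y) \<in> und_edges N \<sigma>" for x y
          using Suc.prems(6)[of x y] that Nil by simp
      qed
      then have "Some (X, A) = Some (component N \<sigma> v, component_edges N \<sigma> v)"
        using Nil Suc.prems(5) by (simp add: component_edges_def)
      then show ?thesis using Nil
        by (intro exI[of _ "Some (X, A)"]) (simp add: computes_ret)
    next
      case (Cons x F')
      define Y where "Y = {u \<in> N x. stat (\<sigma> u) = Und}"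
      define F'' where "F'' = F' @ sorted_list_of_set (Y - X)"
      have finY: "finite Y" using finite_N by (simp add: Y_def)
      have x: "x \<in> X" "x \<in> component N \<sigma> v" using Suc.prems(1,3) Cons by auto
      have sx: "stat (\<sigma> x) = Und" using component_Und[of \<sigma> v x] v x by auto
      have edge: "(x, y) \<in> und_edges N \<sigma> \<longleftrightarrow> y \<in> Y" for y using sx by (auto simp: Y_def und_edges_def)
      have diff: "X \<union> Y - set F'' = insert x (X - set F)"
        using Suc.prems(3,4) finY Cons x by (auto simp: F''_def)
      have "\<exists>res. computes G r (explore bs m (X \<union> Y) F'' (A \<union> {x} \<times> Y)) res (m * (1 + \<Delta> * b))
        \<and> (res = None \<or> res = Some (component N \<sigma> v, component_edges N \<sigma> v))
        \<and> (card (component N \<sigma> v) \<le> m + card (X \<union> Y - set F'') \<longrightarrow> res \<noteq> None)"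
      proof (rule Suc.IH)
        have "y \<in> component N \<sigma> v" if "y \<in> Y" for y
          using x(2) edge[of y] that unfolding component_def by (auto intro: rtrancl_into_rtrancl)
        then show "X \<union> Y \<subseteq> component N \<sigma> v" using Suc.prems(1) by auto
        show "v \<in> X \<union> Y" using Suc.prems(2) by simp
        show "set F'' \<subseteq> X \<union> Y" using Suc.prems(3) finY Cons by (auto simp: F''_def)
        show "distinct F''" using Suc.prems(3,4) finY Cons by (auto simp: F''_def)
        show "A \<union> {x} \<times> Y = und_edges N \<sigma> \<inter> (X \<union> Y - set F'') \<times> UNIV"
          unfolding diff Suc.prems(5) using edge by auto
        show "y \<in> X \<union> Y" if "z \<in> X \<union> Y - set F''" "(z, y) \<in> und_edges N \<sigma>" for z y
          using that edge[of y] Suc.prems(6)[of z y] unfolding diff by auto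
      qed
      then obtain res where res: "computes G r (explore bs m (X \<union> Y) F'' (A \<union> {x} \<times> Y)) res (m * (1 + \<Delta> * b))"
        "res = None \<or> res = Some (component N \<sigma> v, component_edges N \<sigma> v)"
        "card (component N \<sigma> v) \<le> m + card (X \<union> Y - set F'') \<longrightarrow> res \<noteq> None" by auto
      have tab: "computes G r (tab bs (sorted_list_of_set (N x))) (restrict \<sigma> (N x)) (\<Delta> * b)"
        by (intro computes_tab_set[where q = b] finite_N bs mult_le_mono1 card_N)
      have Y: "{u \<in> N x. stat (restrict \<sigma> (N x) u) = Und} = Y" by (auto simp: Y_def)
      have "computes G r (explore bs (Suc m) X F A) res (Suc m * (1 + \<Delta> * b))"
        unfolding explore.simps Cons list.case Let_def
        by (rule computes_bnd[OF computes_nbrs, where q' = "\<Delta> * b + m * (1 + \<Delta> * b)"],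
            rule computes_bnd[OF tab, where q' = "m * (1 + \<Delta> * b)"],
            unfold Y, fold F''_def, rule res(1), simp_all)
      moreover have "card (X \<union> Y - set F'') = Suc (card (X - set F))"
      proof -
        have "finite (X - set F)" using fin Suc.prems(1) finite_subset by blast
        then show ?thesis unfolding diff using Cons by simp
      qed
      ultimately show ?thesis using res by (intro exI[of _ res]) auto
    qed
  }
qed

text \<open>The query bound is unconditional. The answer is right outside the failure event, because
  the component of an undecided node is connected and undecided, so that its size is at most the
  fuel \<open>m\<close>.\<close>

lemma mis_lca_correct:
  assumes v: "v \<in> V"
  shows "num_queries G r (mis_lca R K m v) \<le> M ^ K + m * (1 + \<Delta> * M ^ K)"
    and "\<not> large_cluster m r \<Longrightarrow> answer G r (mis_lca R K m v) \<longleftrightarrow> v \<in> final_mis N V (base N R r K)"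
proof -
  let ?\<sigma> = "base N R r K"
  let ?k = "\<lambda>s. case stat s of In \<Rightarrow> Answer True | Out \<Rightarrow> Answer False
     | Und \<Rightarrow> explore (base_of R K) m {v} [v] {} (\<lambda>o'.
         case o' of None \<Rightarrow> Answer False | Some (C, A) \<Rightarrow> Answer (v \<in> mis_of C A))"
  have run: "answer G r (mis_lca R K m v) = answer G r (?k (?\<sigma> v))"
    "num_queries G r (mis_lca R K m v) \<le> M ^ K + num_queries G r (?k (?\<sigma> v))"
    using computes_base[of K v] unfolding computes_def mis_lca_def by auto
  have "num_queries G r (?k (?\<sigma> v)) \<le> m * (1 + \<Delta> * M ^ K) \<and>
    (\<not> large_cluster m r \<longrightarrow> answer G r (?k (?\<sigma> v)) \<longleftrightarrow> v \<in> final_mis N V ?\<sigma>)"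
  proof (cases "stat (?\<sigma> v)")
    case Und
    obtain res where res: "computes G r (explore (base_of R K) m {v} [v] {}) res (m * (1 + \<Delta> * M ^ K))"
      "res = None \<or> res = Some (component N ?\<sigma> v, component_edges N ?\<sigma> v)"
      "card (component N ?\<sigma> v) \<le> m \<longrightarrow> res \<noteq> None"
      using explore_spec[where \<sigma> = ?\<sigma> and bs = "base_of R K" and b = "M ^ K" and v = v and X = "{v}"
          and F = "[v]" and A = "{}" and m = m] computes_base[of K] v Und component_self[of v ?\<sigma>] by auto
    have small: "card (component N ?\<sigma> v) \<le> m" if "\<not> large_cluster m r"
      using that component_subset[OF v, of ?\<sigma>] conn_comp[of ?\<sigma> v] component_Und[of ?\<sigma> v, OF Und]
      unfolding large_cluster_def by (meson not_le)
    have k: "?k (?\<sigma> v) = explore (base_of R K) m {v} [v] {} (\<lambda>o'.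
         case o' of None \<Rightarrow> Answer False | Some (C, A) \<Rightarrow> Answer (v \<in> mis_of C A))"
      using Und by simp
    have "num_queries G r (?k (?\<sigma> v)) \<le> m * (1 + \<Delta> * M ^ K)
        + num_queries G r (case res of None \<Rightarrow> Answer False | Some (C, A) \<Rightarrow> Answer (v \<in> mis_of C A))"
      "answer G r (?k (?\<sigma> v)) = answer G r (case res of None \<Rightarrow> Answer False | Some (C, A) \<Rightarrow> Answer (v \<in> mis_of C A))"
      using res(1) unfolding k computes_def by blast+
    then show ?thesis using res(2,3) small v Und by (auto simp: final_mis_def)
  qed (use v in \<open>simp_all add: final_mis_def\<close>)
  then show "num_queries G r (mis_lca R K m v) \<le> M ^ K + m * (1 + \<Delta> * M ^ K)"
    "\<not> large_cluster m r \<Longrightarrow> answer G r (mis_lca R K m v) \<longleftrightarrow> v \<in> final_mis N V ?\<sigma>"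
    using run by linarith+
qed

lemma mis_lca_maximal:
  assumes V: "V = pverts G" and small: "\<not> large_cluster m r"
  shows "maximal_independent_set G (lca_output (mis_lca R K m) G r)"
proof -
  let ?I = "final_mis N V (base N R r K)"
  have out: "lca_output (mis_lca R K m) G r = ?I"
    using mis_lca_correct(2)[OF _ small] V by (auto simp: lca_output_def final_mis_def)
  have arc: "(u, v) \<in> parcs G \<longleftrightarrow> v \<in> N u" for u v by (simp add: N_eq neighbors_def)
  have I1: "v \<notin> N u" if "u \<in> ?I" "v \<in> ?I" for u v
    by (rule final_mis(1)[OF consistent_base(1) _ that]) (rule consistent_base(2))
  have I2: "\<exists>u\<in>?I. u \<in> N v" if "v \<in> V" "v \<notin> ?I" for v
    by (rule final_mis(2)[OF consistent_base(1) _ that]) (rule consistent_base(2))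
  have sub: "?I \<subseteq> pverts G" using V by (auto simp: final_mis_def)
  show ?thesis
    unfolding out maximal_independent_set_def independent_set_def
  proof (intro conjI ballI allI impI)
    fix u v assume "u \<in> ?I" "v \<in> ?I"
    then show "(u, v) \<notin> parcs G" unfolding arc by (rule I1)
  next
    fix J assume J: "(J \<subseteq> pverts G \<and> (\<forall>u\<in>J. \<forall>v\<in>J. (u, v) \<notin> parcs G)) \<and> ?I \<subseteq> J"
    show "J = ?I"
    proof (rule ccontr)
      assume "J \<noteq> ?I"
      then obtain v where v: "v \<in> J" "v \<notin> ?I" using J by auto
      then have "v \<in> V" using J V by auto
      then obtain u where "u \<in> ?I" "u \<in> N v" using I2 v by auto
      then show False using J v unfolding arc by auto
    qed
  qed (use sub in auto)
qed

end

section \<open>Choice of the parameters\<close>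

lemma measurable_answer: "{r. answer G r c} \<in> sets random_bits"
proof (induction c)
  case (Answer b)
  have "{r. answer G r (Answer b)} = (if b then space random_bits else {})"
    by (simp add: space_random_bits)
  then show ?case by simp
next
  case (Query v k)
  then show ?case by simp
next
  case (ReadBit i k)
  have "{r. answer G r (ReadBit i k)} =
      ({r. r i} \<inter> {r. answer G r (k True)}) \<union> ((space random_bits - {r. r i}) \<inter> {r. answer G r (k False)})"
  proof (rule set_eqI)
    fix r
    show "r \<in> {r. answer G r (ReadBit i k)} \<longleftrightarrow> r \<in> ({r. r i} \<inter> {r. answer G r (k True)})
      \<union> ((space random_bits - {r. r i}) \<inter> {r. answer G r (k False)})"
      by (cases "r i") (simp_all add: space_random_bits)
  qed
  then show ?case
    using ReadBit[OF rangeI, of True] ReadBit[OF rangeI, of False] measurable_bit[of i] by auto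
qed

lemma measurable_lca_output:
  assumes "finite (pverts G)"
  shows "{r \<in> space random_bits. Q (lca_output A G r)} \<in> sets random_bits"
proof -
  have ev: "{r \<in> space random_bits. lca_output A G r = S} \<in> sets random_bits" if "S \<subseteq> pverts G" for S
  proof -
    have "{r \<in> space random_bits. lca_output A G r = S} =
      {r \<in> space random_bits. \<forall>v\<in>pverts G. r \<in> (if v \<in> S then {r. answer G r (A v)} else space random_bits - {r. answer G r (A v)})}"
      using that by (auto simp: lca_output_def space_random_bits)
    also have "\<dots> \<in> sets random_bits"
      by (intro sets.sets_Collect_finite_All assms)
        (auto simp: space_random_bits measurable_answer sets.compl_sets[OF measurable_answer, unfolded space_random_bits])
    finally show ?thesis .
  qed
  have "{r \<in> space random_bits. Q (lca_output A G r)} =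
    (\<Union>S\<in>{S \<in> Pow (pverts G). Q S}. {r \<in> space random_bits. lca_output A G r = S})"
    by (auto simp: lca_output_def)
  also have "\<dots> \<in> sets random_bits" using assms ev by (intro sets.finite_UN) auto
  finally show ?thesis .
qed

lemma query_complexity_le:
  assumes "\<And>v r. v \<in> pverts G \<Longrightarrow> real (num_queries G r (A v)) \<le> x" "0 \<le> x"
  shows "ereal_of_enat (query_complexity A G) \<le> ereal x"
proof -
  have "num_queries G r (A v) \<le> nat \<lfloor>x\<rfloor>" if "v \<in> pverts G" for v r
    using assms(1)[OF that, of r] by (simp add: le_nat_floor)
  then have "query_complexity A G \<le> enat (nat \<lfloor>x\<rfloor>)"
    unfolding query_complexity_def by (intro SUP_least) simp
  then have "ereal_of_enat (query_complexity A G) \<le> ereal_of_enat (enat (nat \<lfloor>x\<rfloor>))"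
    by (simp only: ereal_of_enat_le_iff)
  also have "\<dots> \<le> ereal x" using assms(2) by simp
  finally show ?thesis .
qed

lemma nbr_graph_neighbors:
  assumes "pair_graph G"
  shows "nbr_graph (pverts G) (neighbors G)"
proof -
  interpret pair_graph G by (rule assms)
  show ?thesis
  proof
    show "finite (pverts G)" by (rule pair_finite_verts)
    show "neighbors G v \<subseteq> pverts G" for v using in_arcsD2 by (auto simp: neighbors_def)
    show "u \<in> neighbors G v \<Longrightarrow> v \<in> neighbors G u" for u v
      using pair_sym_arcs by (auto simp: neighbors_def symmetric_def sym_def)
    show "v \<notin> neighbors G v" for v using pair_no_loops[of "(v, v)"] by (auto simp: neighbors_def)
  qed
qed

lemma card_neighbors_le:
  assumes "pair_graph G" "max_degree_at_most G \<Delta>"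
  shows "card (neighbors G v) \<le> \<Delta>"
proof (cases "v \<in> pverts G")
  case False
  interpret pair_graph G by (rule assms)
  have "neighbors G v = {}" using False in_arcsD1 by (auto simp: neighbors_def)
  then show ?thesis by simp
qed (use assms in \<open>simp add: max_degree_at_most_def\<close>)

text \<open>
  For \<open>\<Delta> = 1\<close> the bound \<open>\<Delta> powr f \<Delta> * log 2 n\<close> is just \<open>log 2 n\<close>, which calls for a single query.
\<close>

definition matching_lca :: lca where
  "matching_lca v = Query v (\<lambda>S. Answer (\<forall>u\<in>S. v < u))"

text \<open>The edges form a matching, and from each of them the smaller identifier is taken;
  isolated nodes are always taken.\<close>

lemma matching_lca_maximal:
  assumes G: "pair_graph G" "max_degree_at_most G 1"
  shows "maximal_independent_set G (lca_output matching_lca G r)"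
proof -
  interpret nbr_graph "pverts G" "neighbors G" by (rule nbr_graph_neighbors[OF G(1)])
  let ?I = "lca_output matching_lca G r"
  have I: "v \<in> ?I \<longleftrightarrow> v \<in> pverts G \<and> (\<forall>u\<in>neighbors G v. v < u)" for v
    by (simp add: lca_output_def matching_lca_def)
  have arc: "(u, v) \<in> parcs G \<longleftrightarrow> v \<in> neighbors G u" for u v by (simp add: neighbors_def)
  show ?thesis unfolding maximal_independent_set_def independent_set_def
  proof (intro conjI ballI allI impI)
    show "?I \<subseteq> pverts G" by (auto simp: I)
    show "(u, v) \<notin> parcs G" if uv: "u \<in> ?I" "v \<in> ?I" for u v
    proof
      assume "(u, v) \<in> parcs G"
      then have "v \<in> neighbors G u" "u \<in> neighbors G v" using N_sym arc by auto
      then show False using uv unfolding I by force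
    qed
    fix J assume J: "(J \<subseteq> pverts G \<and> (\<forall>u\<in>J. \<forall>v\<in>J. (u, v) \<notin> parcs G)) \<and> ?I \<subseteq> J"
    show "J = ?I"
    proof (rule ccontr)
      assume "J \<noteq> ?I"
      then obtain v where v: "v \<in> J" "v \<notin> ?I" using J by auto
      then obtain u where u: "u \<in> neighbors G v" "\<not> v < u" using J by (auto simp: I)
      have vu: "v \<in> neighbors G u" using u N_sym by auto
      have "w = v" if "w \<in> neighbors G u" for w
        using card_neighbors_le[OF G, of u] finite_N[of u] that vu by (auto simp: card_le_Suc0_iff_eq)
      moreover have "u \<noteq> v" using u N_irrefl by auto
      ultimately have "u \<in> ?I" using u N_subset by (auto simp: I)
      then show False using J v u arc by blast
    qed
  qed
qed

context mis_process
begin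

lemma large_cluster_restrict:
  "large_cluster m r \<longleftrightarrow> large_cluster m (\<lambda>i. i \<in> atoms_before (K * R) \<and> r i)"
proof -
  let ?r = "\<lambda>i. i \<in> atoms_before (K * R) \<and> r i"
  have "coin r t u l = coin ?r t u l" if "t < K * R" "u \<in> V" "l \<le> Suc (K * R)" for t u l
    using that unfolding coin_def atoms_before_def atoms_at_def L_def by fastforce
  then have eq: "base N R r K v = base N R ?r K v" if "v \<in> V" for v
    using that by (intro base_cong) auto
  have "(\<forall>v\<in>C. stat (base N R r K v) = Und) = (\<forall>v\<in>C. stat (base N R ?r K v) = Und)" if "C \<subseteq> V" for C
    by (rule ball_cong[OF refl]) (simp only: eq[OF subsetD[OF that]])
  then show ?thesis unfolding large_cluster_def by (simp cong: conj_cong)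
qed

text \<open>Failure has probability at most n / 2^(i + 1), and 2^i is at least n^11. The success
  event contains the complement of the failure event and has to be measurable itself for
  monotonicity.\<close>

lemma measure_maximal:
  assumes G: "V = pverts G" "N = neighbors G"
    and eps: "32 * real \<Delta> * (1 - \<alpha>/4) ^ (K * R) \<le> 1 / (real \<Delta> + 1) ^ 11"
    and i: "real (card V) ^ 11 \<le> 2 ^ i" and n: "V \<noteq> {}"
  shows "1 - 1 / real (card V) ^ 10
    \<le> measure random_bits {r \<in> space random_bits.
        maximal_independent_set G (lca_output (mis_lca R K (i * (\<Delta> + 1) ^ 4)) G r)}"
proof -
  interpret P: prob_space random_bits by (rule prob_space_random_bits)
  let ?m = "i * (\<Delta> + 1) ^ 4"
  let ?n = "real (card V)"
  have n0: "0 < ?n" using n finite_V by (simp add: card_gt_0_iff)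
  have bad: "{r. large_cluster ?m r} \<in> sets random_bits"
    "measure random_bits {r. large_cluster ?m r} = avg (atoms_before (K * R)) (\<lambda>c. of_bool (large_cluster ?m (\<lambda>i. i \<in> c)))"
    using measure_random_bits[where Q = "large_cluster ?m", OF finite_atoms(2) large_cluster_restrict] by auto
  have "measure random_bits {r. large_cluster ?m r} \<le> ?n / 2 ^ Suc i"
    unfolding bad(2) by (rule large_cluster_prob[OF eps])
  also have "\<dots> \<le> ?n / ?n ^ 11"
  proof (rule divide_left_mono)
    show "?n ^ 11 \<le> 2 ^ Suc i" using i by (rule order_trans) simp
  qed (use n0 in auto)
  also have "\<dots> = 1 / ?n ^ 10" using n0 by (simp add: field_simps flip: power_Suc)
  finally have "1 - 1 / ?n ^ 10 \<le> measure random_bits (space random_bits - {r. large_cluster ?m r})"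
    using bad(1) by (simp add: P.prob_compl)
  also have "\<dots> \<le> measure random_bits {r \<in> space random_bits.
        maximal_independent_set G (lca_output (mis_lca R K ?m) G r)}"
  proof (rule P.finite_measure_mono)
    show "space random_bits - {r. large_cluster ?m r} \<subseteq> {r \<in> space random_bits.
        maximal_independent_set G (lca_output (mis_lca R K ?m) G r)}"
    proof
      fix r assume r: "r \<in> space random_bits - {r. large_cluster ?m r}"
      interpret L: lca_process V N R K \<Delta> \<alpha> G r by unfold_locales (rule G(2))
      show "r \<in> {r \<in> space random_bits. maximal_independent_set G (lca_output (mis_lca R K ?m) G r)}"
        using r L.mis_lca_maximal[OF G(1)] by simp
    qed
    show "{r \<in> space random_bits. maximal_independent_set G (lca_output (mis_lca R K ?m) G r)} \<in> sets random_bits"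
      using finite_V G(1) by (intro measurable_lca_output) simp
  qed
  finally show ?thesis .
qed

end

text \<open>The number of rounds is at least \<open>C\<close> times log \<Delta>, and 112 / 4 = 28
  makes the decay at most \<Delta>^(-28). For \<Delta> at least 2, 32 \<Delta> uses up six of these
  powers, and the other 22 cover (\<Delta> + 1)^11, since \<Delta> + 1 is at most
  \<Delta>^2.\<close>

lemma survival_small:
  fixes \<Delta> s R C :: nat and \<alpha> :: real
  assumes \<Delta>: "2 \<le> \<Delta>" and \<alpha>: "0 < \<alpha>" "\<alpha> \<le> 1" and C: "112 \<le> \<alpha> * real C"
    and s: "log 2 (real \<Delta>) \<le> real s ^ 2" and R: "s \<le> R"
  shows "32 * real \<Delta> * (1 - \<alpha>/4) ^ (C * s * R) \<le> 1 / (real \<Delta> + 1) ^ 11"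
proof -
  let ?D = "real \<Delta>"
  have D: "2 \<le> ?D" using \<Delta> by simp
  have "(1 - \<alpha>/4) ^ (C * s * R) \<le> exp (- \<alpha>/4) ^ (C * s * R)"
    using \<alpha> exp_ge_add_one_self[of "- \<alpha>/4"] by (intro power_mono) auto
  also have "\<dots> = exp (- (\<alpha>/4 * real (C * s * R)))" by (simp flip: exp_of_nat_mult add: mult_ac)
  also have "\<dots> \<le> exp (- (28 * ln ?D))"
  proof -
    have ln: "0 \<le> ln ?D" using D by simp
    have "ln 2 \<le> (1::real)" using ln_2_less_1 by simp
    then have "ln ?D \<le> log 2 ?D" using ln D unfolding log_def by (simp add: field_simps mult_left_le)
    also have "\<dots> \<le> real (s * R)"
      using s mult_mono[of "real s" "real s" "real s" "real R"] R by (simp add: power2_eq_square)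
    finally have "112 * ln ?D \<le> (\<alpha> * real C) * real (s * R)"
      using C ln by (intro mult_mono) auto
    then show ?thesis by (simp add: mult_ac)
  qed
  also have "\<dots> = 1 / ?D ^ 28"
  proof -
    have "exp (28 * ln ?D) = ?D ^ 28" using exp_of_nat_mult[of 28 "ln ?D"] D by simp
    then show ?thesis by (simp add: exp_minus inverse_eq_divide)
  qed
  finally have "32 * ?D * (1 - \<alpha>/4) ^ (C * s * R) \<le> 32 * ?D * (1 / ?D ^ 28)"
    using D by (intro mult_left_mono) auto
  also have "\<dots> \<le> ?D ^ 6 * (1 / ?D ^ 28)"
  proof (rule mult_right_mono)
    have "32 * ?D \<le> ?D ^ 5 * ?D" using power_mono[OF D, of 5] by (intro mult_right_mono) auto
    then show "32 * ?D \<le> ?D ^ 6" by (simp flip: power_Suc2)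
  qed simp
  also have "\<dots> = 1 / (?D\<^sup>2) ^ 11" using D by (simp add: field_simps flip: power_mult power_add)
  also have "\<dots> \<le> 1 / (?D + 1) ^ 11"
  proof -
    have "2 * ?D \<le> ?D * ?D" using D by (intro mult_right_mono) auto
    then have "?D + 1 \<le> ?D\<^sup>2" using D unfolding power2_eq_square by linarith
    then show ?thesis using D by (intro divide_left_mono power_mono) auto
  qed
  finally show ?thesis .
qed

text \<open>Everything is measured in powers of two: \<Delta> is at most 2^(s^2) and
  \<open>R\<close> at most (R0 + 1) s, so \<open>M\<close> is 2^O(s^2) and its power over the phases
  2^O(s^3). In \<open>E\<close>, 10 comes from (\<Delta> + 2)^5, 4 from bounding \<open>i\<close> by
  16 log n, and the rest from \<open>M\<close>.\<close>

lemma query_bound: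
  fixes \<Delta> s R0 C n i :: nat
  assumes \<Delta>: "2 \<le> \<Delta>" and n: "2 \<le> n" and s: "s = nat \<lceil>sqrt (log 2 (real \<Delta>))\<rceil>"
    and i: "i = nat \<lceil>11 * log 2 (real n)\<rceil>" and R: "R = R0 + s"
    and M: "M = (\<Delta> + 2)\<^sup>2 * (2 ^ (6 * R) + 2) ^ (2 * R + 1)"
    and E: "E = 14 + (4 + 21 * (R0 + 1)\<^sup>2) * C"
  shows "real (M ^ (C * s) + i * (\<Delta> + 1) ^ 4 * (1 + \<Delta> * M ^ (C * s)))
    \<le> real \<Delta> powr (8 * real E * sqrt (log 2 (real \<Delta>))) * log 2 (real n)"
proof -
  define l where "l = log 2 (real \<Delta>)"
  have l1: "1 \<le> l" using \<Delta> by (simp add: l_def le_log_iff)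
  have sl: "sqrt l \<le> real s" "real s \<le> sqrt l + 1"
  proof -
    have "0 \<le> sqrt l" using l1 by simp
    then have "real s = of_int \<lceil>sqrt l\<rceil>" unfolding s l_def[symmetric] by simp
    then show "sqrt l \<le> real s" "real s \<le> sqrt l + 1" by linarith+
  qed
  have sq1: "1 \<le> sqrt l" using l1 by simp
  have s1: "1 \<le> s" using sl sq1 by linarith
  have ss: "1 \<le> s\<^sup>2" using s1 by simp
  have \<Delta>s: "\<Delta> \<le> 2 ^ s\<^sup>2"
  proof -
    have "l \<le> (real s)\<^sup>2" using sl l1 by (metis power_mono real_sqrt_ge_zero real_sqrt_pow2 le_trans zero_le_one order_trans)
    then have "2 powr l \<le> 2 powr real (s\<^sup>2)" by simp
    moreover have "2 powr real (s\<^sup>2) = (2::real) ^ s\<^sup>2" by (rule powr_realpow) simp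
    moreover have "2 powr l = real \<Delta>" using \<Delta> by (simp add: l_def)
    ultimately have "real \<Delta> \<le> real (2 ^ s\<^sup>2)" by (simp only: of_nat_power of_nat_numeral)
    then show ?thesis by (simp only: of_nat_le_iff)
  qed
  have \<Delta>2: "\<Delta> + 2 \<le> 2 ^ (2 * s\<^sup>2)"
  proof -
    have "\<Delta> + 2 \<le> 2 ^ (s\<^sup>2 + 1)" using \<Delta>s \<Delta> by simp
    also have "\<dots> \<le> 2 ^ (2 * s\<^sup>2)" using ss by (intro power_increasing) auto
    finally show ?thesis .
  qed
  have R1: "1 \<le> R" using R s1 by simp
  have B: "2 ^ (6 * R) + 2 \<le> (2::nat) ^ (7 * R)"
  proof -
    have "(2::nat) ^ 1 \<le> 2 ^ (6 * R)" using R1 by (intro power_increasing) auto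
    then have "2 ^ (6 * R) + 2 \<le> (2::nat) ^ (6 * R + 1)" by simp
    also have "\<dots> \<le> 2 ^ (7 * R)" using R1 by (intro power_increasing) auto
    finally show ?thesis .
  qed
  have Rs: "R\<^sup>2 \<le> (R0 + 1)\<^sup>2 * s\<^sup>2"
  proof -
    have "R \<le> (R0 + 1) * s" using R s1 by (simp add: add_mono)
    then have "R\<^sup>2 \<le> ((R0 + 1) * s)\<^sup>2" by (intro power_mono) auto
    then show ?thesis by (simp only: power_mult_distrib)
  qed
  define D where "D = 4 + 21 * (R0 + 1)\<^sup>2"
  have MD: "M \<le> 2 ^ (D * s\<^sup>2)"
  proof -
    have "M \<le> (2 ^ (2 * s\<^sup>2))\<^sup>2 * (2 ^ (7 * R)) ^ (2 * R + 1)"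
      unfolding M using \<Delta>2 B by (intro mult_le_mono power_mono) auto
    also have "\<dots> = 2 ^ (2 * s\<^sup>2 * 2 + 7 * R * (2 * R + 1))" by (simp only: power_mult power_add)
    also have "\<dots> \<le> 2 ^ (D * s\<^sup>2)"
    proof (rule power_increasing)
      have "7 * R * (2 * R + 1) \<le> 21 * R\<^sup>2" using R1 by (simp add: power2_eq_square algebra_simps)
      then show "2 * s\<^sup>2 * 2 + 7 * R * (2 * R + 1) \<le> D * s\<^sup>2"
        using Rs unfolding D_def by (simp add: algebra_simps)
    qed simp
    finally show ?thesis .
  qed
  define Q where "Q = M ^ (C * s)"
  have s3: "s\<^sup>2 \<le> s ^ 3" using s1 by (intro power_increasing) auto
  have Q: "Q \<le> 2 ^ (D * C * s ^ 3)"
  proof -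
    have "Q \<le> (2 ^ (D * s\<^sup>2)) ^ (C * s)" unfolding Q_def using MD by (intro power_mono) auto
    also have "\<dots> = 2 ^ (D * C * s ^ 3)"
      by (simp add: power2_eq_square power3_eq_cube mult_ac flip: power_mult)
    finally show ?thesis .
  qed
  have "0 < M" unfolding M by (intro mult_pos_pos zero_less_power) simp_all
  then have Q1: "1 \<le> Q" unfolding Q_def by simp
  have log_n: "1 \<le> log 2 (real n)" using n by (simp add: le_log_iff)
  have i1: "1 \<le> i" and i12: "real i \<le> 16 * log 2 (real n)"
    using log_n unfolding i by linarith+
  have "Q + i * (\<Delta> + 1) ^ 4 * (1 + \<Delta> * Q) \<le> i * (2 ^ (10 * s ^ 3) * 2 ^ (D * C * s ^ 3))"
  proof -
    have "1 + \<Delta> * Q \<le> (\<Delta> + 1) * Q" using Q1 by simp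
    then have "i * (\<Delta> + 1) ^ 4 * (1 + \<Delta> * Q) \<le> i * (\<Delta> + 1) ^ 4 * ((\<Delta> + 1) * Q)"
      by (intro mult_le_mono) auto
    moreover have "Q \<le> i * Q" using i1 by simp
    ultimately have "Q + i * (\<Delta> + 1) ^ 4 * (1 + \<Delta> * Q) \<le> i * Q + i * (\<Delta> + 1) ^ 4 * ((\<Delta> + 1) * Q)"
      by (rule add_mono[rotated])
    also have "\<dots> = i * ((1 + (\<Delta> + 1) ^ 5) * Q)"
      by (simp add: algebra_simps eval_nat_numeral)
    also have "\<dots> \<le> i * ((\<Delta> + 2) ^ 5 * 2 ^ (D * C * s ^ 3))"
    proof (intro mult_le_mono Q order_refl)
      have p5: "x ^ 5 = x ^ 4 * x" for x :: nat by (simp add: eval_nat_numeral)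
      have "1 + (\<Delta> + 1) ^ 4 * (\<Delta> + 1) \<le> (\<Delta> + 1) ^ 4 + (\<Delta> + 1) ^ 4 * (\<Delta> + 1)"
        by (intro add_mono order_refl) simp
      also have "\<dots> = (\<Delta> + 1) ^ 4 * (\<Delta> + 2)" by (simp only: distrib_left)
      also have "\<dots> \<le> (\<Delta> + 2) ^ 4 * (\<Delta> + 2)" by (intro mult_le_mono power_mono) auto
      finally show "1 + (\<Delta> + 1) ^ 5 \<le> (\<Delta> + 2) ^ 5" unfolding p5 .
    qed
    also have "\<dots> \<le> i * ((2 ^ (2 * s\<^sup>2)) ^ 5 * 2 ^ (D * C * s ^ 3))"
      using \<Delta>2 by (intro mult_le_mono power_mono) auto
    also have "i * ((2 ^ (2 * s\<^sup>2)) ^ 5 * 2 ^ (D * C * s ^ 3)) \<le> i * (2 ^ (10 * s ^ 3) * 2 ^ (D * C * s ^ 3))"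
    proof -
      have "((2::nat) ^ (2 * s\<^sup>2)) ^ 5 = 2 ^ (10 * s\<^sup>2)" by (simp flip: power_mult)
      also have "\<dots> \<le> 2 ^ (10 * s ^ 3)" using s3 by (intro power_increasing) auto
      finally show ?thesis by (intro mult_le_mono) auto
    qed
    finally show ?thesis .
  qed
  then have "real (Q + i * (\<Delta> + 1) ^ 4 * (1 + \<Delta> * Q)) \<le> real (i * (2 ^ (10 * s ^ 3) * 2 ^ (D * C * s ^ 3)))"
    by (simp only: of_nat_le_iff)
  also have "\<dots> = real i * (2 ^ (10 * s ^ 3) * 2 ^ (D * C * s ^ 3))" by simp
  also have "\<dots> \<le> (16 * log 2 (real n)) * (2 ^ (10 * s ^ 3) * 2 ^ (D * C * s ^ 3))"
    using i12 by (intro mult_right_mono) auto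
  also have "\<dots> = (2 ^ 4 * 2 ^ (10 * s ^ 3) * 2 ^ (D * C * s ^ 3)) * log 2 (real n)" by simp
  also have "\<dots> = 2 ^ (4 + 10 * s ^ 3 + D * C * s ^ 3) * log 2 (real n)" by (simp only: power_add)
  also have "\<dots> \<le> 2 ^ (E * s ^ 3) * log 2 (real n)"
  proof -
    have "4 * 1 \<le> 4 * s ^ 3" using s1 by (intro mult_le_mono2) simp
    then have "4 + 10 * s ^ 3 + D * C * s ^ 3 \<le> E * s ^ 3" unfolding E D_def by (simp add: algebra_simps)
    then show ?thesis using log_n by (intro mult_right_mono power_increasing) auto
  qed
  also have "\<dots> \<le> real \<Delta> powr (8 * real E * sqrt l) * log 2 (real n)"
  proof (rule mult_right_mono)
    \<comment> \<open>Since \<open>l\<close> is at least 1, rounding up at most doubles the root.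
      Its cube produces the factor 8, and l sqrt l over base 2 becomes the exponent sqrt l over base
      \<Delta>.\<close>
    have "real s \<le> 2 * sqrt l" using sl sq1 by linarith
    then have "real s ^ 3 \<le> (2 * sqrt l) ^ 3" by (intro power_mono) auto
    also have "\<dots> = 8 * (l * sqrt l)" using l1 by (simp add: power3_eq_cube)
    finally have "real (E * s ^ 3) \<le> l * (8 * real E * sqrt l)"
      using mult_left_mono[of "real s ^ 3" "8 * (l * sqrt l)" "real E"] by (simp add: mult_ac)
    then have "2 powr real (E * s ^ 3) \<le> 2 powr (l * (8 * real E * sqrt l))" by simp
    also have "\<dots> = real \<Delta> powr (8 * real E * sqrt l)"
      unfolding powr_powr[symmetric] using \<Delta> by (simp add: l_def)
    finally show "2 ^ (E * s ^ 3) \<le> real \<Delta> powr (8 * real E * sqrt l)"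
      by (simp only: powr_realpow zero_less_numeral)
  qed (use log_n in simp)
  finally show ?thesis unfolding Q_def l_def .
qed

theorem theorem3p9:
  shows "\<exists>(A :: nat \<Rightarrow> nat \<Rightarrow> lca) (f :: nat \<Rightarrow> real).
    f \<in> O(\<lambda>\<Delta>. sqrt (log 2 (real \<Delta>))) \<and>
    (\<forall>(n::nat) (\<Delta>::nat) (G :: nat pair_pre_digraph).
       n \<ge> 1 \<longrightarrow> \<Delta> \<ge> 1 \<longrightarrow> pair_graph G \<longrightarrow> card (pverts G) = n \<longrightarrow> max_degree_at_most G \<Delta> \<longrightarrow>
         measure random_bits
             {r \<in> space random_bits. maximal_independent_set G (lca_output (A n \<Delta>) G r)}
           \<ge> 1 - 1 / real n ^ 10 \<and>
         ereal_of_enat (query_complexity (A n \<Delta>) G)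
           \<le> ereal (real \<Delta> powr f \<Delta> * log 2 (real n)))"
proof -
  define \<alpha> :: real where "\<alpha> = exp (-18) / 12288"
  have \<alpha>01: "0 < \<alpha>" "\<alpha> \<le> 1"
    using exp_le_one_iff[of "-18::real"] unfolding \<alpha>_def by (simp, linarith)
  \<comment> \<open>\<open>R0\<close> depends on \<alpha> alone and makes phases long enough even
    for small \<Delta>, so that the expected \<open>jump\<close> stays below \<alpha>.\<close>
  obtain R0 where R0_less: "(1/2) ^ R0 < \<alpha> / 16" using real_arch_pow_inv[of "\<alpha>/16" "1/2"] \<alpha>01 by auto
  have R0: "16 * (1/2) ^ (R0 + s) \<le> \<alpha>" for s
  proof -
    have "(1/2::real) ^ (R0 + s) \<le> (1/2) ^ R0" by (intro power_decreasing) auto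
    then show ?thesis using R0_less by linarith
  qed
  obtain C :: nat where "112 / \<alpha> \<le> real C" using real_arch_simple by auto
  then have C: "112 \<le> \<alpha> * real C" using \<alpha>01 by (simp add: field_simps)
  define s where "s \<Delta> = nat \<lceil>sqrt (log 2 (real \<Delta>))\<rceil>" for \<Delta> :: nat
  define i where "i n = nat \<lceil>11 * log 2 (real n)\<rceil>" for n :: nat
  define E where "E = 14 + (4 + 21 * (R0 + 1)\<^sup>2) * C"
  \<comment> \<open>For n = 1 the logarithm vanishes and allows no query at all; a lone node is
    simply accepted.\<close>
  define A :: "nat \<Rightarrow> nat \<Rightarrow> lca" where
    "A n \<Delta> = (if n = 1 then (\<lambda>_. Answer True) else if \<Delta> = 1 then matching_lca
      else mis_lca (R0 + s \<Delta>) (C * s \<Delta>) (i n * (\<Delta> + 1) ^ 4))" for n \<Delta>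
  define f where "f \<Delta> = 8 * real E * sqrt (log 2 (real \<Delta>))" for \<Delta> :: nat
  interpret P: prob_space random_bits by (rule prob_space_random_bits)
  have "f \<in> O(\<lambda>\<Delta>. sqrt (log 2 (real \<Delta>)))" unfolding f_def by simp
  moreover have "1 - 1 / real n ^ 10 \<le> measure random_bits
       {r \<in> space random_bits. maximal_independent_set G (lca_output (A n \<Delta>) G r)} \<and>
     ereal_of_enat (query_complexity (A n \<Delta>) G) \<le> ereal (real \<Delta> powr f \<Delta> * log 2 (real n))"
    if n: "1 \<le> n" and \<Delta>: "1 \<le> \<Delta>" and G: "pair_graph G" and card: "card (pverts G) = n"
      and deg: "max_degree_at_most G \<Delta>" for n \<Delta> G
  proof -
    consider "n = 1" | "2 \<le> n" "\<Delta> = 1" | "2 \<le> n" "2 \<le> \<Delta>" using n \<Delta> by linarith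
    then show ?thesis
    proof cases
      case 1
      have "ereal_of_enat (query_complexity (A n \<Delta>) G) \<le> ereal 0"
        by (rule query_complexity_le) (simp_all add: A_def 1)
      then show ?thesis using 1 by simp
    next
      case 2
      have eq: "A n \<Delta> = matching_lca" using 2 by (simp add: A_def)
      have "1 \<le> log 2 (real n)" using 2 by (simp add: le_log_iff)
      then have "ereal_of_enat (query_complexity (A n \<Delta>) G) \<le> ereal (real \<Delta> powr f \<Delta> * log 2 (real n))"
        unfolding eq using 2(2) by (intro query_complexity_le) (simp_all add: matching_lca_def)
      moreover have "{r \<in> space random_bits. maximal_independent_set G (lca_output matching_lca G r)} = space random_bits"
        using matching_lca_maximal[OF G] deg 2 by auto
      ultimately show ?thesis unfolding eq by (simp add: P.prob_space)
    next
      case 3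
      let ?R = "R0 + s \<Delta>" and ?K = "C * s \<Delta>" and ?m = "i n * (\<Delta> + 1) ^ 4"
      have eq: "A n \<Delta> = mis_lca ?R ?K ?m" using 3 by (simp add: A_def)
      interpret G: nbr_graph "pverts G" "neighbors G" by (rule nbr_graph_neighbors[OF G])
      interpret mis_process "pverts G" "neighbors G" ?R ?K \<Delta> \<alpha>
        by unfold_locales (use card_neighbors_le[OF G deg] \<Delta> \<alpha>_def R0 in auto)
      have s: "log 2 (real \<Delta>) \<le> real (s \<Delta>) ^ 2"
      proof -
        have l0: "0 \<le> log 2 (real \<Delta>)" using 3 by simp
        have "sqrt (log 2 (real \<Delta>)) \<le> real (s \<Delta>)" unfolding s_def by (rule real_nat_ceiling_ge)
        then have "(sqrt (log 2 (real \<Delta>)))\<^sup>2 \<le> (real (s \<Delta>))\<^sup>2" using l0 by (intro power_mono) auto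
        then show ?thesis using l0 by simp
      qed
      have eps: "32 * real \<Delta> * (1 - \<alpha>/4) ^ (?K * ?R) \<le> 1 / (real \<Delta> + 1) ^ 11"
        using survival_small[OF 3(2) \<alpha>01 C s, of ?R] by simp
      have pow: "real (card (pverts G)) ^ 11 \<le> 2 ^ i n"
      proof -
        have "real n ^ 11 = real n powr 11" using 3 by (simp add: powr_numeral)
        also have "\<dots> = 2 powr (log 2 (real n) * 11)"
          unfolding powr_powr[symmetric] using 3 by simp
        also have "\<dots> \<le> 2 powr real (i n)"
          unfolding i_def using real_nat_ceiling_ge[of "11 * log 2 (real n)"]
          by (intro powr_mono) (simp_all add: mult.commute)
        finally show ?thesis by (simp add: card powr_realpow)
      qed
      have "pverts G \<noteq> {}" using card n by auto
      then have "1 - 1 / real n ^ 10 \<le> measure random_bits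
         {r \<in> space random_bits. maximal_independent_set G (lca_output (A n \<Delta>) G r)}"
        unfolding eq by (rule measure_maximal[OF refl refl eps pow, unfolded card])
      moreover have "ereal_of_enat (query_complexity (A n \<Delta>) G) \<le> ereal (real \<Delta> powr f \<Delta> * log 2 (real n))"
      proof (rule query_complexity_le)
        fix v r assume v: "v \<in> pverts G"
        interpret L: lca_process "pverts G" "neighbors G" ?R ?K \<Delta> \<alpha> G r by unfold_locales simp
        have "real (num_queries G r (A n \<Delta> v)) \<le> real (L.M ^ ?K + ?m * (1 + \<Delta> * L.M ^ ?K))"
          unfolding eq using L.mis_lca_correct(1)[OF v, of ?m] by (simp only: of_nat_le_iff)
        also have "\<dots> \<le> real \<Delta> powr f \<Delta> * log 2 (real n)"
          unfolding f_def by (rule query_bound[OF 3(2,1) s_def i_def refl L.M_def E_def])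
        finally show "real (num_queries G r (A n \<Delta> v)) \<le> real \<Delta> powr f \<Delta> * log 2 (real n)" .
      qed (use 3 in simp)
      ultimately show ?thesis by simp
    qed
  qed
  ultimately show ?thesis by blast
qed

end
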